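(* Let $N$ agents communicate over an undirected connected graph, let $h_i:\mathbb{R}^n\to\mathbb{R}^n$ ($i=1,\dots,N$) be globally Lipschitz and let $E\in\mathbb{R}^{q\times n}$ have full row rank. Consider the multi-agent system $$\dot x_i=h_i(x_i)+u_i,\qquad y_i=Ex_i,\qquad \dot\xi_i=-\kappa K\sum_{j\in\mathcal{N}_i}(y_j-y_i),\qquad i=1,\dots,N,$$ with $K=EWW^\top E^\top$, with positive gains $\kappa,k_{\mathrm P},k_{\mathrm I}$, and with one of the following two couplings: (A) $u_i=k_{\mathrm P}E^\top\sum_{j\in\mathcal{N}_i}(y_j-y_i)+k_{\mathrm I}E^\top\sum_{j\in\mathcal{N}_i}(\xi_j-\xi_i)$, with arbitrary initial conditions; or (B) $u_i=k_{\mathrm P}E^\top\sum_{j\in\mathcal{N}_i}(y_j-y_i)-k_{\mathrm I}E^\top\xi_i$, with initial conditions satisfying $\sum_{i=1}^N\xi_i(0)=0$. Assume that the blended dynamics $$\dot z_i=Z^\top h_i(Zz_i+W\bar w),\ i=1,\dots,N,\qquad \dot{\bar w}=\frac1N\sum_{i=1}^N W^\top h_i(Zz_i+W\bar w)$$ has a unique equilibrium $(z_1^*,\dots,z_N^*,\bar w^* )$ that is globally exponentially stable with a rate $\mu>0$. Then, with the matrices $Z,W$ and the error coordinates $z_\delta,\bar w_\delta,\widetilde w,\widetilde\xi_\delta$ defined in the context, the following hold in each of the cases (A) and (B). (a) For any positive $\kappa$ and $k_{\mathrm I}$ with $2\kappa>k_{\mathrm I}$, there exists $k_{\mathrm P}^*=k_{\mathrm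 P}^*(\kappa,k_{\mathrm I})$ such that, for each $k_{\mathrm P}>k_{\mathrm P}^*$, the origin of the error system in the variables $(z_\delta,\bar w_\delta,\widetilde w,\widetilde\xi_\delta)$ (written out in the context) is globally exponentially stable. Therefore $x_i(t)$ converges to $x_i^*=Zz_i^*+W\bar w^*$ exponentially fast, for every $i$. (b) Set $\kappa=k_{\mathrm I}=\phi^*k_{\mathrm P}$, where $\phi^*>0$ is sufficiently small (i.e. $\phi^*$ is any number in $(0,\bar\phi)$ for a certain threshold $\bar\phi>0$ depending only on the graph, on $E$ and on which of (A), (B) is used). Then for any positive $\upsilon<\mu$ there exists $k_{\mathrm P}^{**}=k_{\mathrm P}^{**}(\upsilon,\phi^* )>0$ such that, for each $k_{\mathrm P}>k_{\mathrm P}^{**}$, there is a constant $\bar c$ (independent of the initial condition) with $$\left|[e_\delta(t);\widetilde w(t);\widetilde\xi_\delta(t)]\right|\le \bar c\,e^{-(\mu-\upsilon)t}\left|[e_\delta(0);\widetilde w(0);\widetilde\xi_\delta(0)]\right|,\qquad t\ge 0,$$ where $e_\delta=[z_\delta;\bar w_\delta]$. Therefore $x_i(t)$ converges to $x_i^*$ exponentially fast at least with the rate $\mu-\upsilon$.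
   Context: Notation: $[X_1;\cdots;X_N]=[X_1^\top\ \cdots\ X_N^\top]^\top$ (vertical stacking), $1_N=[1;\cdots;1]\in\mathbb{R}^N$, $|\cdot|$ is the Euclidean norm, $\otimes$ is the Kronecker product. $\mathcal{N}_i$ is the set of neighbors of agent $i$. The graph Laplacian $\mathfrak{L}_{\mathrm P}=[l_{ij}]\in\mathbb{R}^{N\times N}$ has, for $i\ne j$, $l_{ij}=-1$ if $(j,i)$ is an edge and $l_{ij}=0$ otherwise, and $l_{ii}=-\sum_{j\neq i}l_{ij}$. The dimensions are $x_i,u_i\in\mathbb{R}^n$, $y_i,\xi_i\in\mathbb{R}^q$, $q\le n$. Matrices: $Z\in\mathbb{R}^{n\times(n-q)}$ and $W\in\mathbb{R}^{n\times q}$ are such that their columns form orthonormal bases of $\ker(E)$ and $\ker(E)^\perp$, respectively ($Z$ is void if $q=n$). $R\in\mathbb{R}^{N\times(N-1)}$ is such that its columns form an orthonormal basis of $\ker(1_N^\top)$. $\Lambda_{\mathrm P}=R^\top\mathfrak{L}_{\mathrm P}R$ (positive definite since the graph is connected), and $\Lambda_{\mathrm I}=\Lambda_{\mathrm P}$ in case (A), $\Lambda_{\mathrm I}=I_{N-1}$ in case (B). The equilibrium of the blended dynamics is globally exponentially stable with rate $\mu>0$ if there is a constant $c$ such that every solution of the blended dynamics satisfies $|e_\delta(t)|\le c\,e^{-\mu t}|e_\delta(0)|$ for $t\ge0$, where $e_\delta=[z-z^*;\bar w-\bar w^*]$, $z=[z_1;\cdots;z_N]$, $z^*=[z_1^*;\cdots;z_N^*]$.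 Coordinates: for the multi-agent system let $x=[x_1;\cdots;x_N]$, $\xi=[\xi_1;\cdots;\xi_N]$, $h(x)=[h_1(x_1);\cdots;h_N(x_N)]$, $z_i=Z^\top x_i$, $w_i=W^\top x_i$, $z=[z_1;\cdots;z_N]$, $w=[w_1;\cdots;w_N]$, $\bar w=\frac1N\sum_i w_i$, $\widetilde w=(R^\top\otimes I_q)w$, $\bar\xi=\frac1N\sum_i\xi_i$, $\widetilde\xi=(R^\top\otimes I_q)\xi$. ($\bar\xi$ is constant in time, and zero in case (B).) Let $x^*=(I_N\otimes Z)z^*+(1_N\otimes W)\bar w^*$ and $\widetilde\xi^*=\frac1{k_{\mathrm I}}(\Lambda_{\mathrm I}\otimes W^\top E^\top)^{-1}(R^\top\otimes W^\top)h(x^* )$. The error coordinates are $z_\delta=z-z^*$, $\bar w_\delta=\bar w-\bar w^*$, $\widetilde w$, and $\widetilde\xi_\delta=\widetilde\xi-\widetilde\xi^*$. Error system: with $x=(I_N\otimes Z)(z_\delta+z^* )+(1_N\otimes W)(\bar w_\delta+\bar w^* )+(R\otimes W)\widetilde w$, $$\dot z_\delta=(I_N\otimes Z^\top)h(x),\qquad \dot{\bar w}_\delta=\tfrac1N(1_N^\top\otimes W^\top)h(x),$$ $$\dot{\widetilde w}=(R^\top\otimes W^\top)(h(x)-h(x^* ))-k_{\mathrm P}(\Lambda_{\mathrm P}\otimes W^\top E^\top EW)\widetilde w-k_{\mathrm I}(\Lambda_{\mathrm I}\otimes W^\top E^\top)\widetilde\xi_\delta,$$ $$\dot{\widetilde\xi}_\delta=\kappa(\Lambda_{\mathrm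 P}\otimes KEW)\widetilde w.$$ *)

theory Defs
  imports
    "HOL-Analysis.Analysis"
    "Jordan_Normal_Form.DL_Rank"
    "Jordan_Normal_Form.Matrix_Kernel"
    "Jordan_Normal_Form.Gauss_Jordan_Elimination"
begin

text \<open>Vectors and matrices are those of Jordan Normal Form, with dimensions given by natural
  numbers: the matrices Z (n rows, n - q columns) and R (N rows, N - 1 columns) are then allowed
  to be void. Agents are numbered from 0 to N - 1.\<close>

hide_type (open) Finite_Cartesian_Product.vec
hide_const (open) Finite_Cartesian_Product.vec Finite_Cartesian_Product.mat
unbundle no vec_syntax
unbundle no inner_syntax

definition enorm :: "real vec \<Rightarrow> real" where
  "enorm v = sqrt (v \<bullet> v)"

definition stack :: "nat \<Rightarrow> nat \<Rightarrow> (nat \<Rightarrow> real vec) \<Rightarrow> real vec" where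
  "stack N d v = vec (N * d) (\<lambda>k. v (k div d) $ (k mod d))"

definition block :: "nat \<Rightarrow> nat \<Rightarrow> real vec \<Rightarrow> real vec" where
  "block d i v = vec d (\<lambda>k. v $ (i * d + k))"

definition kron :: "real mat \<Rightarrow> real mat \<Rightarrow> real mat" (infixl "\<otimes>\<^sub>K" 75) where
  "A \<otimes>\<^sub>K B = mat (dim_row A * dim_row B) (dim_col A * dim_col B)
     (\<lambda>(i, j). A $$ (i div dim_row B, j div dim_col B) * B $$ (i mod dim_row B, j mod dim_col B))"

definition ones :: "nat \<Rightarrow> real mat" where
  "ones N = mat N 1 (\<lambda>_. 1)"

definition orthonormal_basis_cols :: "real mat \<Rightarrow> real vec set \<Rightarrow> bool" where
  "orthonormal_basis_cols M S \<longleftrightarrow>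
     (\<forall>i<dim_col M. \<forall>j<dim_col M. col M i \<bullet> col M j = (if i = j then 1 else 0)) \<and>
     vec_space.col_space (dim_row M) M = S"

definition globally_lipschitz :: "nat \<Rightarrow> (real vec \<Rightarrow> real vec) \<Rightarrow> bool" where
  "globally_lipschitz n f \<longleftrightarrow> f \<in> carrier_vec n \<rightarrow> carrier_vec n \<and>
     (\<exists>L. \<forall>u\<in>carrier_vec n. \<forall>v\<in>carrier_vec n. enorm (f u - f v) \<le> L * enorm (u - v))"

text \<open>The d-dimensional trajectory f has derivative f' at every time in the half-line of
  nonnegative reals (one-sided at 0). Values at negative times are irrelevant.\<close>

definition has_derivative_traj :: "nat \<Rightarrow> (real \<Rightarrow> real vec) \<Rightarrow> (real \<Rightarrow> real vec) \<Rightarrow> bool" where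
  "has_derivative_traj d f f' \<longleftrightarrow> (\<forall>t\<ge>0. f t \<in> carrier_vec d \<and> f' t \<in> carrier_vec d \<and>
     (\<forall>k<d. ((\<lambda>s. f s $ k) has_real_derivative f' t $ k) (at t within {0..})))"

definition exp_bound :: "real \<Rightarrow> real \<Rightarrow> (real \<Rightarrow> real vec) \<Rightarrow> bool" where
  "exp_bound c r f \<longleftrightarrow> (\<forall>t\<ge>0. enorm (f t) \<le> c * exp (- r * t) * enorm (f 0))"

text \<open>An undirected edge is represented by both of its orientations.\<close>

definition connected_graph :: "nat \<Rightarrow> (nat \<times> nat) set \<Rightarrow> bool" where
  "connected_graph N G \<longleftrightarrow> G \<subseteq> {..<N} \<times> {..<N} \<and> sym G \<and> irrefl G \<and>
     (\<forall>i<N. \<forall>j<N. (i, j) \<in> G\<^sup>*)"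

definition nbrs :: "(nat \<times> nat) set \<Rightarrow> nat \<Rightarrow> nat set" where
  "nbrs G i = {j. (j, i) \<in> G}"

definition laplacian :: "nat \<Rightarrow> (nat \<times> nat) set \<Rightarrow> real mat" where
  "laplacian N G = (let l = (\<lambda>i j. if (j, i) \<in> G then - 1 else 0) in
     mat N N (\<lambda>(i, j). if i = j then - (\<Sum>k\<in>{..<N} - {i}. l i k) else l i j))"

text \<open>\<open>CoupA\<close>: agents exchange both outputs and integrator states; \<open>CoupB\<close>: only outputs
  are exchanged and the integrators start with zero sum.\<close>

datatype coupling = CoupA | CoupB

definition Lambda_P :: "nat \<Rightarrow> (nat \<times> nat) set \<Rightarrow> real mat \<Rightarrow> real mat" where
  "Lambda_P N G R = R\<^sup>T * laplacian N G * R"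

definition Lambda_I :: "coupling \<Rightarrow> nat \<Rightarrow> (nat \<times> nat) set \<Rightarrow> real mat \<Rightarrow> real mat" where
  "Lambda_I cpl N G R = (case cpl of CoupA \<Rightarrow> Lambda_P N G R | CoupB \<Rightarrow> 1\<^sub>m (N - 1))"

definition gain_K :: "real mat \<Rightarrow> real mat \<Rightarrow> real mat" where
  "gain_K E W = E * W * W\<^sup>T * E\<^sup>T"

definition control ::
  "coupling \<Rightarrow> nat \<Rightarrow> (nat \<times> nat) set \<Rightarrow> real mat \<Rightarrow> real \<Rightarrow> real \<Rightarrow>
   (nat \<Rightarrow> real vec) \<Rightarrow> (nat \<Rightarrow> real vec) \<Rightarrow> nat \<Rightarrow> real vec" where
  "control cpl q G E kP kI y \<xi> i =
     kP \<cdot>\<^sub>v (E\<^sup>T *\<^sub>v finsum_vec TYPE(real) q (\<lambda>j. y j - y i) (nbrs G i)) +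
     (case cpl of
        CoupA \<Rightarrow> kI \<cdot>\<^sub>v (E\<^sup>T *\<^sub>v finsum_vec TYPE(real) q (\<lambda>j. \<xi> j - \<xi> i) (nbrs G i))
      | CoupB \<Rightarrow> - (kI \<cdot>\<^sub>v (E\<^sup>T *\<^sub>v \<xi> i)))"

definition mas_solution ::
  "coupling \<Rightarrow> nat \<Rightarrow> nat \<Rightarrow> nat \<Rightarrow> (nat \<times> nat) set \<Rightarrow> real mat \<Rightarrow> (nat \<Rightarrow> real vec \<Rightarrow> real vec) \<Rightarrow>
   real mat \<Rightarrow> real \<Rightarrow> real \<Rightarrow> real \<Rightarrow> (nat \<Rightarrow> real \<Rightarrow> real vec) \<Rightarrow> (nat \<Rightarrow> real \<Rightarrow> real vec) \<Rightarrow> bool" where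
  "mas_solution cpl N n q G E h W \<kappa> kP kI x \<xi> \<longleftrightarrow>
     (\<forall>i<N. has_derivative_traj n (x i)
        (\<lambda>t. h i (x i t) + control cpl q G E kP kI (\<lambda>j. E *\<^sub>v x j t) (\<lambda>j. \<xi> j t) i)) \<and>
     (\<forall>i<N. has_derivative_traj q (\<xi> i)
        (\<lambda>t. (- \<kappa>) \<cdot>\<^sub>v (gain_K E W *\<^sub>v
           finsum_vec TYPE(real) q (\<lambda>j. E *\<^sub>v x j t - E *\<^sub>v x i t) (nbrs G i)))) \<and>
     (cpl = CoupB \<longrightarrow> finsum_vec TYPE(real) q (\<lambda>i. \<xi> i 0) {..<N} = 0\<^sub>v q)"

definition blended_z ::
  "(nat \<Rightarrow> real vec \<Rightarrow> real vec) \<Rightarrow> real mat \<Rightarrow> real mat \<Rightarrow> nat \<Rightarrow> (nat \<Rightarrow> real vec) \<Rightarrow> real vec \<Rightarrow> real vec"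
  where
  "blended_z h Z W i z w = Z\<^sup>T *\<^sub>v h i (Z *\<^sub>v z i + W *\<^sub>v w)"

definition blended_w ::
  "nat \<Rightarrow> nat \<Rightarrow> (nat \<Rightarrow> real vec \<Rightarrow> real vec) \<Rightarrow> real mat \<Rightarrow> real mat \<Rightarrow>
   (nat \<Rightarrow> real vec) \<Rightarrow> real vec \<Rightarrow> real vec" where
  "blended_w N q h Z W z w =
     (1 / real N) \<cdot>\<^sub>v finsum_vec TYPE(real) q (\<lambda>i. W\<^sup>T *\<^sub>v h i (Z *\<^sub>v z i + W *\<^sub>v w)) {..<N}"

definition blended_solution ::
  "nat \<Rightarrow> nat \<Rightarrow> nat \<Rightarrow> (nat \<Rightarrow> real vec \<Rightarrow> real vec) \<Rightarrow> real mat \<Rightarrow> real mat \<Rightarrow>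
   (nat \<Rightarrow> real \<Rightarrow> real vec) \<Rightarrow> (real \<Rightarrow> real vec) \<Rightarrow> bool" where
  "blended_solution N n q h Z W z w \<longleftrightarrow>
     (\<forall>i<N. has_derivative_traj (n - q) (z i) (\<lambda>t. blended_z h Z W i (\<lambda>j. z j t) (w t))) \<and>
     has_derivative_traj q w (\<lambda>t. blended_w N q h Z W (\<lambda>j. z j t) (w t))"

definition blended_equilibrium ::
  "nat \<Rightarrow> nat \<Rightarrow> nat \<Rightarrow> (nat \<Rightarrow> real vec \<Rightarrow> real vec) \<Rightarrow> real mat \<Rightarrow> real mat \<Rightarrow>
   (nat \<Rightarrow> real vec) \<Rightarrow> real vec \<Rightarrow> bool" where
  "blended_equilibrium N n q h Z W z w \<longleftrightarrow>
     (\<forall>i<N. z i \<in> carrier_vec (n - q)) \<and> w \<in> carrier_vec q \<and>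
     (\<forall>i<N. blended_z h Z W i z w = 0\<^sub>v (n - q)) \<and> blended_w N q h Z W z w = 0\<^sub>v q"

definition unique_blended_equilibrium ::
  "nat \<Rightarrow> nat \<Rightarrow> nat \<Rightarrow> (nat \<Rightarrow> real vec \<Rightarrow> real vec) \<Rightarrow> real mat \<Rightarrow> real mat \<Rightarrow>
   (nat \<Rightarrow> real vec) \<Rightarrow> real vec \<Rightarrow> bool" where
  "unique_blended_equilibrium N n q h Z W zs ws \<longleftrightarrow>
     blended_equilibrium N n q h Z W zs ws \<and>
     (\<forall>z w. blended_equilibrium N n q h Z W z w \<longrightarrow> (\<forall>i<N. z i = zs i) \<and> w = ws)"

definition blended_ges ::
  "nat \<Rightarrow> nat \<Rightarrow> nat \<Rightarrow> (nat \<Rightarrow> real vec \<Rightarrow> real vec) \<Rightarrow> real mat \<Rightarrow> real mat \<Rightarrow>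
   (nat \<Rightarrow> real vec) \<Rightarrow> real vec \<Rightarrow> real \<Rightarrow> bool" where
  "blended_ges N n q h Z W zs ws \<mu> \<longleftrightarrow>
     (\<exists>c. \<forall>z w. blended_solution N n q h Z W z w \<longrightarrow>
        exp_bound c \<mu> (\<lambda>t. (stack N (n - q) (\<lambda>i. z i t) - stack N (n - q) zs) @\<^sub>v (w t - ws)))"

definition stacked_h :: "nat \<Rightarrow> nat \<Rightarrow> (nat \<Rightarrow> real vec \<Rightarrow> real vec) \<Rightarrow> real vec \<Rightarrow> real vec" where
  "stacked_h N n h x = stack N n (\<lambda>i. h i (block n i x))"

definition x_star ::
  "nat \<Rightarrow> nat \<Rightarrow> nat \<Rightarrow> real mat \<Rightarrow> real mat \<Rightarrow> (nat \<Rightarrow> real vec) \<Rightarrow> real vec \<Rightarrow> real vec" where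
  "x_star N n q Z W zs ws =
     (1\<^sub>m N \<otimes>\<^sub>K Z) *\<^sub>v stack N (n - q) zs + (ones N \<otimes>\<^sub>K W) *\<^sub>v ws"

text \<open>The inverted matrix is invertible whenever the graph is connected and E has full row rank, so
  \<open>mat_inverse\<close> yields \<open>Some\<close>.\<close>

definition xi_star ::
  "coupling \<Rightarrow> nat \<Rightarrow> nat \<Rightarrow> nat \<Rightarrow> (nat \<times> nat) set \<Rightarrow> real mat \<Rightarrow> (nat \<Rightarrow> real vec \<Rightarrow> real vec) \<Rightarrow>
   real mat \<Rightarrow> real mat \<Rightarrow> real mat \<Rightarrow> (nat \<Rightarrow> real vec) \<Rightarrow> real vec \<Rightarrow> real \<Rightarrow> real vec" where
  "xi_star cpl N n q G E h Z W R zs ws kI =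
     (1 / kI) \<cdot>\<^sub>v (the (mat_inverse (Lambda_I cpl N G R \<otimes>\<^sub>K (W\<^sup>T * E\<^sup>T))) *\<^sub>v
       ((R\<^sup>T \<otimes>\<^sub>K W\<^sup>T) *\<^sub>v stacked_h N n h (x_star N n q Z W zs ws)))"

definition error_solution ::
  "coupling \<Rightarrow> nat \<Rightarrow> nat \<Rightarrow> nat \<Rightarrow> (nat \<times> nat) set \<Rightarrow> real mat \<Rightarrow> (nat \<Rightarrow> real vec \<Rightarrow> real vec) \<Rightarrow>
   real mat \<Rightarrow> real mat \<Rightarrow> real mat \<Rightarrow> (nat \<Rightarrow> real vec) \<Rightarrow> real vec \<Rightarrow> real \<Rightarrow> real \<Rightarrow> real \<Rightarrow>
   (real \<Rightarrow> real vec) \<Rightarrow> (real \<Rightarrow> real vec) \<Rightarrow> (real \<Rightarrow> real vec) \<Rightarrow> (real \<Rightarrow> real vec) \<Rightarrow> bool" where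
  "error_solution cpl N n q G E h Z W R zs ws \<kappa> kP kI z\<delta> w\<delta> wt \<xi>\<delta> \<longleftrightarrow>
     (let x = (\<lambda>t. (1\<^sub>m N \<otimes>\<^sub>K Z) *\<^sub>v (z\<delta> t + stack N (n - q) zs) +
                   (ones N \<otimes>\<^sub>K W) *\<^sub>v (w\<delta> t + ws) + (R \<otimes>\<^sub>K W) *\<^sub>v wt t);
          H = stacked_h N n h
      in has_derivative_traj (N * (n - q)) z\<delta> (\<lambda>t. (1\<^sub>m N \<otimes>\<^sub>K Z\<^sup>T) *\<^sub>v H (x t)) \<and>
         has_derivative_traj q w\<delta>
           (\<lambda>t. (1 / real N) \<cdot>\<^sub>v (((ones N)\<^sup>T \<otimes>\<^sub>K W\<^sup>T) *\<^sub>v H (x t))) \<and>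
         has_derivative_traj ((N - 1) * q) wt
           (\<lambda>t. (R\<^sup>T \<otimes>\<^sub>K W\<^sup>T) *\<^sub>v (H (x t) - H (x_star N n q Z W zs ws))
              - kP \<cdot>\<^sub>v ((Lambda_P N G R \<otimes>\<^sub>K (W\<^sup>T * E\<^sup>T * E * W)) *\<^sub>v wt t)
              - kI \<cdot>\<^sub>v ((Lambda_I cpl N G R \<otimes>\<^sub>K (W\<^sup>T * E\<^sup>T)) *\<^sub>v \<xi>\<delta> t)) \<and>
         has_derivative_traj ((N - 1) * q) \<xi>\<delta>
           (\<lambda>t. \<kappa> \<cdot>\<^sub>v ((Lambda_P N G R \<otimes>\<^sub>K (gain_K E W * E * W)) *\<^sub>v wt t)))"

definition error_exp_bound ::
  "coupling \<Rightarrow> nat \<Rightarrow> nat \<Rightarrow> nat \<Rightarrow> (nat \<times> nat) set \<Rightarrow> real mat \<Rightarrow> (nat \<Rightarrow> real vec \<Rightarrow> real vec) \<Rightarrow>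
   real mat \<Rightarrow> real mat \<Rightarrow> real mat \<Rightarrow> (nat \<Rightarrow> real vec) \<Rightarrow> real vec \<Rightarrow> real \<Rightarrow> real \<Rightarrow> real \<Rightarrow>
   real \<Rightarrow> real \<Rightarrow> bool" where
  "error_exp_bound cpl N n q G E h Z W R zs ws \<kappa> kP kI c r \<longleftrightarrow>
     (\<forall>z\<delta> w\<delta> wt \<xi>\<delta>. error_solution cpl N n q G E h Z W R zs ws \<kappa> kP kI z\<delta> w\<delta> wt \<xi>\<delta> \<longrightarrow>
        exp_bound c r (\<lambda>t. z\<delta> t @\<^sub>v w\<delta> t @\<^sub>v wt t @\<^sub>v \<xi>\<delta> t))"

definition error_coords ::
  "coupling \<Rightarrow> nat \<Rightarrow> nat \<Rightarrow> nat \<Rightarrow> (nat \<times> nat) set \<Rightarrow> real mat \<Rightarrow> (nat \<Rightarrow> real vec \<Rightarrow> real vec) \<Rightarrow>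
   real mat \<Rightarrow> real mat \<Rightarrow> real mat \<Rightarrow> (nat \<Rightarrow> real vec) \<Rightarrow> real vec \<Rightarrow> real \<Rightarrow>
   (nat \<Rightarrow> real \<Rightarrow> real vec) \<Rightarrow> (nat \<Rightarrow> real \<Rightarrow> real vec) \<Rightarrow> real \<Rightarrow> real vec" where
  "error_coords cpl N n q G E h Z W R zs ws kI x \<xi> t =
     (stack N (n - q) (\<lambda>i. Z\<^sup>T *\<^sub>v x i t) - stack N (n - q) zs) @\<^sub>v
     ((1 / real N) \<cdot>\<^sub>v finsum_vec TYPE(real) q (\<lambda>i. W\<^sup>T *\<^sub>v x i t) {..<N} - ws) @\<^sub>v
     ((R\<^sup>T \<otimes>\<^sub>K 1\<^sub>m q) *\<^sub>v stack N q (\<lambda>i. W\<^sup>T *\<^sub>v x i t)) @\<^sub>v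
     ((R\<^sup>T \<otimes>\<^sub>K 1\<^sub>m q) *\<^sub>v stack N q (\<lambda>i. \<xi> i t) - xi_star cpl N n q G E h Z W R zs ws kI)"

definition mas_exp_bound ::
  "coupling \<Rightarrow> nat \<Rightarrow> nat \<Rightarrow> nat \<Rightarrow> (nat \<times> nat) set \<Rightarrow> real mat \<Rightarrow> (nat \<Rightarrow> real vec \<Rightarrow> real vec) \<Rightarrow>
   real mat \<Rightarrow> real mat \<Rightarrow> real mat \<Rightarrow> (nat \<Rightarrow> real vec) \<Rightarrow> real vec \<Rightarrow> real \<Rightarrow> real \<Rightarrow> real \<Rightarrow>
   real \<Rightarrow> real \<Rightarrow> bool" where
  "mas_exp_bound cpl N n q G E h Z W R zs ws \<kappa> kP kI c r \<longleftrightarrow>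
     (\<forall>x \<xi>. mas_solution cpl N n q G E h W \<kappa> kP kI x \<xi> \<longrightarrow>
        exp_bound c r (error_coords cpl N n q G E h Z W R zs ws kI x \<xi>))"

text \<open>The rate r is common to all solutions; the constant may depend on the solution.\<close>

definition agents_converge ::
  "coupling \<Rightarrow> nat \<Rightarrow> nat \<Rightarrow> nat \<Rightarrow> (nat \<times> nat) set \<Rightarrow> real mat \<Rightarrow> (nat \<Rightarrow> real vec \<Rightarrow> real vec) \<Rightarrow>
   real mat \<Rightarrow> real mat \<Rightarrow> (nat \<Rightarrow> real vec) \<Rightarrow> real vec \<Rightarrow> real \<Rightarrow> real \<Rightarrow> real \<Rightarrow> real \<Rightarrow> bool" where
  "agents_converge cpl N n q G E h Z W zs ws \<kappa> kP kI r \<longleftrightarrow>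
     (\<forall>x \<xi>. mas_solution cpl N n q G E h W \<kappa> kP kI x \<xi> \<longrightarrow>
        (\<exists>C. \<forall>i<N. \<forall>t\<ge>0. enorm (x i t - (Z *\<^sub>v zs i + W *\<^sub>v ws)) \<le> C * exp (- r * t)))"

end

theory Submission
  imports Defs
begin

text \<open>The columns of \<open>Z\<close> and \<open>W\<close> split the state of each agent, and \<open>ones N\<close> and \<open>R\<close> split the \<open>w\<close> parts of
all agents into mean and disagreement. Feedback enters through \<open>E\<^sup>T\<close> and is therefore invisible in the
\<open>z\<close> coordinates; it cancels in the mean, for the Laplacian annihilates \<open>ones N\<close> and, in case (B), the
mean of \<open>\<xi>\<close> stays zero. Hence the slow error \<open>e = [z\<delta>; w\<delta>]\<close> obeys the blended dynamics up to
a perturbation bounded by a multiple of the disagreement \<open>wt\<close>, whereas \<open>(wt, \<xi>\<delta>)\<close> obeys a linear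
equation with a forcing term bounded by a multiple of \<open>enorm e + enorm wt\<close>. The theorem is a statement
about this interconnection (\<open>mas_solution_error_coords\<close> leads from the agents to it).

For the slow part, exponential stability with rate \<open>\<mu>\<close> yields for every \<open>\<rho> < \<mu>\<close> a converse Lyapunov
function \<open>U\<close> that lies between two multiples of the norm, is Lipschitz on the whole space, and decays
at the rate \<open>\<rho>\<close> (\<open>converse_lyapunov\<close>). It is in general not differentiable; derivatives are
replaced by those of functions touching it from above (\<open>exp_bound_of_right_majorant\<close>). As dimensions
are numbers and not types, this theory is developed in Banach spaces and transferred by embedding the
vectors of all dimensions into one function space (\<open>vector_field_converse_lyapunov\<close>).

For the fast part, \<open>V = (\<alpha> * (w \<bullet> (Y *\<^sub>v w)) + \<beta> * (\<xi> \<bullet> \<xi>)) / 2 + \<epsilon> * (w \<bullet> (T *\<^sub>v \<xi>))\<close> serves, where \<open>Y\<close> is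
positive definite and makes the two ways in which \<open>w\<close> and \<open>\<xi>\<close> act on each other balance
(\<open>setup_lyapunov_matrices\<close>). Proportional feedback dissipates \<open>w\<close>, and the small mixed term passes
some of this dissipation on to \<open>\<xi>\<close>.

The sum \<open>U\<^sup>2 + V\<close> decays whenever one scalar inequality between constants and gains holds
(\<open>decay_certificate\<close>, \<open>interconnection_decay\<close>). For fixed \<open>\<kappa>\<close> and \<open>kI\<close> it holds for large \<open>kP\<close> with
\<open>\<epsilon>\<close> and the rate of order \<open>1 / kP\<close> (\<open>decay_certificate_fixed_gains\<close>). If \<open>\<kappa>\<close> and \<open>kI\<close> grow in
proportion to \<open>kP\<close>, the whole fast part becomes arbitrarily fast, and any rate below \<open>\<rho>\<close> is
attained (\<open>decay_certificate_proportional_gains\<close>).\<close>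

section \<open>Comparison and global solutions of differential equations\<close>

text \<open>The function \<open>T\<close> need not be differentiable: its decay is expressed by differentiable
  functions that lie above it to the right of a point and touch it there. If \<open>T t * exp (- a * t)\<close>
  exceeded its initial value by more than a small linear slack, then at the last time \<open>m\<close> before
  this happens the touching function would have a negative right derivative and would keep \<open>T\<close>
  below the level a little longer.\<close>

lemma exp_bound_of_right_majorant:
  fixes T :: "real \<Rightarrow> real"
  assumes cont: "continuous_on {0..} T"
    and maj: "\<And>t. 0 \<le> t \<Longrightarrow> \<exists>B d. B t = T t \<and> (\<forall>s\<ge>t. T s \<le> B s) \<and>
      (B has_real_derivative d) (at t within {t..}) \<and> d \<le> a * T t"
    and t: "0 \<le> t"
  shows "T t \<le> exp (a * t) * T 0"
proof -
  have "T t * exp (- a * t) \<le> T 0 + \<epsilon>" if "\<epsilon> > 0" for \<epsilon> :: real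
  proof (cases "t = 0")
    case True
    with that show ?thesis by simp
  next
    case False
    with t have t: "0 < t" by simp
    \<comment> \<open>the slack that makes the derivative at m strictly negative\<close>
    define \<eta> where "\<eta> = \<epsilon> / t"
    have \<eta>: "\<eta> > 0" using that t by (simp add: \<eta>_def)
    define g where "g = (\<lambda>s. T s * exp (- a * s) - \<eta> * s)"
    have "g t \<le> g 0"
    proof (rule ccontr)
      assume "\<not> g t \<le> g 0"
      then have gt: "g 0 < g t" by simp
      define S where "S = {0..t} \<inter> g -` {..g 0}"
      have cg: "continuous_on {0..t} g" unfolding g_def
        by (intro continuous_intros continuous_on_subset[OF cont]) auto
      have cS: "closed S" unfolding S_def
        by (intro continuous_closed_preimage cg) auto
      have S0: "0 \<in> S" using t by (simp add: S_def)
      have bS: "bdd_above S" by (auto simp: S_def intro!: bdd_aboveI[of _ t])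
      define m where "m = Sup S"
      have mS: "m \<in> S" unfolding m_def using closed_contains_Sup[OF _ bS cS] S0 by auto
      then have m: "0 \<le> m" "m \<le> t" "g m \<le> g 0" by (auto simp: S_def)
      with gt have mt: "m < t" by (cases "m = t") auto
      have above: "g 0 < g s" if "m < s" "s \<le> t" for s
      proof (rule ccontr)
        assume "\<not> g 0 < g s"
        then have "s \<in> S" using that m by (auto simp: S_def)
        then have "s \<le> m" unfolding m_def by (rule cSup_upper[OF _ bS])
        with that show False by simp
      qed
      obtain B d where B: "B m = T m" "\<forall>s\<ge>m. T s \<le> B s"
        "(B has_real_derivative d) (at m within {m..})" "d \<le> a * T m"
        using maj[OF m(1)] by blast
      define G where "G = (\<lambda>s. B s * exp (- a * s) - \<eta> * s)"
      have "(G has_real_derivative (d * exp (- a * m) + - a * exp (- a * m) * B m - \<eta>)) (at m within {m..})"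
        unfolding G_def by (rule derivative_eq_intros B(3) refl | simp)+
      moreover have "d * exp (- a * m) + - a * exp (- a * m) * B m - \<eta> < 0"
      proof -
        have "(d - a * T m) * exp (- a * m) \<le> 0"
          using B(4) by (intro mult_nonpos_nonneg) auto
        moreover have "d * exp (- a * m) + - a * exp (- a * m) * B m = (d - a * T m) * exp (- a * m)"
          by (simp add: B(1) algebra_simps)
        ultimately show ?thesis using \<eta> by linarith
      qed
      ultimately obtain \<delta> where \<delta>: "\<delta> > 0" "\<And>h. h > 0 \<Longrightarrow> m + h \<in> {m..} \<Longrightarrow> h < \<delta> \<Longrightarrow> G (m + h) < G m"
        using has_real_derivative_neg_dec_right by blast
      define h where "h = min (\<delta> / 2) (t - m)"
      have h: "0 < h" "h < \<delta>" "m + h \<le> t" using \<delta>(1) mt by (auto simp: h_def)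
      have "g (m + h) \<le> G (m + h)" using B(2) h by (simp add: g_def G_def)
      also have "\<dots> < G m" using \<delta>(2) h by simp
      also have "\<dots> = g m" using B(1) by (simp add: g_def G_def)
      also have "\<dots> \<le> g 0" by fact
      finally show False using above[of "m + h"] h by simp
    qed
    then show ?thesis using t by (simp add: g_def \<eta>_def)
  qed
  then have "T t * exp (- a * t) \<le> T 0" by (rule field_le_epsilon)
  then show ?thesis by (simp add: exp_minus field_simps)
qed

lemma has_vector_derivative_integral_halfline:
  fixes g :: "real \<Rightarrow> 'a::banach"
  assumes "continuous_on {0..} g" "0 \<le> t"
  shows "((\<lambda>u. integral {0..u} g) has_vector_derivative g t) (at t within {0..})"
proof -
  have "((\<lambda>u. integral {0..u} g) has_vector_derivative g t) (at t within {0..t+1})"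
    using assms by (intro integral_has_vector_derivative continuous_on_subset[OF assms(1)]) auto
  moreover have "at t within {0..t+1} = at t within {0..}"
    by (rule at_within_nhd[of _ "{..<t+1}"]) auto
  ultimately show ?thesis by simp
qed

text \<open>Picard iteration in a weighted supremum norm. A trajectory is represented by the bounded
  function \<open>y\<close> with trajectory \<open>exp (l * s) *\<^sub>R y s\<close>; on these functions the integral operator has
  Lipschitz constant \<open>L / l\<close>, which is below 1 for \<open>l = 2 * L + 1\<close>. The contraction principle then
  yields a solution on the whole half-line at once, without continuation of local solutions.\<close>

lemma global_solution_exists:
  fixes f :: "'a::banach \<Rightarrow> 'a"
  assumes lip: "L-lipschitz_on UNIV f" and f0: "f 0 = 0"
  shows "\<exists>y. y 0 = x0 \<and> (\<forall>t\<ge>0. (y has_vector_derivative f (y t)) (at t within {0..}))"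
proof -
  have L: "0 \<le> L" using lip by (rule lipschitz_on_nonneg)
  have fl: "norm (f a - f b) \<le> L * norm (a - b)" for a b
    using lipschitz_onD[OF lip, of a b] by (simp add: dist_norm)
  have cf: "continuous_on S f" for S
    using lipschitz_on_continuous_on[OF lip] continuous_on_subset by blast
  define l where "l = 2 * L + 1"
  have l: "0 < l" using L by (simp add: l_def)
  \<comment> \<open>y is the damped function, so the argument of f is the trajectory itself\<close>
  define g where "g = (\<lambda>(y :: real \<Rightarrow>\<^sub>C 'a) s. f (exp (l * s) *\<^sub>R apply_bcontfun y s))"
  have cg: "continuous_on S (g y)" for y S unfolding g_def
    by (intro continuous_on_compose2[OF cf[of UNIV]] continuous_intros) auto
  have ig: "g y integrable_on {0..t}" for y t
    by (intro integrable_continuous_real cg)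
  define J where "J = (\<lambda>y t. integral {0..t} (g y))"
  have expint: "((\<lambda>s. M * exp (l * s)) has_integral (M * (exp (l * t) - 1) / l)) {0..t}"
    if "0 \<le> t" for t M
  proof -
    have "((\<lambda>s. M * exp (l * s)) has_integral (M * exp (l * t) / l - M * exp (l * 0) / l)) {0..t}"
      using that l
      by (intro fundamental_theorem_of_calculus)
        (auto intro!: derivative_eq_intros simp flip: has_real_derivative_iff_has_vector_derivative)
    then show ?thesis by (simp add: algebra_simps diff_divide_distrib)
  qed
  have Jdiff: "norm (J y t - J z t) \<le> L * dist y z * (exp (l * t) - 1) / l" if "0 \<le> t" for y z t
  proof -
    have "J y t - J z t = integral {0..t} (\<lambda>s. g y s - g z s)"
      unfolding J_def by (rule integral_diff[symmetric]) (rule ig)+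
    also have "norm \<dots> \<le> integral {0..t} (\<lambda>s. L * dist y z * exp (l * s))"
    proof (rule integral_norm_bound_integral)
      show "(\<lambda>s. g y s - g z s) integrable_on {0..t}" by (intro integrable_diff ig)
      show "(\<lambda>s. L * dist y z * exp (l * s)) integrable_on {0..t}"
        using expint[OF that] by blast
      show "norm (g y s - g z s) \<le> L * dist y z * exp (l * s)" for s
      proof -
        have "norm (g y s - g z s) \<le> L * norm (exp (l * s) *\<^sub>R (apply_bcontfun y s - apply_bcontfun z s))"
          unfolding g_def scaleR_diff_right by (rule fl)
        also have "\<dots> = L * (exp (l * s) * dist (apply_bcontfun y s) (apply_bcontfun z s))"
          by (simp add: dist_norm)
        also have "\<dots> \<le> L * (exp (l * s) * dist y z)"
          using L by (intro mult_left_mono dist_bounded) auto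
        finally show ?thesis by (simp add: algebra_simps)
      qed
    qed
    also have "\<dots> = L * dist y z * (exp (l * t) - 1) / l"
      using expint[OF that] by (rule integral_unique)
    finally show ?thesis .
  qed
  have J0: "J 0 t = 0" for t unfolding J_def g_def by (simp add: f0)
  have contract: "exp (- l * t) * norm (J y t - J z t) \<le> (L / l) * dist y z" if "0 \<le> t" for y z t
  proof -
    have "exp (- l * t) * norm (J y t - J z t) \<le> exp (- l * t) * (L * dist y z * (exp (l * t) - 1) / l)"
      by (intro mult_left_mono Jdiff that) auto
    also have "\<dots> = (L / l) * dist y z * (1 - exp (- l * t))"
      using l by (simp add: field_simps exp_minus)
    also have "\<dots> \<le> (L / l) * dist y z * 1"
      using L l by (intro mult_left_mono) auto
    finally show ?thesis by simp
  qed
  have cJ: "continuous_on {0..} (J y)" for y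
    unfolding J_def continuous_on_eq_continuous_within
    by (auto intro!: has_vector_derivative_continuous[OF has_vector_derivative_integral_halfline] cg)
  \<comment> \<open>bounded continuous functions live on the whole line: extend constantly to negative times\<close>
  define \<Phi> where "\<Phi> = (\<lambda>y t. exp (- l * max 0 t) *\<^sub>R (x0 + J y (max 0 t)))"
  have bc: "\<Phi> y \<in> bcontfun" for y
  proof (rule bcontfun_normI)
    show "continuous_on UNIV (\<Phi> y)" unfolding \<Phi>_def
      by (intro continuous_intros continuous_on_compose2[OF cJ]) auto
    fix t :: real
    have "norm (\<Phi> y t) \<le> exp (- l * max 0 t) * (norm x0 + norm (J y (max 0 t) - J 0 (max 0 t)))"
      unfolding \<Phi>_def by (simp add: J0 norm_triangle_ineq)
    also have "\<dots> \<le> norm x0 + (L / l) * dist y 0"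
    proof -
      have "exp (- l * max 0 t) * norm x0 \<le> 1 * norm x0"
        using l by (intro mult_right_mono) auto
      then show ?thesis using contract[of "max 0 t" y 0] by (simp add: algebra_simps)
    qed
    finally show "norm (\<Phi> y t) \<le> norm x0 + (L / l) * dist y 0" .
  qed
  define P where "P = (\<lambda>y. Bcontfun (\<Phi> y))"
  have P: "apply_bcontfun (P y) t = \<Phi> y t" for y t
    unfolding P_def by (simp add: Bcontfun_inverse[OF bc])
  have "\<exists>!y. P y = y"
  proof (rule banach_fix_type[of "L / l"])
    show "0 \<le> L / l" "L / l < 1" using L l by (auto simp: l_def)
    show "\<forall>y z. dist (P y) (P z) \<le> L / l * dist y z"
    proof (intro allI dist_bound)
      fix y z t
      have "dist (apply_bcontfun (P y) t) (apply_bcontfun (P z) t)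
        = norm (exp (- l * max 0 t) *\<^sub>R (J y (max 0 t) - J z (max 0 t)))"
        unfolding P \<Phi>_def dist_norm by (simp add: algebra_simps)
      also have "\<dots> = exp (- l * max 0 t) * norm (J y (max 0 t) - J z (max 0 t))" by simp
      also have "\<dots> \<le> (L / l) * dist y z" by (rule contract) simp
      finally show "dist (apply_bcontfun (P y) t) (apply_bcontfun (P z) t) \<le> L / l * dist y z" .
    qed
  qed
  then obtain y where y: "P y = y" by blast
  define x where "x = (\<lambda>t. x0 + J y t)"
  have xy: "x t = exp (l * t) *\<^sub>R apply_bcontfun y t" if "0 \<le> t" for t
  proof -
    have "apply_bcontfun y t = exp (- l * t) *\<^sub>R (x0 + J y t)"
      using P[of y t] that by (simp add: y \<Phi>_def)
    then have "exp (l * t) *\<^sub>R apply_bcontfun y t = (exp (l * t) * exp (- l * t)) *\<^sub>R (x0 + J y t)"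
      by simp
    also have "exp (l * t) * exp (- l * t) = 1" by (simp flip: exp_add)
    finally show ?thesis by (simp add: x_def)
  qed
  have "(x has_vector_derivative f (x t)) (at t within {0..})" if "0 \<le> t" for t
  proof -
    have "(J y has_vector_derivative g y t) (at t within {0..})"
      unfolding J_def by (rule has_vector_derivative_integral_halfline[OF cg that])
    moreover have "g y t = f (x t)" using xy[OF that] by (simp add: g_def)
    ultimately show ?thesis unfolding x_def by (auto intro!: derivative_eq_intros)
  qed
  moreover have "x 0 = x0" by (simp add: x_def J_def)
  ultimately show ?thesis by blast
qed

text \<open>The norm is not differentiable at 0. Splitting \<open>d\<close> into its linearization and a remainder of
  vanishing derivative, and applying the triangle inequality, gives a majorant that is.\<close>

lemma norm_right_majorant:
  fixes d :: "real \<Rightarrow> 'a::real_normed_vector"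
  assumes d: "(d has_vector_derivative v) (at t within {t..})"
  shows "\<exists>B. B t = norm (d t) \<and> (\<forall>s\<ge>t. norm (d s) \<le> B s) \<and>
    (B has_real_derivative norm v) (at t within {t..})"
proof -
  define r where "r = (\<lambda>s. norm ((d s - d t) - (s - t) *\<^sub>R v))"
  have "((\<lambda>s. norm ((d s - d t) - (s - t) *\<^sub>R v) / norm (s - t)) \<longlongrightarrow> 0) (at t within {t..})"
    using d unfolding has_vector_derivative_def has_derivative_iff_norm by simp
  then have "(r has_derivative (\<lambda>_. 0)) (at t within {t..})"
    unfolding has_derivative_iff_norm r_def by simp
  then have r: "(r has_real_derivative 0) (at t within {t..})"
    by (simp add: has_field_derivative_def lambda_zero)
  define B where "B = (\<lambda>s. norm (d t) + (s - t) * norm v + r s)"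
  have "norm (d s) \<le> B s" if "s \<ge> t" for s
  proof -
    have "d s = (d t + (s - t) *\<^sub>R v) + ((d s - d t) - (s - t) *\<^sub>R v)" by simp
    also have "norm \<dots> \<le> norm (d t) + norm ((s - t) *\<^sub>R v) + r s"
      unfolding r_def by (intro order_trans[OF norm_triangle_ineq] add_right_mono norm_triangle_ineq)
    finally show ?thesis using that by (simp add: B_def)
  qed
  moreover have "(B has_real_derivative norm v) (at t within {t..})"
    unfolding B_def by (auto intro!: derivative_eq_intros r)
  ultimately show ?thesis by (intro exI[of _ B]) (auto simp: B_def r_def)
qed

text \<open>Gronwall's inequality; it serves both for the uniqueness of solutions and for the Lipschitz
  constant of the converse Lyapunov function.\<close>

lemma solutions_diverge_at_most_exponentially:
  fixes f :: "'a::real_normed_vector \<Rightarrow> 'a"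
  assumes lip: "L-lipschitz_on UNIV f"
    and y: "\<And>t. 0 \<le> t \<Longrightarrow> (y has_vector_derivative f (y t)) (at t within {0..})"
    and z: "\<And>t. 0 \<le> t \<Longrightarrow> (z has_vector_derivative f (z t)) (at t within {0..})"
    and t: "0 \<le> t"
  shows "norm (y t - z t) \<le> exp (L * t) * norm (y 0 - z 0)"
proof (rule exp_bound_of_right_majorant[OF _ _ t])
  have "continuous_on {0..} y" "continuous_on {0..} z"
    unfolding continuous_on_eq_continuous_within
    by (auto intro: has_vector_derivative_continuous y z)
  then show "continuous_on {0..} (\<lambda>t. norm (y t - z t))" by (intro continuous_intros)
next
  fix t :: real assume t: "0 \<le> t"
  have "((\<lambda>s. y s - z s) has_vector_derivative (f (y t) - f (z t))) (at t within {t..})"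
    using t by (intro has_vector_derivative_diff
        has_vector_derivative_within_subset[OF y] has_vector_derivative_within_subset[OF z]) auto
  from norm_right_majorant[OF this] obtain B where
    "B t = norm (y t - z t)" "\<forall>s\<ge>t. norm (y s - z s) \<le> B s"
    "(B has_real_derivative norm (f (y t) - f (z t))) (at t within {t..})" by blast
  moreover have "norm (f (y t) - f (z t)) \<le> L * norm (y t - z t)"
    using lipschitz_onD[OF lip, of "y t" "z t"] by (simp add: dist_norm)
  ultimately show "\<exists>B d. B t = norm (y t - z t) \<and> (\<forall>s\<ge>t. norm (y s - z s) \<le> B s) \<and>
      (B has_real_derivative d) (at t within {t..}) \<and> d \<le> L * norm (y t - z t)" by blast
qed

section \<open>A globally Lipschitz converse Lyapunov function\<close>

text \<open>\<open>U a\<close> is the supremum over \<open>t \<ge> 0\<close> of \<open>exp (\<rho> * t) * norm (F a t)\<close>, where \<open>F a\<close> is the solution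
  starting at \<open>a\<close>. Shifting time shows that \<open>U\<close> decays along solutions at the rate \<open>\<rho>\<close>, and
  exponential stability bounds it by a multiple of the norm. Since \<open>\<rho> < \<mu>\<close>, after the time
  \<open>\<tau> = ln C / (\<mu> - \<rho>)\<close> the weighted norm is below \<open>norm a\<close>, its value at time 0. So only the
  bounded window up to \<open>\<tau>\<close> matters, in which two solutions separate by a factor of at most
  \<open>exp (L * \<tau>)\<close>: this makes \<open>U\<close> Lipschitz on the whole space with one constant.\<close>

lemma converse_lyapunov:
  fixes f :: "'a::banach \<Rightarrow> 'a"
  assumes lip: "L-lipschitz_on UNIV f" and f0: "f 0 = 0"
    and ges: "\<And>y t. \<lbrakk>\<And>s. 0 \<le> s \<Longrightarrow> (y has_vector_derivative f (y s)) (at s within {0..}); 0 \<le> t\<rbrakk>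
      \<Longrightarrow> norm (y t) \<le> c * exp (- \<mu> * t) * norm (y 0)"
    and \<rho>: "0 < \<rho>" "\<rho> < \<mu>"
  shows "\<exists>U C K. 0 \<le> K \<and> 0 \<le> C \<and> (\<forall>a. norm a \<le> U a \<and> U a \<le> C * norm a) \<and>
    (\<forall>a b. U a \<le> U b + K * norm (a - b)) \<and>
    (\<forall>a. \<exists>y. y 0 = a \<and> (\<forall>t\<ge>0. (y has_vector_derivative f (y t)) (at t within {0..})) \<and>
       (\<forall>t\<ge>0. U (y t) \<le> exp (- \<rho> * t) * U a))"
proof -
  have L: "0 \<le> L" using lip by (rule lipschitz_on_nonneg)
  define sol where "sol = (\<lambda>y. \<forall>t\<ge>0. (y has_vector_derivative f (y t)) (at t within {0..}))"
  obtain F where F0: "F a 0 = a" and F: "sol (F a)" for a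
    using global_solution_exists[OF lip f0] unfolding sol_def by metis
  have diverge: "norm (y t - z t) \<le> exp (L * t) * norm (y 0 - z 0)"
    if "sol y" "sol z" "0 \<le> t" for y z t
    using solutions_diverge_at_most_exponentially[OF lip, of y z t] that by (auto simp: sol_def)
  have F_unique: "F (y 0) t = y t" if "sol y" "0 \<le> t" for y t
    using diverge[OF F that(1,2), of "y 0"] by (simp add: F0)
  define C where "C = max c 1"
  have C: "1 \<le> C" by (simp add: C_def)
  have FC: "norm (F a t) \<le> C * exp (- \<mu> * t) * norm a" if "0 \<le> t" for a t
  proof -
    have "norm (F a t) \<le> c * exp (- \<mu> * t) * norm (F a 0)"
      by (rule ges) (use F that in \<open>auto simp: sol_def\<close>)
    also have "\<dots> \<le> C * exp (- \<mu> * t) * norm a"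
      unfolding F0 by (intro mult_right_mono) (auto simp: C_def)
    finally show ?thesis .
  qed
  define u where "u = (\<lambda>a t. exp (\<rho> * t) * norm (F a t))"
  have uC: "u a t \<le> C * exp (- (\<mu> - \<rho>) * t) * norm a" if "0 \<le> t" for a t
  proof -
    have "u a t \<le> exp (\<rho> * t) * (C * exp (- \<mu> * t) * norm a)"
      unfolding u_def by (intro mult_left_mono FC that) auto
    also have "\<dots> = C * (exp (\<rho> * t) * exp (- \<mu> * t)) * norm a" by simp
    also have "exp (\<rho> * t) * exp (- \<mu> * t) = exp (- (\<mu> - \<rho>) * t)"
      by (simp add: algebra_simps flip: exp_add)
    finally show ?thesis .
  qed
  have uC': "u a t \<le> C * norm a" if "0 \<le> t" for a t
  proof -
    have "exp (- (\<mu> - \<rho>) * t) \<le> 1" using \<rho> that by (simp add: mult_nonpos_nonneg)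
    then have "C * exp (- (\<mu> - \<rho>) * t) * norm a \<le> C * 1 * norm a"
      using C by (intro mult_right_mono mult_left_mono) auto
    then show ?thesis using uC[OF that, of a] by simp
  qed
  define U where "U = (\<lambda>a. SUP t\<in>{0..}. u a t)"
  have bdd: "bdd_above (u a ` {0..})" for a
    using uC' by (auto intro!: bdd_aboveI[of _ "C * norm a"])
  have U_upper: "u a t \<le> U a" if "0 \<le> t" for a t
    unfolding U_def by (rule cSUP_upper[OF _ bdd]) (use that in auto)
  have U_least: "U a \<le> M" if "\<And>t. 0 \<le> t \<Longrightarrow> u a t \<le> M" for a M
    unfolding U_def by (rule cSUP_least) (use that in auto)
  have U1: "norm a \<le> U a" for a using U_upper[of 0 a] by (simp add: u_def F0)
  have U2: "U a \<le> C * norm a" for a by (rule U_least) (rule uC')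
  \<comment> \<open>from this time on, \<open>C * exp (- (\<mu> - \<rho>) * t)\<close> is at most 1\<close>
  define \<tau> where "\<tau> = ln C / (\<mu> - \<rho>)"
  have \<tau>: "0 \<le> \<tau>" using C \<rho> by (simp add: \<tau>_def)
  define K where "K = exp ((\<rho> + L) * \<tau>)"
  have K: "1 \<le> K" using L \<rho> \<tau> by (simp add: K_def)
  have U3: "U a \<le> U b + K * norm (a - b)" for a b
  proof (rule U_least)
    fix t :: real assume t: "0 \<le> t"
    show "u a t \<le> U b + K * norm (a - b)"
    proof (cases "t \<le> \<tau>")
      case True
      have "u a t \<le> exp (\<rho> * t) * (norm (F b t) + norm (F a t - F b t))"
        unfolding u_def by (intro mult_left_mono) (auto simp: norm_triangle_sub)
      also have "\<dots> \<le> u b t + exp (\<rho> * t) * (exp (L * t) * norm (a - b))"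
        using diverge[OF F F t, of a b] by (simp add: u_def distrib_left F0)
      also have "\<dots> = u b t + exp ((\<rho> + L) * t) * norm (a - b)"
        by (simp add: algebra_simps exp_add)
      also have "\<dots> \<le> U b + K * norm (a - b)"
        unfolding K_def using True L \<rho> by (intro add_mono U_upper t mult_right_mono) auto
      finally show ?thesis .
    next
      case False
      have "C = exp ((\<mu> - \<rho>) * \<tau>)" using C \<rho> by (simp add: \<tau>_def)
      also have "\<dots> \<le> exp ((\<mu> - \<rho>) * t)" using False \<rho> by simp
      finally have "C * exp (- (\<mu> - \<rho>) * t) \<le> exp ((\<mu> - \<rho>) * t) * exp (- (\<mu> - \<rho>) * t)"
        by (intro mult_right_mono) auto
      also have "\<dots> = 1" by (metis exp_minus_inverse minus_mult_left)
      finally have "C * exp (- (\<mu> - \<rho>) * t) * norm a \<le> 1 * norm a"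
        by (intro mult_right_mono) auto
      then have "u a t \<le> norm a" using uC[OF t, of a] by simp
      also have "\<dots> \<le> norm b + 1 * norm (a - b)" by (simp add: norm_triangle_sub)
      also have "\<dots> \<le> U b + K * norm (a - b)" by (intro add_mono U1 mult_right_mono K) auto
      finally show ?thesis .
    qed
  qed
  have U4: "U (F a h) \<le> exp (- \<rho> * h) * U a" if h: "0 \<le> h" for a h
  proof (rule U_least)
    fix t :: real assume t: "0 \<le> t"
    \<comment> \<open>a solution shifted in time is a solution, hence the one from F a h\<close>
    have "sol (\<lambda>s. F a (s + h))"
      unfolding sol_def
    proof (intro allI impI)
      fix s :: real assume s: "0 \<le> s"
      have shift: "((\<lambda>x. x + h) has_vector_derivative 1) (at s within {0..})"
        by (auto intro!: derivative_eq_intros)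
      have "(F a has_vector_derivative f (F a (s + h))) (at (s + h) within {0..})"
        using F[of a] s h by (simp add: sol_def)
      then have "(F a has_vector_derivative f (F a (s + h))) (at (s + h) within (\<lambda>x. x + h) ` {0..})"
        by (rule has_vector_derivative_within_subset) (use h in auto)
      from vector_diff_chain_within[OF shift this]
      show "((\<lambda>s. F a (s + h)) has_vector_derivative f (F a (s + h))) (at s within {0..})"
        by (simp add: o_def)
    qed
    from F_unique[OF this t] have "F (F a h) t = F a (t + h)" by simp
    moreover have "exp (- \<rho> * h) * exp (\<rho> * (t + h)) = exp (\<rho> * t)"
      unfolding exp_add[symmetric] by (simp add: distrib_left)
    ultimately have "u (F a h) t = exp (- \<rho> * h) * u a (t + h)"
      unfolding u_def by (metis mult.assoc)
    also have "\<dots> \<le> exp (- \<rho> * h) * U a" using t h by (intro mult_left_mono U_upper) auto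
    finally show "u (F a h) t \<le> exp (- \<rho> * h) * U a" .
  qed
  have "\<exists>y. y 0 = a \<and> sol y \<and> (\<forall>t\<ge>0. U (y t) \<le> exp (- \<rho> * t) * U a)" for a
    using F F0 U4 by (intro exI[of _ "F a"]) blast
  with U1 U2 U3 K C show ?thesis unfolding sol_def
    by (intro exI[of _ U] exI[of _ C] exI[of _ K] conjI allI) (assumption | simp)+
qed

text \<open>Next to the perturbed trajectory \<open>e\<close> runs the unperturbed one \<open>y\<close> through the same point at time
  \<open>t\<close>. Along \<open>y\<close> the function \<open>U\<close> decays; the two separate like \<open>(s - t) *\<^sub>R g\<close> to first order, and
  the Lipschitz property of \<open>U\<close> turns this into the term \<open>K * norm g\<close>.\<close>

lemma lyapunov_majorant_of_perturbed:
  fixes f :: "'a::banach \<Rightarrow> 'a"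
  assumes K: "0 \<le> K" and UK: "\<And>a b. U a \<le> U b + K * norm (a - b)"
    and y: "y t = e t" "(y has_vector_derivative f (e t)) (at t within {t..})"
      "\<And>s. t \<le> s \<Longrightarrow> U (y s) \<le> exp (- \<rho> * (s - t)) * U (e t)"
    and e: "(e has_vector_derivative f (e t) + g) (at t within {t..})"
  shows "\<exists>B. B t = U (e t) \<and> (\<forall>s\<ge>t. U (e s) \<le> B s) \<and>
    (B has_real_derivative - \<rho> * U (e t) + K * norm g) (at t within {t..})"
proof -
  have "((\<lambda>s. e s - y s) has_vector_derivative g) (at t within {t..})"
    using has_vector_derivative_diff[OF e y(2)] by simp
  from norm_right_majorant[OF this] obtain B where B: "B t = norm (e t - y t)"
    "\<And>s. s \<ge> t \<Longrightarrow> norm (e s - y s) \<le> B s" "(B has_real_derivative norm g) (at t within {t..})"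
    by blast
  define D where "D = (\<lambda>s. exp (- \<rho> * (s - t)) * U (e t) + K * B s)"
  have "U (e s) \<le> D s" if "s \<ge> t" for s
  proof -
    have "U (e s) \<le> U (y s) + K * norm (e s - y s)" by (rule UK)
    also have "\<dots> \<le> D s" unfolding D_def using y(3)[OF that] B(2)[OF that] K
      by (intro add_mono mult_left_mono) auto
    finally show ?thesis .
  qed
  moreover have "(D has_real_derivative - \<rho> * U (e t) + K * norm g) (at t within {t..})"
    unfolding D_def by (auto intro!: derivative_eq_intros B(3))
  ultimately show ?thesis using B(1) y(1) by (intro exI[of _ D]) (auto simp: D_def)
qed

section \<open>Vectors and coercive matrices\<close>

lemma enorm_eq_L2_set: "enorm v = L2_set (\<lambda>i. v $ i) {0..<dim_vec v}"
  by (simp add: enorm_def L2_set_def scalar_prod_def power2_eq_square)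

lemma enorm_nonneg [simp]: "0 \<le> enorm v"
  by (simp add: enorm_eq_L2_set)

lemma enorm_square: "(enorm v)\<^sup>2 = v \<bullet> v"
  by (simp add: enorm_def scalar_prod_def sum_nonneg)

lemma enorm_zero_vec [simp]: "enorm (0\<^sub>v n) = 0"
  by (simp add: enorm_def)

lemma enorm_eq_0_iff:
  assumes v: "v \<in> carrier_vec n"
  shows "enorm v = 0 \<longleftrightarrow> v = 0\<^sub>v n"
proof
  assume "enorm v = 0"
  then have "\<forall>i\<in>{0..<n}. v $ i = 0" using v by (simp add: enorm_eq_L2_set L2_set_eq_0_iff)
  then show "v = 0\<^sub>v n" using v by (intro eq_vecI) simp_all
qed simp

lemma enorm_triangle:
  assumes "v \<in> carrier_vec n" "w \<in> carrier_vec n"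
  shows "enorm (v + w) \<le> enorm v + enorm w"
proof -
  have "enorm (v + w) = L2_set (\<lambda>i. v $ i + w $ i) {0..<n}"
    using assms by (auto simp: enorm_eq_L2_set intro!: L2_set_cong)
  also have "\<dots> \<le> enorm v + enorm w"
    using assms L2_set_triangle_ineq[of "\<lambda>i. v $ i" "\<lambda>i. w $ i" "{0..<n}"]
    by (simp add: enorm_eq_L2_set)
  finally show ?thesis .
qed

lemma enorm_smult: "enorm (a \<cdot>\<^sub>v v) = \<bar>a\<bar> * enorm v"
proof -
  have "(a \<cdot>\<^sub>v v) \<bullet> (a \<cdot>\<^sub>v v) = a\<^sup>2 * (v \<bullet> v)"
    by (simp add: scalar_prod_def sum_distrib_left power2_eq_square algebra_simps)
  then show ?thesis by (simp add: enorm_def real_sqrt_mult)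
qed

lemma scalar_prod_le_enorm:
  assumes "v \<in> carrier_vec n" "w \<in> carrier_vec n"
  shows "\<bar>v \<bullet> w\<bar> \<le> enorm v * enorm w"
proof -
  have "\<bar>v \<bullet> w\<bar> \<le> (\<Sum>i\<in>{0..<n}. \<bar>v $ i\<bar> * \<bar>w $ i\<bar>)"
    using assms sum_abs[of "\<lambda>i. v $ i * w $ i" "{0..<n}"] by (simp add: scalar_prod_def abs_mult)
  also have "\<dots> \<le> enorm v * enorm w"
    using assms L2_set_mult_ineq[of "\<lambda>i. v $ i" "\<lambda>i. w $ i" "{0..<n}"] by (simp add: enorm_eq_L2_set)
  finally show ?thesis .
qed

lemma enorm_append_square: "(enorm (v @\<^sub>v w))\<^sup>2 = (enorm v)\<^sup>2 + (enorm w)\<^sup>2"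
  unfolding enorm_square
  by (rule scalar_prod_append[of _ "dim_vec v" _ "dim_vec w"]) (rule carrier_vec_dim_vec)+

lemma enorm_append_le: "enorm v \<le> enorm (v @\<^sub>v w)" "enorm w \<le> enorm (v @\<^sub>v w)"
proof -
  show "enorm v \<le> enorm (v @\<^sub>v w)" by (rule power2_le_imp_le) (simp_all add: enorm_append_square)
  show "enorm w \<le> enorm (v @\<^sub>v w)" by (rule power2_le_imp_le) (simp_all add: enorm_append_square)
qed

lemma enorm_append_le_add: "enorm (v @\<^sub>v w) \<le> enorm v + enorm w"
  by (rule power2_le_imp_le) (simp_all add: enorm_append_square power2_sum)

lemma abs_index_le_enorm:
  assumes "i < dim_vec v"
  shows "\<bar>v $ i\<bar> \<le> enorm v"
proof -
  have "\<bar>v $ i\<bar> \<le> L2_set (\<lambda>j. \<bar>v $ j\<bar>) {0..<dim_vec v}"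
    using assms by (intro member_le_L2_set) auto
  also have "\<dots> = enorm v" unfolding enorm_eq_L2_set by (simp add: L2_set_def)
  finally show ?thesis .
qed

lemma mult_mat_vec_enorm_bounded:
  "\<exists>b>0. \<forall>v\<in>carrier_vec (dim_col A). enorm (A *\<^sub>v v) \<le> b * enorm v"
proof (intro exI conjI ballI)
  fix v :: "real vec" assume v: "v \<in> carrier_vec (dim_col A)"
  have "enorm (A *\<^sub>v v) \<le> (\<Sum>i<dim_row A. \<bar>row A i \<bullet> v\<bar>)"
    using L2_set_le_sum_abs[of "\<lambda>i. (A *\<^sub>v v) $ i" "{0..<dim_row A}"]
    by (simp add: enorm_eq_L2_set lessThan_atLeast0)
  also have "\<dots> \<le> (\<Sum>i<dim_row A. enorm (row A i) * enorm v)"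
    using v by (intro sum_mono scalar_prod_le_enorm[of _ "dim_col A"]) auto
  also have "\<dots> \<le> (1 + (\<Sum>i<dim_row A. enorm (row A i))) * enorm v"
    by (simp add: sum_distrib_right distrib_right)
  finally show "enorm (A *\<^sub>v v) \<le> (1 + (\<Sum>i<dim_row A. enorm (row A i))) * enorm v" .
qed (simp add: add_pos_nonneg sum_nonneg)

lemma left_invertible_bounded_below:
  assumes X: "X \<in> carrier_mat m n" and Y: "Y \<in> carrier_mat n m" and YX: "Y * X = 1\<^sub>m n"
  shows "\<exists>c>0. \<forall>v\<in>carrier_vec n. c * enorm v \<le> enorm (X *\<^sub>v v)"
proof -
  obtain b where b: "b > 0" "\<And>v. v \<in> carrier_vec m \<Longrightarrow> enorm (Y *\<^sub>v v) \<le> b * enorm v"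
    using mult_mat_vec_enorm_bounded[of Y] Y by auto
  show ?thesis
  proof (intro exI[of _ "1 / b"] conjI ballI)
    fix v :: "real vec" assume v: "v \<in> carrier_vec n"
    have "v = Y *\<^sub>v (X *\<^sub>v v)"
      using X Y v by (simp flip: assoc_mult_mat_vec add: YX)
    then have "enorm v \<le> b * enorm (X *\<^sub>v v)"
      using b(2)[of "X *\<^sub>v v"] X v by simp
    then show "1 / b * enorm v \<le> enorm (X *\<^sub>v v)"
      using b(1) by (simp add: field_simps)
  qed (use b in simp)
qed

lemma vec_diff_add_diff:
  fixes a b :: "real vec"
  assumes "a \<in> carrier_vec n" "a' \<in> carrier_vec n" "b \<in> carrier_vec n" "b' \<in> carrier_vec n"
  shows "(a - a') + (b - b') = (a + b) - (a' + b')"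
  using assms by (intro eq_vecI) auto

lemma vec_add_diff_add:
  fixes a :: "real vec"
  assumes "a \<in> carrier_vec m" "b \<in> carrier_vec m" "x \<in> carrier_vec m"
  shows "(a + x) - (b + x) = a - b"
  using assms by (intro eq_vecI) auto

lemma vec_add_diff_left:
  fixes a :: "real vec"
  assumes "a \<in> carrier_vec m" "b \<in> carrier_vec m"
  shows "(a + b) - a = b"
  using assms by (intro eq_vecI) auto

lemma vec_add_add_diff_mid:
  fixes a :: "real vec"
  assumes "a \<in> carrier_vec m" "b \<in> carrier_vec m" "x \<in> carrier_vec m"
  shows "(a + x + b) - x = a + b"
  using assms by (intro eq_vecI) auto

lemma vec_first_append: "v \<in> carrier_vec a \<Longrightarrow> vec_first (v @\<^sub>v w) a = v"
  by (auto simp: vec_first_def)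

lemma vec_last_append: "v \<in> carrier_vec a \<Longrightarrow> w \<in> carrier_vec b \<Longrightarrow> vec_last (v @\<^sub>v w) b = w"
  by (auto simp: vec_last_def)

lemma vec_last_carrier [simp]: "vec_last v k \<in> carrier_vec k"
  by (simp add: vec_last_def)

lemma zero_mat_mult_vec: "v \<in> carrier_vec n \<Longrightarrow> 0\<^sub>m m n *\<^sub>v (v :: real vec) = 0\<^sub>v m"
  by (auto intro!: eq_vecI)

lemma mat_eq_of_mult_vec:
  fixes A B :: "real mat"
  assumes A: "A \<in> carrier_mat m n" and B: "B \<in> carrier_mat m n"
    and eq: "\<And>v. v \<in> carrier_vec n \<Longrightarrow> A *\<^sub>v v = B *\<^sub>v v"
  shows "A = B"
proof (rule eq_matI)
  fix i j assume "i < dim_row B" "j < dim_col B"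
  then have ij: "i < m" "j < n" using B by auto
  have "(A *\<^sub>v unit_vec n j) $ i = (B *\<^sub>v unit_vec n j) $ i" using eq[of "unit_vec n j"] by simp
  then show "A $$ (i, j) = B $$ (i, j)" using A B ij by simp
qed (use A B in auto)

lemma smult_mat_mult_vec: "dim_vec v = dim_col A \<Longrightarrow> (a \<cdot>\<^sub>m A) *\<^sub>v (v :: real vec) = a \<cdot>\<^sub>v (A *\<^sub>v v)"
  by (rule eq_vecI) auto

lemma mult_mat_vec_combination:
  fixes A :: "real mat"
  assumes A: "A \<in> carrier_mat m n" and v: "u \<in> carrier_vec n" "v \<in> carrier_vec n" "w \<in> carrier_vec n"
  shows "A *\<^sub>v (u - a \<cdot>\<^sub>v v - b \<cdot>\<^sub>v w) = A *\<^sub>v u - a \<cdot>\<^sub>v (A *\<^sub>v v) - b \<cdot>\<^sub>v (A *\<^sub>v w)"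
proof -
  have "A *\<^sub>v (u - a \<cdot>\<^sub>v v - b \<cdot>\<^sub>v w) = A *\<^sub>v (u - a \<cdot>\<^sub>v v) - A *\<^sub>v (b \<cdot>\<^sub>v w)"
    using v by (intro mult_minus_distrib_mat_vec[OF A]) auto
  also have "A *\<^sub>v (u - a \<cdot>\<^sub>v v) = A *\<^sub>v u - A *\<^sub>v (a \<cdot>\<^sub>v v)"
    using v by (intro mult_minus_distrib_mat_vec[OF A]) auto
  finally show ?thesis unfolding mult_mat_vec[OF A v(2)] mult_mat_vec[OF A v(3)] .
qed

lemma left_inverse_of_trivial_kernel:
  fixes M :: "real mat"
  assumes M: "M \<in> carrier_mat n n"
    and ker: "\<And>v. v \<in> carrier_vec n \<Longrightarrow> M *\<^sub>v v = 0\<^sub>v n \<Longrightarrow> v = 0\<^sub>v n"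
  obtains Mi where "Mi \<in> carrier_mat n n" "Mi * M = 1\<^sub>m n" "M * Mi = 1\<^sub>m n"
proof -
  have "det M \<noteq> 0" unfolding det_0_iff_vec_prod_zero_field[OF M] using ker by blast
  then show ?thesis
    using det_non_zero_imp_unit[OF M, where b = "()"] that unfolding Units_def ring_mat_def by auto
qed

text \<open>Positive definiteness of the quadratic form with an explicit constant, as decay rates are
  computed from it.\<close>

definition coercive :: "nat \<Rightarrow> real mat \<Rightarrow> bool" where
  "coercive n G \<longleftrightarrow> (\<exists>c>0. \<forall>v\<in>carrier_vec n. c * (enorm v)\<^sup>2 \<le> v \<bullet> (G *\<^sub>v v))"

lemma coercive_one: "coercive n (1\<^sub>m n)"
  unfolding coercive_def by (intro exI[of _ 1]) (simp add: enorm_square)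

text \<open>A left inverse of \<open>X\<close> is a quantitative form of injectivity, and so it carries the lower bound
  over.\<close>

lemma coercive_congruence:
  assumes G: "G \<in> carrier_mat m m" "coercive m G"
    and X: "X \<in> carrier_mat m n" and Y: "Y \<in> carrier_mat n m" and YX: "Y * X = 1\<^sub>m n"
  shows "coercive n (X\<^sup>T * G * X)"
proof -
  obtain c where c: "c > 0" "\<And>v. v \<in> carrier_vec m \<Longrightarrow> c * (enorm v)\<^sup>2 \<le> v \<bullet> (G *\<^sub>v v)"
    using G(2) unfolding coercive_def by blast
  obtain a where a: "a > 0" "\<And>v. v \<in> carrier_vec n \<Longrightarrow> a * enorm v \<le> enorm (X *\<^sub>v v)"
    using left_invertible_bounded_below[OF X Y YX] by blast
  show ?thesis unfolding coercive_def
  proof (intro exI[of _ "c * a\<^sup>2"] conjI ballI)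
    fix v :: "real vec" assume v: "v \<in> carrier_vec n"
    have "c * a\<^sup>2 * (enorm v)\<^sup>2 = c * (a * enorm v)\<^sup>2" by (simp add: power_mult_distrib)
    also have "\<dots> \<le> c * (enorm (X *\<^sub>v v))\<^sup>2"
      using a c(1) v by (intro mult_left_mono power_mono) auto
    also have "\<dots> \<le> (X *\<^sub>v v) \<bullet> (G *\<^sub>v (X *\<^sub>v v))" using X v by (intro c(2)) auto
    also have "\<dots> = (X\<^sup>T *\<^sub>v (G *\<^sub>v (X *\<^sub>v v))) \<bullet> v"
      using X G(1) v
      by (subst transpose_vec_mult_scalar[of _ m n]) (auto intro!: comm_scalar_prod[of _ m])
    also have "\<dots> = v \<bullet> (X\<^sup>T * G * X *\<^sub>v v)"
      using X G(1) v assoc_mult_mat_vec[of "X\<^sup>T * G" n m X n v]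
        assoc_mult_mat_vec[of "X\<^sup>T" n m G m "X *\<^sub>v v"]
      by (subst comm_scalar_prod[of _ n]) auto
    finally show "c * a\<^sup>2 * (enorm v)\<^sup>2 \<le> v \<bullet> (X\<^sup>T * G * X *\<^sub>v v)" .
  qed (use a c in simp)
qed

lemma coercive_gram:
  assumes X: "X \<in> carrier_mat m n" and Y: "Y \<in> carrier_mat n m" and YX: "Y * X = 1\<^sub>m n"
  shows "coercive n (X\<^sup>T * X)"
  using coercive_congruence[OF one_carrier_mat coercive_one X Y YX] X by simp

text \<open>The form at \<open>t \<cdot>\<^sub>v v + w\<close> is a nonnegative quadratic polynomial in \<open>t\<close>, so its discriminant is
  nonpositive. As \<open>G\<close> is only semidefinite, the leading coefficient may vanish; then the polynomial
  is constant.\<close>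

lemma semidefinite_cauchy_schwarz:
  fixes G :: "real mat"
  assumes G: "G \<in> carrier_mat n n" "G\<^sup>T = G"
    and pos: "\<And>v. v \<in> carrier_vec n \<Longrightarrow> 0 \<le> v \<bullet> (G *\<^sub>v v)"
    and v: "v \<in> carrier_vec n" and w: "w \<in> carrier_vec n"
  shows "(v \<bullet> (G *\<^sub>v w))\<^sup>2 \<le> (v \<bullet> (G *\<^sub>v v)) * (w \<bullet> (G *\<^sub>v w))"
proof -
  let ?a = "v \<bullet> (G *\<^sub>v v)" and ?b = "v \<bullet> (G *\<^sub>v w)" and ?c = "w \<bullet> (G *\<^sub>v w)"
  have sym: "w \<bullet> (G *\<^sub>v v) = ?b"
    using transpose_vec_mult_scalar[OF G(1) w v] G v w by (auto simp: comm_scalar_prod[of _ n])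
  have q: "0 \<le> ?a * t\<^sup>2 + 2 * ?b * t + ?c" for t
  proof -
    have "0 \<le> (t \<cdot>\<^sub>v v + w) \<bullet> (G *\<^sub>v (t \<cdot>\<^sub>v v + w))" using v w by (intro pos) auto
    also have "\<dots> = ?a * t\<^sup>2 + 2 * ?b * t + ?c"
      using G v w sym
      by (simp add: mult_add_distrib_mat_vec[of _ n n] mult_mat_vec[of _ n n] add_scalar_prod_distrib[of _ n]
          scalar_prod_add_distrib[of _ n] power2_eq_square algebra_simps)
    finally show ?thesis .
  qed
  show ?thesis
  proof (cases "?a = 0")
    case True
    have "?b = 0"
    proof (rule ccontr)
      assume "?b \<noteq> 0"
      with q[of "- (?c + 1) / (2 * ?b)"] True show False by (simp add: field_simps)
    qed
    with True show ?thesis by simp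
  next
    case False
    then have a: "?a > 0" using pos[OF v] by simp
    have "0 \<le> ?a * (?a * (- ?b / ?a)\<^sup>2 + 2 * ?b * (- ?b / ?a) + ?c)"
      by (rule mult_nonneg_nonneg[OF less_imp_le[OF a] q])
    also have "\<dots> = ?a * ?c - ?b\<^sup>2" using a by (simp add: field_simps power2_eq_square)
    finally show ?thesis by simp
  qed
qed

text \<open>The Cauchy-Schwarz inequality for the form of \<open>G\<close>, applied to \<open>G *\<^sub>v v\<close> and \<open>v\<close>, bounds
  the square of the norm of \<open>G *\<^sub>v v\<close> by a multiple of \<open>v \<bullet> (G *\<^sub>v v)\<close>; definiteness makes \<open>G\<close>
  invertible, so the norm of \<open>G *\<^sub>v v\<close> dominates that of \<open>v\<close>. This takes the place of a compactness
  argument on the unit sphere.\<close>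

lemma coercive_of_semidefinite:
  fixes G :: "real mat"
  assumes G: "G \<in> carrier_mat n n" "G\<^sup>T = G"
    and pos: "\<And>v. v \<in> carrier_vec n \<Longrightarrow> 0 \<le> v \<bullet> (G *\<^sub>v v)"
    and def: "\<And>v. v \<in> carrier_vec n \<Longrightarrow> v \<bullet> (G *\<^sub>v v) = 0 \<Longrightarrow> v = 0\<^sub>v n"
  shows "coercive n G"
proof -
  have ker: "v = 0\<^sub>v n" if "v \<in> carrier_vec n" "G *\<^sub>v v = 0\<^sub>v n" for v
    using that def[of v] by simp
  obtain Y where Y: "Y \<in> carrier_mat n n" "Y * G = 1\<^sub>m n"
    using left_inverse_of_trivial_kernel[OF G(1) ker] by metis
  obtain a where a: "a > 0" "\<And>v. v \<in> carrier_vec n \<Longrightarrow> a * enorm v \<le> enorm (G *\<^sub>v v)"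
    using left_invertible_bounded_below[OF G(1) Y] by blast
  obtain b where b: "b > 0" "\<And>v. v \<in> carrier_vec n \<Longrightarrow> enorm (G *\<^sub>v v) \<le> b * enorm v"
    using mult_mat_vec_enorm_bounded[of G] G by auto
  show ?thesis unfolding coercive_def
  proof (intro exI[of _ "a\<^sup>2 / b"] conjI ballI)
    fix v :: "real vec" assume v: "v \<in> carrier_vec n"
    define w where "w = G *\<^sub>v v"
    have w: "w \<in> carrier_vec n" unfolding w_def using G v by simp
    have "((enorm w)\<^sup>2)\<^sup>2 = (w \<bullet> (G *\<^sub>v v))\<^sup>2" by (simp add: enorm_square w_def)
    also have "\<dots> \<le> (w \<bullet> (G *\<^sub>v w)) * (v \<bullet> (G *\<^sub>v v))"
      by (rule semidefinite_cauchy_schwarz[OF G pos w v])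
    also have "\<dots> \<le> (b * (enorm w)\<^sup>2) * (v \<bullet> (G *\<^sub>v v))"
    proof (rule mult_right_mono[OF _ pos[OF v]])
      have "w \<bullet> (G *\<^sub>v w) \<le> enorm w * enorm (G *\<^sub>v w)"
        using scalar_prod_le_enorm[of w n "G *\<^sub>v w"] w G by auto
      also have "\<dots> \<le> enorm w * (b * enorm w)" by (intro mult_left_mono b w) auto
      finally show "w \<bullet> (G *\<^sub>v w) \<le> b * (enorm w)\<^sup>2" by (simp add: power2_eq_square algebra_simps)
    qed
    finally have ww: "(enorm w)\<^sup>2 * (enorm w)\<^sup>2 \<le> (enorm w)\<^sup>2 * (b * (v \<bullet> (G *\<^sub>v v)))"
      by (simp only: power2_eq_square mult_ac)
    then have *: "(enorm w)\<^sup>2 \<le> b * (v \<bullet> (G *\<^sub>v v))"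
      using pos[OF v] b(1) by (cases "enorm w = 0") (simp, use mult_left_le_imp_le[OF ww] in simp)
    have "a\<^sup>2 * (enorm v)\<^sup>2 = (a * enorm v)\<^sup>2" by (simp add: power_mult_distrib)
    also have "\<dots> \<le> (enorm w)\<^sup>2"
      unfolding w_def using a v by (intro power_mono) auto
    finally show "a\<^sup>2 / b * (enorm v)\<^sup>2 \<le> v \<bullet> (G *\<^sub>v v)" using * b(1) by (simp add: field_simps)
  qed (use a b in simp)
qed

lemma coercive_left_inverse:
  assumes G: "G \<in> carrier_mat n n" and c: "coercive n G"
  obtains Gi where "Gi \<in> carrier_mat n n" "Gi * G = 1\<^sub>m n" "G * Gi = 1\<^sub>m n"
proof (rule left_inverse_of_trivial_kernel[OF G])
  fix v assume v: "v \<in> carrier_vec n" and z: "G *\<^sub>v v = 0\<^sub>v n"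
  obtain a where a: "a > 0" "a * (enorm v)\<^sup>2 \<le> v \<bullet> (G *\<^sub>v v)"
    using c v unfolding coercive_def by blast
  then have "a * (enorm v)\<^sup>2 \<le> 0" using z v by simp
  then have "enorm v = 0" using a(1) by (simp add: mult_le_0_iff)
  then show "v = 0\<^sub>v n" using v by (simp add: enorm_eq_0_iff)
qed

lemma orthonormal_basis_cols_gram:
  assumes "orthonormal_basis_cols M S" and M: "M \<in> carrier_mat n k"
  shows "M\<^sup>T * M = 1\<^sub>m k"
  using assms by (intro eq_matI) (auto simp: orthonormal_basis_cols_def)

lemma orthonormal_basis_cols_image:
  assumes "orthonormal_basis_cols M S" and M: "M \<in> carrier_mat n k" and v: "v \<in> carrier_vec k"
  shows "M *\<^sub>v v \<in> S"
proof -
  interpret vec_space "TYPE(real)" n .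
  have "col_space M = S" using assms by (simp add: orthonormal_basis_cols_def)
  then show ?thesis using col_space_eq[OF M] M v by auto
qed

text \<open>The matrix with the columns of \<open>Z\<close> followed by those of \<open>W\<close> is square with orthonormal columns, so
  its transpose is an inverse on both sides. Blocks without rows serve to put the two matrices side
  by side.\<close>

lemma right_inverse_of_orthonormal_split:
  fixes Z W :: "real mat"
  assumes Z: "Z \<in> carrier_mat n a" and W: "W \<in> carrier_mat n b" and ab: "a + b = n"
    and ZZ: "Z\<^sup>T * Z = 1\<^sub>m a" and WW: "W\<^sup>T * W = 1\<^sub>m b" and ZW: "Z\<^sup>T * W = 0\<^sub>m a b"
  shows "Z * Z\<^sup>T + W * W\<^sup>T = 1\<^sub>m n"
proof -
  define P where "P = four_block_mat Z W (0\<^sub>m 0 a) (0\<^sub>m 0 b)"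
  have P: "P \<in> carrier_mat n n" unfolding P_def using Z W ab by auto
  have PT: "P\<^sup>T = four_block_mat Z\<^sup>T (0\<^sub>m a 0) W\<^sup>T (0\<^sub>m b 0)"
    unfolding P_def using Z W by (subst transpose_four_block_mat) auto
  have WZ: "W\<^sup>T * Z = 0\<^sub>m b a"
    using transpose_mult[of "Z\<^sup>T" a n W b] Z W ZW by simp
  have "P\<^sup>T * P = four_block_mat (1\<^sub>m a) (0\<^sub>m a b) (0\<^sub>m b a) (1\<^sub>m b)"
    unfolding PT unfolding P_def using Z W
    by (subst mult_four_block_mat[of _ a n _ 0 _ b]) (auto simp: ZZ WW ZW WZ)
  then have "P\<^sup>T * P = 1\<^sub>m n" using ab by simp
  then have 1: "P * P\<^sup>T = 1\<^sub>m n" using P mat_mult_left_right_inverse[of "P\<^sup>T" n P] by simp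
  have "P * P\<^sup>T = four_block_mat (Z * Z\<^sup>T + W * W\<^sup>T) (0\<^sub>m n 0) (0\<^sub>m 0 n) (0\<^sub>m 0 0)"
    unfolding PT unfolding P_def using Z W
    by (subst mult_four_block_mat[of _ n a _ b _ 0]) auto
  with 1 have *: "four_block_mat (Z * Z\<^sup>T + W * W\<^sup>T) (0\<^sub>m n 0) (0\<^sub>m 0 n) (0\<^sub>m 0 0) = 1\<^sub>m n" by simp
  show ?thesis
  proof (rule eq_matI)
    fix i j assume "i < dim_row (1\<^sub>m n :: real mat)" "j < dim_col (1\<^sub>m n :: real mat)"
    then show "(Z * Z\<^sup>T + W * W\<^sup>T) $$ (i, j) = 1\<^sub>m n $$ (i, j)"
      using arg_cong[OF *, of "\<lambda>M. M $$ (i, j)"] Z W by (simp add: four_block_mat_def Let_def)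
  qed (use Z W in auto)
qed

lemma lipschitz_bound_nonneg:
  assumes "globally_lipschitz n f"
  obtains L where "0 \<le> L" "\<And>u v. u \<in> carrier_vec n \<Longrightarrow> v \<in> carrier_vec n \<Longrightarrow> enorm (f u - f v)
      \<le> L * enorm (u - v)"
proof -
  obtain L where L: "\<And>u v. u \<in> carrier_vec n \<Longrightarrow> v \<in> carrier_vec n \<Longrightarrow> enorm (f u - f v) \<le> L * enorm (u - v)"
    using assms unfolding globally_lipschitz_def by blast
  have "enorm (f u - f v) \<le> \<bar>L\<bar> * enorm (u - v)" if "u \<in> carrier_vec n" "v \<in> carrier_vec n" for u v
    using L[OF that] mult_right_mono[OF abs_ge_self, of "enorm (u - v)" L] by simp
  then show ?thesis by (intro that[of "\<bar>L\<bar>"]) auto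
qed

section \<open>Kronecker products and stacked vectors\<close>

lemma div_mod_less_mult: "k < m * p \<Longrightarrow> k div p < m \<and> k mod p < (p::nat)"
  by (cases "p = 0") (auto simp: less_mult_imp_div_less)

lemma mult_add_less_mult: "i < m \<Longrightarrow> j < p \<Longrightarrow> i * p + j < m * (p::nat)"
proof -
  assume "i < m" "j < p"
  then have "i * p + j < (i + 1) * p" by simp
  also have "\<dots> \<le> m * p" using \<open>i < m\<close> by (intro mult_right_mono) auto
  finally show ?thesis .
qed

lemma sum_div_mod:
  "(\<Sum>k<m * p. f (k div p) (k mod p)) = (\<Sum>i<m. \<Sum>j<(p::nat). f i j)"
proof -
  have "(\<Sum>k<m * p. f (k div p) (k mod p)) = (\<Sum>(i, j)\<in>{..<m} \<times> {..<p}. f i j)"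
    by (rule sum.reindex_bij_witness[of _ "\<lambda>(i, j). i * p + j" "\<lambda>k. (k div p, k mod p)"])
      (auto simp: div_mod_less_mult mult_add_less_mult)
  then show ?thesis by (simp add: sum.cartesian_product)
qed

lemma kron_carrier [simp]:
  "A \<in> carrier_mat m n \<Longrightarrow> B \<in> carrier_mat p q \<Longrightarrow> A \<otimes>\<^sub>K B \<in> carrier_mat (m * p) (n * q)"
  by (auto simp: kron_def)

lemma kron_index:
  "A \<in> carrier_mat m n \<Longrightarrow> B \<in> carrier_mat p q \<Longrightarrow> i < m * p \<Longrightarrow> j < n * q \<Longrightarrow>
    (A \<otimes>\<^sub>K B) $$ (i, j) = A $$ (i div p, j div q) * B $$ (i mod p, j mod q)"
  by (auto simp: kron_def)

lemma mult_mat_index: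
  "A \<in> carrier_mat m n \<Longrightarrow> B \<in> carrier_mat n p \<Longrightarrow> i < m \<Longrightarrow> j < p \<Longrightarrow>
    (A * B) $$ (i, j) = (\<Sum>k<n. A $$ (i, k) * B $$ (k, j))"
  by (auto simp: scalar_prod_def lessThan_atLeast0 intro!: sum.cong)

lemma mult_mat_vec_index:
  "A \<in> carrier_mat m n \<Longrightarrow> v \<in> carrier_vec n \<Longrightarrow> i < m \<Longrightarrow>
    (A *\<^sub>v v) $ i = (\<Sum>k<n. A $$ (i, k) * v $ k)"
  by (auto simp: scalar_prod_def lessThan_atLeast0 intro!: sum.cong)

text \<open>The mixed product rule: both sides are double sums over the quotient and the remainder of the
  inner index.\<close>

lemma kron_mult:
  assumes A: "A \<in> carrier_mat m n" and B: "B \<in> carrier_mat p q"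
    and C: "C \<in> carrier_mat n r" and D: "D \<in> carrier_mat q s"
  shows "(A \<otimes>\<^sub>K B) * (C \<otimes>\<^sub>K D) = (A * C) \<otimes>\<^sub>K (B * D)"
proof (rule eq_matI)
  have AC: "A * C \<in> carrier_mat m r" and BD: "B * D \<in> carrier_mat p s"
    using A B C D by auto
  fix i j assume "i < dim_row ((A * C) \<otimes>\<^sub>K (B * D))" "j < dim_col ((A * C) \<otimes>\<^sub>K (B * D))"
  then have i: "i < m * p" and j: "j < r * s"
    using kron_carrier[OF AC BD] by auto
  note im = div_mod_less_mult[OF i] and jm = div_mod_less_mult[OF j]
  have "((A \<otimes>\<^sub>K B) * (C \<otimes>\<^sub>K D)) $$ (i, j)
    = (\<Sum>k<n * q. (A \<otimes>\<^sub>K B) $$ (i, k) * (C \<otimes>\<^sub>K D) $$ (k, j))"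
    using A B C D i j by (intro mult_mat_index[of _ "m * p" _ _ "r * s"]) auto
  also have "\<dots> = (\<Sum>k<n * q. (A $$ (i div p, k div q) * B $$ (i mod p, k mod q)) *
      (C $$ (k div q, j div s) * D $$ (k mod q, j mod s)))"
    by (intro sum.cong refl) (auto simp: kron_index[OF A B i] kron_index[OF C D _ j])
  also have "\<dots> = (\<Sum>k<n. \<Sum>l<q. (A $$ (i div p, k) * B $$ (i mod p, l)) *
      (C $$ (k, j div s) * D $$ (l, j mod s)))"
    by (rule sum_div_mod[of "\<lambda>k l. (A $$ (i div p, k) * B $$ (i mod p, l)) * (C $$ (k, j div s) * D $$ (l, j mod s))"])
  also have "\<dots> = (\<Sum>k<n. A $$ (i div p, k) * C $$ (k, j div s)) * (\<Sum>l<q. B $$ (i mod p, l) * D $$ (l, j mod s))"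
    by (simp add: sum_product mult_ac)
  also have "\<dots> = ((A * C) \<otimes>\<^sub>K (B * D)) $$ (i, j)"
    using im jm by (simp add: kron_index[OF AC BD i j] mult_mat_index[OF A C] mult_mat_index[OF B D])
  finally show "((A \<otimes>\<^sub>K B) * (C \<otimes>\<^sub>K D)) $$ (i, j) = ((A * C) \<otimes>\<^sub>K (B * D)) $$ (i, j)" .
qed (use A B C D in \<open>auto simp: kron_def\<close>)

lemma kron_transpose: "(A \<otimes>\<^sub>K B)\<^sup>T = A\<^sup>T \<otimes>\<^sub>K B\<^sup>T"
  by (rule eq_matI) (auto simp: kron_def div_mod_less_mult)

lemma kron_one: "1\<^sub>m m \<otimes>\<^sub>K 1\<^sub>m n = 1\<^sub>m (m * n)"
proof (rule eq_matI)
  fix i j assume "i < dim_row (1\<^sub>m (m * n))" "j < dim_col (1\<^sub>m (m * n))"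
  then have i: "i < m * n" and j: "j < m * n" by auto
  have "i = j \<longleftrightarrow> i div n = j div n \<and> i mod n = j mod n"
    by (metis div_mult_mod_eq)
  then show "(1\<^sub>m m \<otimes>\<^sub>K 1\<^sub>m n) $$ (i, j) = 1\<^sub>m (m * n) $$ (i, j)"
    using div_mod_less_mult[OF i] div_mod_less_mult[OF j] i j
    by (auto simp: kron_index[of _ m m _ n n])
qed (auto simp: kron_def)

lemma kron_mult_vec:
  assumes A: "A \<in> carrier_mat m n" and B: "B \<in> carrier_mat p q"
    and C: "C \<in> carrier_mat n r" and D: "D \<in> carrier_mat q s" and v: "v \<in> carrier_vec (r * s)"
  shows "(A \<otimes>\<^sub>K B) *\<^sub>v ((C \<otimes>\<^sub>K D) *\<^sub>v v) = ((A * C) \<otimes>\<^sub>K (B * D)) *\<^sub>v v"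
  unfolding kron_mult[OF A B C D, symmetric]
  using assms by (intro assoc_mult_mat_vec[symmetric, of _ "m * p" "n * q" _ "r * s"]) auto

lemma kron_add_left:
  assumes A: "A \<in> carrier_mat m n" and A': "A' \<in> carrier_mat m n" and B: "B \<in> carrier_mat p q"
  shows "(A + A') \<otimes>\<^sub>K B = A \<otimes>\<^sub>K B + A' \<otimes>\<^sub>K B"
proof (rule eq_matI)
  fix i j assume "i < dim_row (A \<otimes>\<^sub>K B + A' \<otimes>\<^sub>K B)" "j < dim_col (A \<otimes>\<^sub>K B + A' \<otimes>\<^sub>K B)"
  then have i: "i < m * p" and j: "j < n * q" using carrier_matD[OF kron_carrier[OF A' B]] by auto
  have AA: "A + A' \<in> carrier_mat m n" using A A' by simp
  show "((A + A') \<otimes>\<^sub>K B) $$ (i, j) = (A \<otimes>\<^sub>K B + A' \<otimes>\<^sub>K B) $$ (i, j)"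
    using div_mod_less_mult[OF i] div_mod_less_mult[OF j] A A' B i j carrier_matD[OF kron_carrier[OF A' B]]
    by (simp add: kron_index[OF AA B i j] kron_index[OF A B i j] kron_index[OF A' B i j] distrib_right)
qed (use A A' B in \<open>auto simp: kron_def\<close>)

lemma kron_add_right:
  assumes A: "A \<in> carrier_mat m n" and B: "B \<in> carrier_mat p q" and B': "B' \<in> carrier_mat p q"
  shows "A \<otimes>\<^sub>K (B + B') = A \<otimes>\<^sub>K B + A \<otimes>\<^sub>K B'"
proof (rule eq_matI)
  fix i j assume "i < dim_row (A \<otimes>\<^sub>K B + A \<otimes>\<^sub>K B')" "j < dim_col (A \<otimes>\<^sub>K B + A \<otimes>\<^sub>K B')"
  then have i: "i < m * p" and j: "j < n * q" using carrier_matD[OF kron_carrier[OF A B']] by auto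
  have BB: "B + B' \<in> carrier_mat p q" using B B' by simp
  show "(A \<otimes>\<^sub>K (B + B')) $$ (i, j) = (A \<otimes>\<^sub>K B + A \<otimes>\<^sub>K B') $$ (i, j)"
    using div_mod_less_mult[OF i] div_mod_less_mult[OF j] A B' B i j carrier_matD[OF kron_carrier[OF A B']]
    by (simp add: kron_index[OF A BB i j] kron_index[OF A B i j] kron_index[OF A B' i j] distrib_left)
qed (use A B B' in \<open>auto simp: kron_def\<close>)

lemma kron_smult_left: "(a \<cdot>\<^sub>m A) \<otimes>\<^sub>K B = a \<cdot>\<^sub>m (A \<otimes>\<^sub>K B)"
  by (rule eq_matI) (auto simp: kron_def div_mod_less_mult)

lemma kron_zero:
  "B \<in> carrier_mat p q \<Longrightarrow> 0\<^sub>m m n \<otimes>\<^sub>K B = 0\<^sub>m (m * p) (n * q)"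
  "A \<in> carrier_mat m n \<Longrightarrow> A \<otimes>\<^sub>K 0\<^sub>m p q = 0\<^sub>m (m * p) (n * q)"
  by (rule eq_matI; auto simp: kron_def div_mod_less_mult)+

lemma stack_carrier [simp]: "stack N d v \<in> carrier_vec (N * d)"
  by (simp add: stack_def)

lemma dim_stack [simp]: "dim_vec (stack N d v) = N * d"
  by (simp add: stack_def)

lemma stack_index: "k < N * d \<Longrightarrow> stack N d v $ k = v (k div d) $ (k mod d)"
  by (simp add: stack_def)

lemma block_carrier [simp]: "block d i v \<in> carrier_vec d"
  by (simp add: block_def)

lemma stack_block: "v \<in> carrier_vec (N * d) \<Longrightarrow> stack N d (\<lambda>i. block d i v) = v"
  by (rule eq_vecI) (auto simp: stack_def block_def div_mod_less_mult)

lemma block_stack: "i < N \<Longrightarrow> v i \<in> carrier_vec d \<Longrightarrow> block d i (stack N d v) = v i"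
  by (rule eq_vecI) (auto simp: stack_def block_def mult_add_less_mult)

lemma stack_cong: "(\<And>i. i < N \<Longrightarrow> v i = w i) \<Longrightarrow> stack N d v = stack N d w"
  by (rule eq_vecI) (auto simp: stack_index div_mod_less_mult)

lemma stack_add:
  "(\<And>i. i < N \<Longrightarrow> v i \<in> carrier_vec d) \<Longrightarrow> (\<And>i. i < N \<Longrightarrow> w i \<in> carrier_vec d) \<Longrightarrow>
    stack N d (\<lambda>i. v i + w i) = stack N d v + stack N d w"
proof (rule eq_vecI, goal_cases)
  case (1 k)
  then have k: "k < N * d" by simp
  note m = div_mod_less_mult[OF k]
  then show ?case using 1(1)[of "k div d"] 1(2)[of "k div d"] k by (simp add: stack_index)
qed simp

lemma stack_diff:
  "(\<And>i. i < N \<Longrightarrow> v i \<in> carrier_vec d) \<Longrightarrow> (\<And>i. i < N \<Longrightarrow> w i \<in> carrier_vec d) \<Longrightarrow>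
    stack N d (\<lambda>i. v i - w i) = stack N d v - stack N d w"
proof (rule eq_vecI, goal_cases)
  case (1 k)
  then have k: "k < N * d" by simp
  note m = div_mod_less_mult[OF k]
  then show ?case using 1(1)[of "k div d"] 1(2)[of "k div d"] k by (simp add: stack_index)
qed simp

lemma stack_smult:
  "(\<And>i. i < N \<Longrightarrow> v i \<in> carrier_vec d) \<Longrightarrow> stack N d (\<lambda>i. a \<cdot>\<^sub>v v i) = a \<cdot>\<^sub>v stack N d v"
proof (rule eq_vecI, goal_cases)
  case (1 k)
  then have k: "k < N * d" by simp
  note m = div_mod_less_mult[OF k]
  then show ?case using 1(1)[of "k div d"] k by (simp add: stack_index)
qed simp

lemma enorm_stack_square:
  assumes "\<And>i. i < N \<Longrightarrow> v i \<in> carrier_vec d"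
  shows "(enorm (stack N d v))\<^sup>2 = (\<Sum>i<N. (enorm (v i))\<^sup>2)"
proof -
  have "(enorm (stack N d v))\<^sup>2 = (\<Sum>k<N * d. v (k div d) $ (k mod d) * v (k div d) $ (k mod d))"
    by (auto simp: enorm_square scalar_prod_def stack_index lessThan_atLeast0 intro!: sum.cong)
  also have "\<dots> = (\<Sum>i<N. \<Sum>k<d. v i $ k * v i $ k)"
    by (rule sum_div_mod[of "\<lambda>i k. v i $ k * v i $ k"])
  also have "\<dots> = (\<Sum>i<N. (enorm (v i))\<^sup>2)"
    using carrier_vecD[OF assms] by (intro sum.cong refl) (simp add: enorm_square scalar_prod_def lessThan_atLeast0)
  finally show ?thesis .
qed

lemma kron_mult_stack:
  assumes A: "A \<in> carrier_mat m n" and B: "B \<in> carrier_mat p q"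
    and v: "\<And>j. j < n \<Longrightarrow> v j \<in> carrier_vec q"
  shows "(A \<otimes>\<^sub>K B) *\<^sub>v stack n q v = stack m p (\<lambda>i. vec p (\<lambda>k. \<Sum>j<n. A $$ (i, j) * (B *\<^sub>v v j) $ k))"
proof (rule eq_vecI)
  fix i assume "i < dim_vec (stack m p (\<lambda>i. vec p (\<lambda>k. \<Sum>j<n. A $$ (i, j) * (B *\<^sub>v v j) $ k)))"
  then have i: "i < m * p" by simp
  note im = div_mod_less_mult[OF i]
  have "((A \<otimes>\<^sub>K B) *\<^sub>v stack n q v) $ i = (\<Sum>k<n * q. (A \<otimes>\<^sub>K B) $$ (i, k) * stack n q v $ k)"
    using A B i by (intro mult_mat_vec_index[of _ "m * p"]) auto
  also have "\<dots> = (\<Sum>k<n * q. (A $$ (i div p, k div q) * B $$ (i mod p, k mod q)) * v (k div q) $ (k mod q))"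
    by (intro sum.cong refl) (auto simp: kron_index[OF A B i] stack_index)
  also have "\<dots> = (\<Sum>k<n. \<Sum>l<q. (A $$ (i div p, k) * B $$ (i mod p, l)) * v k $ l)"
    by (rule sum_div_mod[of "\<lambda>k l. (A $$ (i div p, k) * B $$ (i mod p, l)) * v k $ l"])
  also have "\<dots> = (\<Sum>k<n. A $$ (i div p, k) * (B *\<^sub>v v k) $ (i mod p))"
    using im by (intro sum.cong refl) (auto simp: mult_mat_vec_index[OF B v] sum_distrib_left mult_ac)
  finally show "((A \<otimes>\<^sub>K B) *\<^sub>v stack n q v) $ i =
      stack m p (\<lambda>i. vec p (\<lambda>k. \<Sum>j<n. A $$ (i, j) * (B *\<^sub>v v j) $ k)) $ i"
    using i im by (simp add: stack_index)
qed (use A B in \<open>auto simp: kron_def\<close>)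

lemma kron_one_mult_stack:
  assumes B: "B \<in> carrier_mat p q" and v: "\<And>j. j < n \<Longrightarrow> v j \<in> carrier_vec q"
  shows "(1\<^sub>m n \<otimes>\<^sub>K B) *\<^sub>v stack n q v = stack n p (\<lambda>i. B *\<^sub>v v i)"
proof (subst kron_mult_stack[OF one_carrier_mat B v], assumption, rule stack_cong, rule eq_vecI)
  fix i k assume i: "i < n" and k: "k < dim_vec (B *\<^sub>v v i)"
  have "(\<Sum>j<n. 1\<^sub>m n $$ (i, j) * (B *\<^sub>v v j) $ k) = (\<Sum>j<n. if i = j then (B *\<^sub>v v j) $ k else 0)"
    using i by (intro sum.cong) auto
  then show "vec p (\<lambda>k. \<Sum>j<n. 1\<^sub>m n $$ (i, j) * (B *\<^sub>v v j) $ k) $ k = (B *\<^sub>v v i) $ k"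
    using i k B by simp
qed (use B in auto)

lemma block_diff:
  assumes "i < N" "x \<in> carrier_vec (N * d)" "y \<in> carrier_vec (N * d)"
  shows "block d i (x - y) = block d i x - block d i y"
  using assms by (intro eq_vecI) (auto simp: block_def mult_add_less_mult)

lemma ones_carrier: "ones N \<in> carrier_mat N 1"
  by (simp add: ones_def)

text \<open>The simplifier turns the dimension 1 into \<open>Suc 0\<close>, where the rule has to match as well.\<close>

lemmas [simp] = ones_carrier[simplified]

text \<open>Lets the one-column matrix \<open>ones N\<close> be treated by the rules for stacked vectors.\<close>

lemma vec_eq_stack_one: "v \<in> carrier_vec d \<Longrightarrow> v = stack 1 d (\<lambda>_. v)"
  by (rule eq_vecI) (auto simp: stack_index)

lemma ones_kron_mult_vec:
  assumes B: "B \<in> carrier_mat p q" and w: "w \<in> carrier_vec q"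
  shows "(ones N \<otimes>\<^sub>K B) *\<^sub>v w = stack N p (\<lambda>i. B *\<^sub>v w)"
proof -
  have "(ones N \<otimes>\<^sub>K B) *\<^sub>v w = (ones N \<otimes>\<^sub>K B) *\<^sub>v stack 1 q (\<lambda>_. w)"
    using vec_eq_stack_one[OF w] by simp
  also have "\<dots> = stack N p (\<lambda>i. B *\<^sub>v w)"
    unfolding kron_mult_stack[OF ones_carrier B w] using B
    by (intro stack_cong eq_vecI) (auto simp: ones_def)
  finally show ?thesis .
qed

lemma ones_transpose_kron_mult_stack:
  assumes B: "B \<in> carrier_mat p q" and v: "\<And>j. j < N \<Longrightarrow> v j \<in> carrier_vec q"
  shows "((ones N)\<^sup>T \<otimes>\<^sub>K B) *\<^sub>v stack N q v = finsum_vec TYPE(real) p (\<lambda>i. B *\<^sub>v v i) {..<N}"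
proof -
  have c: "(\<lambda>i. B *\<^sub>v v i) \<in> {..<N} \<rightarrow> carrier_vec p"
    using B v by (auto intro!: mult_mat_vec_carrier[of _ p q])
  have T: "(ones N)\<^sup>T \<in> carrier_mat 1 N" by simp
  have *: "vec p (\<lambda>k. \<Sum>j<N. (ones N)\<^sup>T $$ (0, j) * (B *\<^sub>v v j) $ k)
      = finsum_vec TYPE(real) p (\<lambda>i. B *\<^sub>v v i) {..<N}"
    using finsum_vec_closed[OF c]
    by (intro eq_vecI) (auto simp: index_finsum_vec[OF _ _ c] ones_def)
  have "((ones N)\<^sup>T \<otimes>\<^sub>K B) *\<^sub>v stack N q v
    = stack 1 p (\<lambda>i. vec p (\<lambda>k. \<Sum>j<N. (ones N)\<^sup>T $$ (i, j) * (B *\<^sub>v v j) $ k))"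
    by (rule kron_mult_stack[OF T B v])
  also have "\<dots> = stack 1 p (\<lambda>_. finsum_vec TYPE(real) p (\<lambda>i. B *\<^sub>v v i) {..<N})"
    unfolding *[symmetric] by (rule stack_cong) simp
  finally show ?thesis by (simp only: vec_eq_stack_one[OF finsum_vec_closed[OF c], symmetric])
qed

text \<open>Slicing \<open>v\<close> across its blocks, one slice for each of the \<open>q\<close> coordinates, splits the form into \<open>q\<close>
  copies of that of \<open>A\<close>.\<close>

lemma coercive_kron_one:
  assumes A: "A \<in> carrier_mat n n" and cA: "coercive n A"
  shows "coercive (n * q) (A \<otimes>\<^sub>K 1\<^sub>m q)"
proof -
  obtain c where c: "c > 0" "\<And>v. v \<in> carrier_vec n \<Longrightarrow> c * (enorm v)\<^sup>2 \<le> v \<bullet> (A *\<^sub>v v)"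
    using cA unfolding coercive_def by blast
  have "c * (enorm v)\<^sup>2 \<le> v \<bullet> ((A \<otimes>\<^sub>K 1\<^sub>m q) *\<^sub>v v)" if v: "v \<in> carrier_vec (n * q)" for v
  proof -
    define u where "u = (\<lambda>i. block q i v)"
    have u: "u i \<in> carrier_vec q" for i by (simp add: u_def)
    have vu: "v = stack n q u" unfolding u_def by (rule stack_block[OF v, symmetric])
    define s where "s = (\<lambda>l. vec n (\<lambda>i. u i $ l))"
    have "v \<bullet> ((A \<otimes>\<^sub>K 1\<^sub>m q) *\<^sub>v v) = (\<Sum>k<n * q. u (k div q) $ (k mod q) * (\<Sum>j<n. A $$ (k div q, j) * u j $ (k mod q)))"
      unfolding vu kron_mult_stack[OF A one_carrier_mat u] using u
      by (auto simp: scalar_prod_def stack_index lessThan_atLeast0 div_mod_less_mult intro!: sum.cong)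
    also have "\<dots> = (\<Sum>i<n. \<Sum>l<q. u i $ l * (\<Sum>j<n. A $$ (i, j) * u j $ l))"
      by (rule sum_div_mod[of "\<lambda>i l. u i $ l * (\<Sum>j<n. A $$ (i, j) * u j $ l)"])
    also have "\<dots> = (\<Sum>l<q. \<Sum>i<n. u i $ l * (\<Sum>j<n. A $$ (i, j) * u j $ l))"
      by (rule sum.swap)
    also have "\<dots> = (\<Sum>l<q. s l \<bullet> (A *\<^sub>v s l))"
      using A by (intro sum.cong refl) (auto simp: scalar_prod_def s_def lessThan_atLeast0 intro!: sum.cong)
    also have "\<dots> \<ge> (\<Sum>l<q. c * (enorm (s l))\<^sup>2)"
      by (intro sum_mono c) (simp add: s_def)
    also have "(\<Sum>l<q. c * (enorm (s l))\<^sup>2) = c * (\<Sum>l<q. \<Sum>i<n. u i $ l * u i $ l)"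
      unfolding sum_distrib_left
      by (intro sum.cong refl) (auto simp: enorm_square scalar_prod_def s_def lessThan_atLeast0 sum_distrib_left)
    also have "(\<Sum>l<q. \<Sum>i<n. u i $ l * u i $ l) = (\<Sum>i<n. \<Sum>l<q. u i $ l * u i $ l)"
      by (rule sum.swap)
    also have "\<dots> = (enorm v)\<^sup>2"
      unfolding vu enorm_stack_square[OF u] using u
      by (intro sum.cong refl) (auto simp: enorm_square scalar_prod_def lessThan_atLeast0 carrier_vecD[OF u])
    finally show ?thesis .
  qed
  with c(1) show ?thesis unfolding coercive_def by blast
qed

section \<open>Differentiable trajectories\<close>

lemma has_derivative_traj_cong:
  assumes "has_derivative_traj d f f'"
    and "\<And>t. 0 \<le> t \<Longrightarrow> f t = g t" "\<And>t. 0 \<le> t \<Longrightarrow> f' t = g' t"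
  shows "has_derivative_traj d g g'"
  unfolding has_derivative_traj_def
proof (intro allI impI conjI)
  fix t :: real and k assume t: "0 \<le> t" and k: "k < d"
  have "((\<lambda>s. f s $ k) has_real_derivative f' t $ k) (at t within {0..})"
    using assms(1) t k by (auto simp: has_derivative_traj_def)
  then show "((\<lambda>s. g s $ k) has_real_derivative g' t $ k) (at t within {0..})"
    unfolding assms(3)[OF t]
    by (rule has_field_derivative_transform_within[where d = 1]) (use assms(2) t in auto)
qed (use assms in \<open>auto simp: has_derivative_traj_def\<close>)

lemma has_derivative_traj_mult_mat:
  assumes "has_derivative_traj n f f'" and A: "A \<in> carrier_mat m n"
  shows "has_derivative_traj m (\<lambda>t. A *\<^sub>v f t) (\<lambda>t. A *\<^sub>v f' t)"
  unfolding has_derivative_traj_def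
proof (intro allI impI conjI)
  fix t :: real and k assume t: "0 \<le> t" and k: "k < m"
  have f: "f s \<in> carrier_vec n" if "0 \<le> s" for s
    using assms(1) that by (auto simp: has_derivative_traj_def)
  have f': "f' t \<in> carrier_vec n" using assms(1) t by (auto simp: has_derivative_traj_def)
  have "((\<lambda>s. \<Sum>j<n. A $$ (k, j) * f s $ j) has_real_derivative (\<Sum>j<n. A $$ (k, j) * f' t $ j))
      (at t within {0..})"
    using assms(1) t by (intro derivative_intros DERIV_cmult) (auto simp: has_derivative_traj_def)
  also have "(\<Sum>j<n. A $$ (k, j) * f' t $ j) = (A *\<^sub>v f' t) $ k"
    using A k f' by (auto simp: scalar_prod_def lessThan_atLeast0 intro!: sum.cong)
  finally show "((\<lambda>s. (A *\<^sub>v f s) $ k) has_real_derivative (A *\<^sub>v f' t) $ k) (at t within {0..})"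
    by (rule has_field_derivative_transform_within[where d = 1])
      (use A k t in \<open>auto simp: scalar_prod_def lessThan_atLeast0 carrier_vecD[OF f] intro!: sum.cong\<close>)
qed (use assms in \<open>auto simp: has_derivative_traj_def\<close>)

lemma has_derivative_traj_add_const:
  assumes "has_derivative_traj n f f'" and c: "c \<in> carrier_vec n"
  shows "has_derivative_traj n (\<lambda>t. f t + c) f'"
  unfolding has_derivative_traj_def
proof (intro allI impI conjI)
  fix t :: real and k assume t: "0 \<le> t" and k: "k < n"
  have "((\<lambda>s. f s $ k) has_real_derivative f' t $ k) (at t within {0..})"
    using assms(1) t k by (auto simp: has_derivative_traj_def)
  then have "((\<lambda>s. f s $ k + c $ k) has_real_derivative f' t $ k + 0) (at t within {0..})"
    by (intro DERIV_add DERIV_const)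
  then show "((\<lambda>s. (f s + c) $ k) has_real_derivative f' t $ k) (at t within {0..})"
    using k c by simp
qed (use assms in \<open>auto simp: has_derivative_traj_def\<close>)

lemma has_derivative_traj_minus_const:
  assumes "has_derivative_traj n f f'" and c: "c \<in> carrier_vec n"
  shows "has_derivative_traj n (\<lambda>t. f t - c) f'"
  unfolding has_derivative_traj_def
proof (intro allI impI conjI)
  fix t :: real and k assume t: "0 \<le> t" and k: "k < n"
  have "((\<lambda>s. f s $ k) has_real_derivative f' t $ k) (at t within {0..})"
    using assms(1) t k by (auto simp: has_derivative_traj_def)
  then have "((\<lambda>s. f s $ k - c $ k) has_real_derivative f' t $ k - 0) (at t within {0..})"
    by (intro DERIV_diff DERIV_const)
  then show "((\<lambda>s. (f s - c) $ k) has_real_derivative f' t $ k) (at t within {0..})"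
    using k c by simp
qed (use assms in \<open>auto simp: has_derivative_traj_def\<close>)

lemma has_derivative_traj_append:
  assumes f: "has_derivative_traj n f f'" and g: "has_derivative_traj m g g'"
  shows "has_derivative_traj (n + m) (\<lambda>t. f t @\<^sub>v g t) (\<lambda>t. f' t @\<^sub>v g' t)"
  unfolding has_derivative_traj_def
proof (intro allI impI conjI)
  fix t :: real and k assume t: "0 \<le> t" and k: "k < n + m"
  have c: "dim_vec (f s) = n" "dim_vec (g s) = m" "dim_vec (f' s) = n" "dim_vec (g' s) = m"
    if "0 \<le> s" for s using f g that by (auto simp: has_derivative_traj_def)
  have "((\<lambda>s. if k < n then f s $ k else g s $ (k - n)) has_real_derivative
      (if k < n then f' t $ k else g' t $ (k - n))) (at t within {0..})"
    using f g t k by (auto simp: has_derivative_traj_def)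
  then show "((\<lambda>s. (f s @\<^sub>v g s) $ k) has_real_derivative (f' t @\<^sub>v g' t) $ k) (at t within {0..})"
    by (rule has_field_derivative_transform_within[where d = 1, THEN DERIV_cong])
      (use c t k in auto)
qed (use assms in \<open>auto simp: has_derivative_traj_def\<close>)

lemma has_derivative_traj_block:
  assumes "has_derivative_traj (N * d) f f'" and "i < N"
  shows "has_derivative_traj d (\<lambda>t. block d i (f t)) (\<lambda>t. block d i (f' t))"
  using assms by (auto simp: has_derivative_traj_def block_def mult_add_less_mult)

lemma has_derivative_traj_stack:
  assumes "\<And>i. i < N \<Longrightarrow> has_derivative_traj d (f i) (f' i)"
  shows "has_derivative_traj (N * d) (\<lambda>t. stack N d (\<lambda>i. f i t)) (\<lambda>t. stack N d (\<lambda>i. f' i t))"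
  using assms by (auto simp: has_derivative_traj_def stack_def div_mod_less_mult)

lemma has_real_derivative_scalar_prod:
  assumes f: "has_derivative_traj n f f'" and g: "has_derivative_traj n g g'" and t: "0 \<le> t"
  shows "((\<lambda>s. f s \<bullet> g s) has_real_derivative f' t \<bullet> g t + f t \<bullet> g' t) (at t within {0..})"
proof -
  have c: "dim_vec (f s) = n" "dim_vec (g s) = n" "dim_vec (f' s) = n" "dim_vec (g' s) = n"
    if "0 \<le> s" for s using f g that by (auto simp: has_derivative_traj_def)
  have "((\<lambda>s. \<Sum>k\<in>{0..<n}. f s $ k * g s $ k) has_real_derivative
      (\<Sum>k\<in>{0..<n}. f' t $ k * g t $ k + f t $ k * g' t $ k)) (at t within {0..})"
    using f g t by (intro DERIV_sum) (auto simp: has_derivative_traj_def intro!: derivative_eq_intros)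
  also have "(\<Sum>k\<in>{0..<n}. f' t $ k * g t $ k + f t $ k * g' t $ k) = f' t \<bullet> g t + f t \<bullet> g' t"
    using c t by (simp add: scalar_prod_def sum.distrib)
  finally show ?thesis
    by (rule has_field_derivative_transform_within[where d = 1]) (use c t in \<open>auto simp: scalar_prod_def\<close>)
qed

lemma has_derivative_traj_first:
  "has_derivative_traj (a + b) f f' \<Longrightarrow> has_derivative_traj a (\<lambda>t. vec_first (f t) a) (\<lambda>t. vec_first (f' t) a)"
  by (auto simp: has_derivative_traj_def vec_first_def)

lemma has_derivative_traj_last:
  assumes "has_derivative_traj (a + b) f f'"
  shows "has_derivative_traj b (\<lambda>t. vec_last (f t) b) (\<lambda>t. vec_last (f' t) b)"
  unfolding has_derivative_traj_def
proof (intro allI impI conjI)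
  fix t :: real and k assume t: "0 \<le> t" and k: "k < b"
  have c: "dim_vec (f s) = a + b" "dim_vec (f' s) = a + b" if "0 \<le> s" for s
    using assms that by (auto simp: has_derivative_traj_def)
  have "((\<lambda>s. f s $ (a + k)) has_real_derivative f' t $ (a + k)) (at t within {0..})"
    using assms t k by (auto simp: has_derivative_traj_def)
  then show "((\<lambda>s. vec_last (f s) b $ k) has_real_derivative vec_last (f' t) b $ k) (at t within {0..})"
    by (rule has_field_derivative_transform_within[where d = 1, THEN DERIV_cong])
      (use c t k in \<open>auto simp: vec_last_def\<close>)
qed (simp_all add: vec_last_def)

lemma has_derivative_traj_zero_const:
  assumes "has_derivative_traj n f (\<lambda>t. 0\<^sub>v n)" and "0 \<le> t"
  shows "f t = f 0"
proof (rule eq_vecI)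
  have c: "f s \<in> carrier_vec n" if "0 \<le> s" for s
    using assms(1) that by (auto simp: has_derivative_traj_def)
  show "dim_vec (f t) = dim_vec (f 0)" using c[of t] c[of 0] assms(2) by simp
  fix k assume "k < dim_vec (f 0)"
  then have k: "k < n" using c[of 0] by simp
  have "((\<lambda>s. f s $ k) has_real_derivative 0) (at s within {0..})" if "0 \<le> s" for s
    using assms(1) k that by (auto simp: has_derivative_traj_def)
  then obtain c where "\<And>s. s \<in> {0..} \<Longrightarrow> f s $ k = c"
    using has_field_derivative_zero_constant[of "{0..} :: real set" "\<lambda>s. f s $ k"] by auto
  then show "f t $ k = f 0 $ k" using assms(2) by simp
qed

section \<open>Euclidean spaces of all dimensions inside one Banach space\<close>

text \<open>Vectors of dimension \<open>d\<close> do not form a type, whereas the results on differential equations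
  hold in any type that is a Banach space. Piecewise linear interpolation embeds the vectors of every
  dimension into the space of bounded continuous functions; the hat function \<open>tent i\<close> is 1 at \<open>i\<close> and
  vanishes at the other integers, so that sampling at the integers recovers the coefficients.\<close>

definition tent :: "nat \<Rightarrow> real \<Rightarrow>\<^sub>C real" where
  "tent i = Bcontfun (\<lambda>x. max 0 (1 - \<bar>x - real i\<bar>))"

definition interpolate :: "nat \<Rightarrow> real vec \<Rightarrow> (real \<Rightarrow>\<^sub>C real)" where
  "interpolate n v = (\<Sum>i<n. (v $ i) *\<^sub>R tent i)"

definition sample :: "nat \<Rightarrow> (real \<Rightarrow>\<^sub>C real) \<Rightarrow> real vec" where
  "sample n x = vec n (\<lambda>i. apply_bcontfun x (real i))"

lemma apply_tent: "apply_bcontfun (tent i) x = max 0 (1 - \<bar>x - real i\<bar>)"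
proof -
  have "(\<lambda>x. max 0 (1 - \<bar>x - real i\<bar>)) \<in> bcontfun"
    by (rule bcontfun_normI[of _ 1]) (auto intro!: continuous_intros)
  then show ?thesis by (simp add: tent_def Bcontfun_inverse)
qed

lemma apply_tent_nat: "apply_bcontfun (tent i) (real j) = (if j = i then 1 else 0)"
proof -
  have "1 \<le> \<bar>real j - real i\<bar>" if "j \<noteq> i" using that by linarith
  then show ?thesis by (auto simp: apply_tent)
qed

lemma norm_tent_le: "norm (tent i) \<le> 1"
  by (rule norm_bound) (simp add: apply_tent)

lemma apply_sum_bcontfun: "apply_bcontfun (sum f A) x = (\<Sum>i\<in>A. apply_bcontfun (f i) x)"
  by (induction A rule: infinite_finite_induct) auto

lemma apply_interpolate: "apply_bcontfun (interpolate n v) (real j) = (if j < n then v $ j else 0)"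
  by (simp add: interpolate_def apply_sum_bcontfun apply_tent_nat if_distrib cong: if_cong)

lemma sample_interpolate [simp]: "v \<in> carrier_vec n \<Longrightarrow> sample n (interpolate n v) = v"
  by (auto simp: sample_def apply_interpolate)

lemma sample_carrier [simp]: "sample n x \<in> carrier_vec n"
  by (simp add: sample_def)

lemma interpolate_diff:
  assumes "v \<in> carrier_vec n" "w \<in> carrier_vec n"
  shows "interpolate n (v - w) = interpolate n v - interpolate n w"
  using assms by (simp add: interpolate_def scaleR_left_diff_distrib flip: sum_subtractf)

lemma interpolate_zero [simp]: "interpolate n (0\<^sub>v n) = 0"
  by (simp add: interpolate_def)

lemma norm_interpolate_le:
  assumes "v \<in> carrier_vec n"
  shows "norm (interpolate n v) \<le> real n * enorm v"
proof -
  have "norm (interpolate n v) \<le> (\<Sum>i<n. \<bar>v $ i\<bar> * norm (tent i))"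
    unfolding interpolate_def by (rule order_trans[OF norm_sum]) simp
  also have "\<dots> \<le> (\<Sum>i<n. enorm v * 1)"
    using assms by (intro sum_mono mult_mono norm_tent_le abs_index_le_enorm) auto
  finally show ?thesis by simp
qed

lemma enorm_sample_le: "enorm (sample n x) \<le> real n * norm x"
proof -
  have "enorm (sample n x) \<le> (\<Sum>i\<in>{0..<n}. \<bar>sample n x $ i\<bar>)"
    using L2_set_le_sum_abs[of "\<lambda>i. sample n x $ i" "{0..<n}"]
    by (simp add: enorm_eq_L2_set sample_def)
  also have "\<dots> \<le> (\<Sum>i\<in>{0..<n}. norm x)"
    using norm_bounded[of x] by (intro sum_mono) (auto simp: sample_def)
  finally show ?thesis by simp
qed

lemma sample_diff: "sample n x - sample n y = sample n (x - y)"
  by (auto simp: sample_def)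

lemma interpolate_has_vector_derivative:
  assumes "has_derivative_traj n f f'" "0 \<le> t"
  shows "((\<lambda>s. interpolate n (f s)) has_vector_derivative interpolate n (f' t)) (at t within {0..})"
  unfolding interpolate_def
proof (rule has_vector_derivative_sum)
  fix i assume "i \<in> {..<n}"
  then have "((\<lambda>s. f s $ i) has_real_derivative f' t $ i) (at t within {0..})"
    using assms by (auto simp: has_derivative_traj_def)
  from has_vector_derivative_scaleR[OF this has_vector_derivative_const[of "tent i"]]
  show "((\<lambda>s. f s $ i *\<^sub>R tent i) has_vector_derivative f' t $ i *\<^sub>R tent i) (at t within {0..})"
    by simp
qed

lemma bounded_linear_apply_bcontfun:
  "bounded_linear (\<lambda>x :: 'a::topological_space \<Rightarrow>\<^sub>C 'b::real_normed_vector. apply_bcontfun x i)"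
  by (rule bounded_linear_intro[where K = 1]) (auto intro: norm_bounded)

lemma sample_has_derivative_traj:
  assumes "\<And>t. 0 \<le> t \<Longrightarrow> (x has_vector_derivative x' t) (at t within {0..})"
  shows "has_derivative_traj n (\<lambda>t. sample n (x t)) (\<lambda>t. sample n (x' t))"
  unfolding has_derivative_traj_def
  using bounded_linear.has_vector_derivative[OF bounded_linear_apply_bcontfun assms]
  by (auto simp: sample_def has_real_derivative_iff_has_vector_derivative)

instance bcontfun :: (metric_space, banach) banach ..

lemma norm_interpolate_sample_le: "norm (interpolate d (sample d x)) \<le> (real d)\<^sup>2 * norm x"
proof -
  have "norm (interpolate d (sample d x)) \<le> real d * enorm (sample d x)"
    by (rule norm_interpolate_le) simp
  also have "\<dots> \<le> real d * (real d * norm x)" by (intro mult_left_mono enorm_sample_le) auto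
  finally show ?thesis by (simp add: power2_eq_square)
qed

lemma bounded_linear_interpolate_sample: "bounded_linear (\<lambda>x. interpolate d (sample d x))"
proof (rule bounded_linear_intro[where K = "(real d)\<^sup>2"])
  show "norm (interpolate d (sample d x)) \<le> norm x * (real d)\<^sup>2" for x
    using norm_interpolate_sample_le[of d x] by (simp add: mult.commute)
qed (simp_all add: interpolate_def sample_def scaleR_left_distrib sum.distrib scaleR_sum_right)

text \<open>The field is carried to the copy of the \<open>d\<close>-dimensional space inside the function space and
  extended by \<open>- \<mu>\<close> on the kernel of the projection \<open>interpolate d (sample d x)\<close>. The two components
  do not interact, and the second one decays at the rate \<open>\<mu>\<close> by itself; so the extended field is
  exponentially stable on the whole Banach space and has a converse Lyapunov function.\<close>

lemma vector_field_converse_lyapunov: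
  fixes f :: "real vec \<Rightarrow> real vec"
  assumes f: "\<And>v. v \<in> carrier_vec d \<Longrightarrow> f v \<in> carrier_vec d"
    and lip: "\<And>v w. v \<in> carrier_vec d \<Longrightarrow> w \<in> carrier_vec d \<Longrightarrow> enorm (f v - f w) \<le> L * enorm (v - w)"
    and f0: "f (0\<^sub>v d) = 0\<^sub>v d"
    and ges: "\<And>y t. has_derivative_traj d y (\<lambda>t. f (y t)) \<Longrightarrow> 0 \<le> t \<Longrightarrow>
      enorm (y t) \<le> c * exp (- \<mu> * t) * enorm (y 0)"
    and \<rho>: "0 < \<rho>" "\<rho> < \<mu>"
  shows "\<exists>F U C K. (\<forall>v\<in>carrier_vec d. F (interpolate d v) = interpolate d (f v)) \<and> 0 \<le> K \<and> 0 \<le> C \<and>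
    (\<forall>a. norm a \<le> U a \<and> U a \<le> C * norm a) \<and> (\<forall>a b. U a \<le> U b + K * norm (a - b)) \<and>
    (\<forall>a. \<exists>y. y 0 = a \<and> (\<forall>t\<ge>0. (y has_vector_derivative F (y t)) (at t within {0..})) \<and>
       (\<forall>t\<ge>0. U (y t) \<le> exp (- \<rho> * t) * U a))"
proof -
  define proj where "proj = (\<lambda>x. interpolate d (sample d x))"
  have bl: "bounded_linear proj" unfolding proj_def by (rule bounded_linear_interpolate_sample)
  interpret proj: bounded_linear proj by (rule bl)
  have proj_norm: "norm (proj x) \<le> (real d)\<^sup>2 * norm x" for x
    unfolding proj_def by (rule norm_interpolate_sample_le)
  have proj_interpolate: "proj (interpolate d v) = interpolate d v" if "v \<in> carrier_vec d" for v
    using that by (simp add: proj_def)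
  have vec_proj: "sample d (x - proj x) = 0\<^sub>v d" for x
    unfolding proj_def by (auto simp: apply_interpolate sample_def)
  have fc: "f (sample d x) \<in> carrier_vec d" for x by (rule f) simp
  define F where "F = (\<lambda>x. interpolate d (f (sample d x)) - \<mu> *\<^sub>R (x - proj x))"
  define L' where "L' = \<bar>L\<bar> * (real d)\<^sup>2 + \<mu> * (1 + (real d)\<^sup>2)"
  have \<mu>: "0 < \<mu>" using \<rho> by simp
  have F_lip: "L'-lipschitz_on UNIV F"
  proof (rule lipschitz_onI)
    show "0 \<le> L'" using \<mu> by (simp add: L'_def)
    fix x y :: "real \<Rightarrow>\<^sub>C real"
    have "F x - F y = interpolate d (f (sample d x) - f (sample d y)) - \<mu> *\<^sub>R ((x - y) - proj (x - y))"
      unfolding F_def interpolate_diff[OF fc fc] proj.diff by (simp add: algebra_simps)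
    then have "norm (F x - F y) \<le> norm (interpolate d (f (sample d x) - f (sample d y)))
        + norm (\<mu> *\<^sub>R ((x - y) - proj (x - y)))"
      by (simp only: norm_triangle_ineq4)
    also have "norm (\<mu> *\<^sub>R ((x - y) - proj (x - y))) \<le> \<mu> * (norm (x - y) + (real d)\<^sup>2 * norm (x - y))"
      using \<mu> norm_triangle_ineq4[of "x - y" "proj (x - y)"] proj_norm[of "x - y"]
      by (simp add: mult_left_mono)
    also have "norm (interpolate d (f (sample d x) - f (sample d y)))
        \<le> real d * (\<bar>L\<bar> * (real d * norm (x - y)))"
    proof -
      have "norm (interpolate d (f (sample d x) - f (sample d y)))
        \<le> real d * enorm (f (sample d x) - f (sample d y))"
        using fc[of x] fc[of y] by (intro norm_interpolate_le) auto
      also have "enorm (f (sample d x) - f (sample d y)) \<le> L * enorm (sample d x - sample d y)"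
        by (rule lip) auto
      also have "\<dots> \<le> \<bar>L\<bar> * enorm (sample d (x - y))"
        unfolding sample_diff by (intro mult_right_mono) auto
      also have "\<dots> \<le> \<bar>L\<bar> * (real d * norm (x - y))" by (intro mult_left_mono enorm_sample_le) auto
      finally show ?thesis by (simp add: mult_left_mono)
    qed
    finally show "dist (F x) (F y) \<le> L' * dist x y"
      by (simp add: dist_norm L'_def algebra_simps power2_eq_square)
  qed
  have v0: "sample d 0 = 0\<^sub>v d" by (auto simp: sample_def)
  have F0: "F 0 = 0" by (simp add: F_def v0 f0 proj.zero)
  define C0 where "C0 = \<bar>c\<bar> * (real d)\<^sup>2 + (1 + (real d)\<^sup>2)"
  have F_ges: "norm (y t) \<le> C0 * exp (- \<mu> * t) * norm (y 0)"
    if y: "\<And>s. 0 \<le> s \<Longrightarrow> (y has_vector_derivative F (y s)) (at s within {0..})" and t: "0 \<le> t" for y t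
  proof -
    define e where "e = (\<lambda>s. sample d (y s))"
    have Fe: "sample d (F x) = f (sample d x)" for x
    proof -
      have "sample d (F x) = sample d (interpolate d (f (sample d x))) - sample d (\<mu> *\<^sub>R (x - proj x))"
        unfolding F_def sample_diff ..
      also have "sample d (\<mu> *\<^sub>R (x - proj x)) = \<mu> \<cdot>\<^sub>v sample d (x - proj x)"
        by (auto simp: sample_def)
      finally show ?thesis unfolding vec_proj using fc[of x] by (auto intro!: eq_vecI)
    qed
    have "has_derivative_traj d e (\<lambda>t. f (e t))"
      using sample_has_derivative_traj[OF y, of d] unfolding e_def Fe .
    from ges[OF this t] have "enorm (e t) \<le> c * exp (- \<mu> * t) * enorm (e 0)" .
    also have "\<dots> \<le> \<bar>c\<bar> * exp (- \<mu> * t) * (real d * norm (y 0))"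
      unfolding e_def by (intro mult_mono enorm_sample_le mult_right_mono) auto
    finally have "real d * enorm (e t) \<le> real d * (\<bar>c\<bar> * exp (- \<mu> * t) * (real d * norm (y 0)))"
      by (rule mult_left_mono) simp
    then have 1: "norm (proj (y t)) \<le> \<bar>c\<bar> * (real d)\<^sup>2 * exp (- \<mu> * t) * norm (y 0)"
      using norm_interpolate_le[of "e t" d] by (simp add: proj_def e_def mult_ac power2_eq_square)
    \<comment> \<open>the kernel component is an explicit exponential: after rescaling it is constant\<close>
    define k where "k = (\<lambda>s. exp (\<mu> * s) *\<^sub>R (y s - proj (y s)))"
    have "(k has_vector_derivative 0) (at s within {0..})" if s: "0 \<le> s" for s
    proof -
      have F': "F (y s) - proj (F (y s)) = - \<mu> *\<^sub>R (y s - proj (y s))"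
      proof -
        have "proj (F (y s)) = interpolate d (f (sample d (y s)))"
          unfolding proj_def Fe ..
        then show ?thesis by (simp add: F_def)
      qed
      have "((\<lambda>s. y s - proj (y s)) has_vector_derivative - \<mu> *\<^sub>R (y s - proj (y s))) (at s within {0..})"
        unfolding F'[symmetric]
        by (intro has_vector_derivative_diff y s bounded_linear.has_vector_derivative[OF bl])
      moreover have "((\<lambda>s. exp (\<mu> * s)) has_real_derivative \<mu> * exp (\<mu> * s)) (at s within {0..})"
        by (auto intro!: derivative_eq_intros)
      ultimately have "(k has_vector_derivative exp (\<mu> * s) *\<^sub>R (- \<mu> *\<^sub>R (y s - proj (y s)))
          + (\<mu> * exp (\<mu> * s)) *\<^sub>R (y s - proj (y s))) (at s within {0..})"
        unfolding k_def by (rule has_vector_derivative_scaleR[rotated])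
      then show ?thesis by (simp add: mult.commute)
    qed
    then obtain k0 where "\<And>s. 0 \<le> s \<Longrightarrow> k s = k0"
      using has_vector_derivative_zero_constant[of "{0..}" k] by (metis atLeast_iff convex_real_interval(1))
    then have "k t = k 0" using t by simp
    have 2: "norm (y t - proj (y t)) \<le> (1 + (real d)\<^sup>2) * exp (- \<mu> * t) * norm (y 0)"
    proof -
      have "exp (\<mu> * t) * norm (y t - proj (y t)) = norm (k t)" by (simp add: k_def)
      also have "\<dots> = norm (y 0 - proj (y 0))" unfolding \<open>k t = k 0\<close> by (simp add: k_def)
      also have "\<dots> \<le> (1 + (real d)\<^sup>2) * norm (y 0)"
        using norm_triangle_ineq4[of "y 0" "proj (y 0)"] proj_norm[of "y 0"] by (simp add: distrib_right)
      finally show ?thesis by (simp add: exp_minus field_simps)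
    qed
    have "norm (y t) \<le> norm (proj (y t)) + norm (y t - proj (y t))" by (simp add: norm_triangle_sub)
    also have "\<dots> \<le> C0 * exp (- \<mu> * t) * norm (y 0)" using 1 2 by (simp add: C0_def algebra_simps)
    finally show ?thesis .
  qed
  have "F (interpolate d v) = interpolate d (f v)" if "v \<in> carrier_vec d" for v
    using that by (simp add: F_def proj_interpolate)
  then show ?thesis
    using converse_lyapunov[of L' F C0 \<mu> \<rho>, OF F_lip F0 F_ges \<rho>] by blast
qed

section \<open>The graph Laplacian\<close>

lemma laplacian_carrier [simp]: "laplacian N G \<in> carrier_mat N N"
  by (simp add: laplacian_def)

lemma connected_graph_finite_nbrs:
  assumes "connected_graph N G"
  shows "nbrs G i \<subseteq> {..<N}" "finite (nbrs G i)"
  using assms finite_subset[of "nbrs G i" "{..<N}"] by (auto simp: connected_graph_def nbrs_def)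

text \<open>The diagonal entry is minus the sum of the others, which turns the row sum into differences.\<close>

lemma laplacian_row_sum:
  assumes G: "connected_graph N G" and i: "i < N"
  shows "(\<Sum>j<N. laplacian N G $$ (i, j) * v j) = (\<Sum>j\<in>nbrs G i. v i - v j)"
proof -
  have ii: "(i, i) \<notin> G" using G by (auto simp: connected_graph_def irrefl_def)
  define l where "l = (\<lambda>j. if (j, i) \<in> G then - 1 else 0 :: real)"
  have "(\<Sum>j<N. laplacian N G $$ (i, j) * v j)
    = laplacian N G $$ (i, i) * v i + (\<Sum>j\<in>{..<N} - {i}. laplacian N G $$ (i, j) * v j)"
    using i by (intro sum.remove) auto
  also have "\<dots> = - (\<Sum>j\<in>{..<N} - {i}. l j) * v i + (\<Sum>j\<in>{..<N} - {i}. l j * v j)"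
    using i by (intro arg_cong2[where f = "(+)"] sum.cong) (auto simp: laplacian_def l_def)
  also have "\<dots> = (\<Sum>j\<in>{..<N} - {i}. - l j * (v i - v j))"
    by (simp add: sum_distrib_right sum_negf right_diff_distrib sum_subtractf)
  also have "\<dots> = (\<Sum>j\<in>nbrs G i. v i - v j)"
    using connected_graph_finite_nbrs[OF G, of i] ii
    by (intro sum.mono_neutral_cong_right) (auto simp: nbrs_def l_def)
  finally show ?thesis .
qed

lemma laplacian_symmetric:
  assumes G: "connected_graph N G"
  shows "(laplacian N G)\<^sup>T = laplacian N G"
  using G by (intro eq_matI) (auto simp: laplacian_def connected_graph_def dest: symD)

lemma laplacian_mult_ones:
  assumes G: "connected_graph N G"
  shows "laplacian N G * ones N = 0\<^sub>m N 1"
proof (rule eq_matI)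
  fix i j assume "i < dim_row (0\<^sub>m N 1 :: real mat)" "j < dim_col (0\<^sub>m N 1 :: real mat)"
  then have i: "i < N" and j: "j = 0" by auto
  have "(laplacian N G * ones N) $$ (i, j) = (\<Sum>k<N. laplacian N G $$ (i, k) * ones N $$ (k, j))"
    using i j by (intro mult_mat_index[of _ N N _ 1]) auto
  also have "\<dots> = (\<Sum>k<N. laplacian N G $$ (i, k) * 1)"
    using j by (intro sum.cong refl) (auto simp: ones_def)
  also have "\<dots> = 0" by (subst laplacian_row_sum[OF G i]) simp
  finally show "(laplacian N G * ones N) $$ (i, j) = 0\<^sub>m N 1 $$ (i, j)" using i j by simp
qed (auto simp: ones_def carrier_matD[OF laplacian_carrier])

text \<open>As every edge occurs in both orientations, the double sum may be averaged with its transpose.\<close>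

lemma laplacian_quadratic_form:
  assumes G: "connected_graph N G" and v: "v \<in> carrier_vec N"
  shows "v \<bullet> (laplacian N G *\<^sub>v v) = (\<Sum>i<N. \<Sum>j\<in>nbrs G i. (v $ i - v $ j)\<^sup>2) / 2"
proof -
  define a where "a = (\<lambda>i j. if (j, i) \<in> G then 1 else 0 :: real)"
  have sym: "a i j = a j i" for i j using G by (auto simp: a_def connected_graph_def dest: symD)
  have nbr: "(\<Sum>j\<in>nbrs G i. f j) = (\<Sum>j<N. a i j * f j)" for i and f :: "nat \<Rightarrow> real"
    using connected_graph_finite_nbrs[OF G, of i]
    by (intro sum.mono_neutral_cong_left) (auto simp: nbrs_def a_def)
  have "v \<bullet> (laplacian N G *\<^sub>v v) = (\<Sum>i<N. v $ i * (\<Sum>j<N. laplacian N G $$ (i, j) * v $ j))"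
    using carrier_matD[OF laplacian_carrier[of N G]]
    by (simp add: scalar_prod_def[of v] flip: lessThan_atLeast0
        add: mult_mat_vec_index[OF laplacian_carrier v] del: index_mult_mat_vec)
  also have "\<dots> = (\<Sum>i<N. v $ i * (\<Sum>j\<in>nbrs G i. v $ i - v $ j))"
    by (intro sum.cong refl) (auto simp: laplacian_row_sum[OF G])
  also have "\<dots> = (\<Sum>i<N. \<Sum>j<N. a i j * (v $ i * (v $ i - v $ j)))" (is "_ = ?X")
    by (simp add: nbr sum_distrib_left mult_ac)
  finally have X: "v \<bullet> (laplacian N G *\<^sub>v v) = ?X" .
  have "?X = (\<Sum>j<N. \<Sum>i<N. a i j * (v $ i * (v $ i - v $ j)))" by (rule sum.swap)
  also have "\<dots> = (\<Sum>i<N. \<Sum>j<N. a i j * (v $ j * (v $ j - v $ i)))"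
    by (simp add: sym)
  finally have "?X + ?X = (\<Sum>i<N. \<Sum>j<N. a i j * (v $ i * (v $ i - v $ j))) +
      (\<Sum>i<N. \<Sum>j<N. a i j * (v $ j * (v $ j - v $ i)))" by simp
  also have "\<dots> = (\<Sum>i<N. \<Sum>j<N. a i j * (v $ i - v $ j)\<^sup>2)"
    by (simp flip: sum.distrib add: power2_eq_square algebra_simps)
  finally show ?thesis unfolding X nbr by simp
qed

lemma Lambda_P_carrier [simp]: "R \<in> carrier_mat N (N - 1) \<Longrightarrow> Lambda_P N G R \<in> carrier_mat (N - 1) (N - 1)"
  unfolding Lambda_P_def by (intro mult_carrier_mat[of _ _ N]) auto

lemma Lambda_P_symmetric:
  assumes G: "connected_graph N G" and R: "R \<in> carrier_mat N (N - 1)"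
  shows "(Lambda_P N G R)\<^sup>T = Lambda_P N G R"
proof -
  have "(Lambda_P N G R)\<^sup>T = R\<^sup>T * (R\<^sup>T * laplacian N G)\<^sup>T"
    unfolding Lambda_P_def using R by (intro transpose_mult[of _ "N - 1" N]) auto
  also have "(R\<^sup>T * laplacian N G)\<^sup>T = laplacian N G * R"
    using R by (subst transpose_mult[of _ "N - 1" N _ N]) (auto simp: laplacian_symmetric[OF G])
  also have "R\<^sup>T * (laplacian N G * R) = Lambda_P N G R"
    unfolding Lambda_P_def using R by (intro assoc_mult_mat[symmetric, of _ "N - 1" N _ N]) auto
  finally show ?thesis .
qed

text \<open>A vector \<open>u = R *\<^sub>v v\<close> on which the form of the Laplacian vanishes is constant along edges, hence
  constant by connectedness; being orthogonal to the vector of ones, it is zero.\<close>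

lemma coercive_Lambda_P:
  assumes G: "connected_graph N G" and N: "0 < N" and R: "R \<in> carrier_mat N (N - 1)"
    and RR: "R\<^sup>T * R = 1\<^sub>m (N - 1)" and R1: "(ones N)\<^sup>T * R = 0\<^sub>m 1 (N - 1)"
  shows "coercive (N - 1) (Lambda_P N G R)"
proof (rule coercive_of_semidefinite[OF Lambda_P_carrier[OF R] Lambda_P_symmetric[OF G R]])
  fix v :: "real vec" assume v: "v \<in> carrier_vec (N - 1)"
  define u where "u = R *\<^sub>v v"
  have u: "u \<in> carrier_vec N" using R v by (simp add: u_def)
  have Lu: "laplacian N G *\<^sub>v u \<in> carrier_vec N"
    by (rule mult_mat_vec_carrier[OF laplacian_carrier u])
  have "v \<bullet> (Lambda_P N G R *\<^sub>v v) = v \<bullet> (R\<^sup>T *\<^sub>v (laplacian N G *\<^sub>v u))"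
    unfolding Lambda_P_def u_def using R v assoc_mult_mat_vec[of "R\<^sup>T * laplacian N G" "N - 1" N R "N - 1" v]
      assoc_mult_mat_vec[of "R\<^sup>T" "N - 1" N "laplacian N G" N "R *\<^sub>v v"] by simp
  also have "\<dots> = (R\<^sup>T *\<^sub>v (laplacian N G *\<^sub>v u)) \<bullet> v"
    using R v u by (intro comm_scalar_prod[of _ "N - 1"] mult_mat_vec_carrier[of _ "N - 1" N]
        mult_mat_vec_carrier[of _ N N]) auto
  also have "\<dots> = (laplacian N G *\<^sub>v u) \<bullet> u"
    unfolding u_def by (rule transpose_vec_mult_scalar[OF R v Lu[unfolded u_def]])
  also have "\<dots> = u \<bullet> (laplacian N G *\<^sub>v u)"
    using u Lu by (intro comm_scalar_prod[of _ N])
  finally have q: "v \<bullet> (Lambda_P N G R *\<^sub>v v) = (\<Sum>i<N. \<Sum>j\<in>nbrs G i. (u $ i - u $ j)\<^sup>2) / 2"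
    unfolding laplacian_quadratic_form[OF G u] .
  show "0 \<le> v \<bullet> (Lambda_P N G R *\<^sub>v v)" unfolding q by (simp add: sum_nonneg)
  assume "v \<bullet> (Lambda_P N G R *\<^sub>v v) = 0"
  then have z: "(u $ i - u $ j)\<^sup>2 = 0" if "i < N" "j \<in> nbrs G i" for i j
    using q that connected_graph_finite_nbrs(2)[OF G]
    by (auto simp: sum_nonneg_eq_0_iff sum_nonneg)
  have edge: "u $ i = u $ j" if "(j, i) \<in> G" for i j
  proof -
    have "i < N" using that G by (auto simp: connected_graph_def)
    then show ?thesis using z[of i j] that by (simp add: nbrs_def)
  qed
  have path: "u $ j = u $ i" if "(j, i) \<in> G\<^sup>*" for i j
    using that by (induction rule: rtrancl_induct) (auto dest: edge)
  have const: "u $ i = u $ 0" if "i < N" for i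
    using path[of i 0] that G N by (auto simp: connected_graph_def)
  have "((ones N)\<^sup>T *\<^sub>v u) $ 0 = (\<Sum>k<N. (ones N)\<^sup>T $$ (0, k) * u $ k)"
    using u by (intro mult_mat_vec_index[of _ 1]) auto
  also have "\<dots> = (\<Sum>k<N. u $ 0)"
  proof (intro sum.cong refl)
    fix k assume "k \<in> {..<N}"
    then show "(ones N)\<^sup>T $$ (0, k) * u $ k = u $ 0" using const[of k] by (simp add: ones_def)
  qed
  finally have "real N * u $ 0 = ((ones N)\<^sup>T *\<^sub>v u) $ 0" by simp
  also have "(ones N)\<^sup>T *\<^sub>v u = ((ones N)\<^sup>T * R) *\<^sub>v v"
    unfolding u_def using R v by (intro assoc_mult_mat_vec[symmetric, of _ 1 N _ "N - 1"]) auto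
  also have "\<dots> $ 0 = 0" unfolding R1 using v by simp
  finally have "u $ 0 = 0" using N by simp
  have "u = 0\<^sub>v N"
  proof (rule eq_vecI)
    fix i assume "i < dim_vec (0\<^sub>v N :: real vec)"
    then show "u $ i = 0\<^sub>v N $ i" using const[of i] \<open>u $ 0 = 0\<close> by simp
  qed (use u in simp)
  moreover have "v = R\<^sup>T *\<^sub>v u"
    unfolding u_def using R v RR assoc_mult_mat_vec[of "R\<^sup>T" "N - 1" N R "N - 1" v] by simp
  ultimately show "v = 0\<^sub>v (N - 1)" using R by (intro eq_vecI) auto
qed

text \<open>The sums over neighbours in the agents' feedback amount, for the stacked outputs, to minus the
  Laplacian.\<close>

lemma neighbour_difference_stack:
  assumes G: "connected_graph N G" and v: "\<And>i. i < N \<Longrightarrow> v i \<in> carrier_vec q"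
  shows "i < N \<Longrightarrow> finsum_vec TYPE(real) q (\<lambda>j. v j - v i) (nbrs G i) \<in> carrier_vec q"
    and "stack N q (\<lambda>i. finsum_vec TYPE(real) q (\<lambda>j. v j - v i) (nbrs G i))
      = - ((laplacian N G \<otimes>\<^sub>K 1\<^sub>m q) *\<^sub>v stack N q v)"
proof -
  have F: "(\<lambda>j. v j - v i) \<in> nbrs G i \<rightarrow> carrier_vec q" if "i < N" for i
    using v that connected_graph_finite_nbrs(1)[OF G, of i] by auto
  show "i < N \<Longrightarrow> finsum_vec TYPE(real) q (\<lambda>j. v j - v i) (nbrs G i) \<in> carrier_vec q"
    by (rule finsum_vec_closed[OF F])
  have "(laplacian N G \<otimes>\<^sub>K 1\<^sub>m q) *\<^sub>v stack N q v
    = stack N q (\<lambda>i. vec q (\<lambda>k. \<Sum>j<N. laplacian N G $$ (i, j) * (1\<^sub>m q *\<^sub>v v j) $ k))"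
    by (rule kron_mult_stack[OF laplacian_carrier one_carrier_mat v])
  also have "\<dots> = stack N q (\<lambda>i. (- 1) \<cdot>\<^sub>v finsum_vec TYPE(real) q (\<lambda>j. v j - v i) (nbrs G i))"
  proof (rule stack_cong, rule eq_vecI)
    fix i k assume i: "i < N" and "k < dim_vec ((- 1) \<cdot>\<^sub>v finsum_vec TYPE(real) q (\<lambda>j. v j - v i) (nbrs G i))"
    then have k: "k < q" using carrier_vecD[OF finsum_vec_closed[OF F[OF i]]] by simp
    have nb: "j < N" if "j \<in> nbrs G i" for j using that connected_graph_finite_nbrs(1)[OF G, of i] by auto
    have "(\<Sum>j<N. laplacian N G $$ (i, j) * (1\<^sub>m q *\<^sub>v v j) $ k) = (\<Sum>j<N. laplacian N G $$ (i, j) * v j $ k)"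
      using v by (intro sum.cong refl) simp
    also have "\<dots> = (\<Sum>j\<in>nbrs G i. v i $ k - v j $ k)" by (rule laplacian_row_sum[OF G i])
    also have "\<dots> = - (\<Sum>j\<in>nbrs G i. (v j - v i) $ k)"
      unfolding sum_negf[symmetric] using k carrier_vecD[OF v[OF i]] by (intro sum.cong refl) simp
    also have "(\<Sum>j\<in>nbrs G i. (v j - v i) $ k) = finsum_vec TYPE(real) q (\<lambda>j. v j - v i) (nbrs G i) $ k"
      by (rule index_finsum_vec[OF connected_graph_finite_nbrs(2)[OF G] k F[OF i], symmetric])
    finally show "vec q (\<lambda>k. \<Sum>j<N. laplacian N G $$ (i, j) * (1\<^sub>m q *\<^sub>v v j) $ k) $ k
      = ((- 1) \<cdot>\<^sub>v finsum_vec TYPE(real) q (\<lambda>j. v j - v i) (nbrs G i)) $ k"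
      using k carrier_vecD[OF finsum_vec_closed[OF F[OF i]]] by simp
  next
    fix i assume "i < N"
    then show "dim_vec (vec q (\<lambda>k. \<Sum>j<N. laplacian N G $$ (i, j) * (1\<^sub>m q *\<^sub>v v j) $ k))
      = dim_vec ((- 1) \<cdot>\<^sub>v finsum_vec TYPE(real) q (\<lambda>j. v j - v i) (nbrs G i))"
      using carrier_vecD[OF finsum_vec_closed[OF F]] by simp
  qed
  also have "\<dots> = (- 1) \<cdot>\<^sub>v stack N q (\<lambda>i. finsum_vec TYPE(real) q (\<lambda>j. v j - v i) (nbrs G i))"
    by (rule stack_smult) (rule finsum_vec_closed[OF F])
  finally show "stack N q (\<lambda>i. finsum_vec TYPE(real) q (\<lambda>j. v j - v i) (nbrs G i))
      = - ((laplacian N G \<otimes>\<^sub>K 1\<^sub>m q) *\<^sub>v stack N q v)"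
    by (auto intro!: eq_vecI)
qed

section \<open>Scalar decay certificates\<close>

lemma weighted_young:
  fixes a s x y :: real
  assumes "0 < s"
  shows "a * x * y \<le> s * x\<^sup>2 + a\<^sup>2 / (4 * s) * y\<^sup>2"
proof -
  have "0 \<le> s * (x - a / (2 * s) * y)\<^sup>2" using assms by simp
  also have "\<dots> = s * x\<^sup>2 - a * x * y + a\<^sup>2 / (4 * s) * y\<^sup>2"
    using assms by (simp add: field_simps power2_eq_square)
  finally show ?thesis by simp
qed

lemma mult_le_sum_squares: "(x::real) * y \<le> x\<^sup>2 + y\<^sup>2"
proof -
  have "0 \<le> (x - y / 2)\<^sup>2 + 3 / 4 * y\<^sup>2" by simp
  also have "\<dots> = x\<^sup>2 + y\<^sup>2 - x * y" by (simp add: power2_eq_square algebra_simps)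
  finally show ?thesis by simp
qed

text \<open>The decay of the interconnection reduced to one inequality between real numbers. Here \<open>u\<close>, \<open>x\<close>, \<open>y\<close>
  stand for \<open>U e\<close>, \<open>enorm w\<close>, \<open>enorm \<xi>\<close>, where \<open>U\<close> decays at the rate \<open>\<rho>\<close> along the blended dynamics;
  \<open>b\<close> bounds the matrices involved from above and \<open>c\<close> from below, \<open>L\<close> is the Lipschitz constant of
  the term driving \<open>w\<close>, and \<open>\<gamma>\<close> measures how strongly \<open>w\<close> disturbs \<open>U\<close>. With
  \<open>V = (\<alpha> * (w \<bullet> (Y *\<^sub>v w)) + \<beta> * (\<xi> \<bullet> \<xi>)) / 2 + \<epsilon> * (w \<bullet> (T *\<^sub>v \<xi>))\<close> the left side of the last inequality
  bounds the derivative of \<open>U\<^sup>2 + V\<close>, and the parenthesis on its right bounds \<open>U\<^sup>2 + V\<close> itself. The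
  identity \<open>\<alpha> * kI = \<beta> * \<kappa>\<close> cancels the products of \<open>w\<close> and \<open>\<xi>\<close> in the derivative of the part of \<open>V\<close>
  without \<open>\<epsilon>\<close>, and the bound on \<open>\<epsilon>\<close> keeps \<open>V\<close> positive definite.\<close>

definition decay_certificate ::
  "real \<Rightarrow> real \<Rightarrow> real \<Rightarrow> real \<Rightarrow> real \<Rightarrow> real \<Rightarrow> real \<Rightarrow> real \<Rightarrow> real \<Rightarrow> real \<Rightarrow> real \<Rightarrow> real \<Rightarrow> bool" where
  "decay_certificate b c L \<gamma> \<rho> kP kI \<kappa> \<alpha> \<beta> \<epsilon> r \<longleftrightarrow>
     0 < \<alpha> \<and> 0 < \<beta> \<and> 0 \<le> \<epsilon> \<and> 0 \<le> r \<and> \<alpha> * kI = \<beta> * \<kappa> \<and> 4 * \<epsilon>\<^sup>2 * b\<^sup>2 \<le> \<alpha> * \<beta> * c \<and>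
     (\<forall>u x y. 0 \<le> u \<longrightarrow> 0 \<le> x \<longrightarrow> 0 \<le> y \<longrightarrow>
        2 * u * (- \<rho> * u + \<gamma> * x) +
        (\<alpha> * b * x * (L * (u + x)) - \<alpha> * kP * c * x\<^sup>2 +
         \<epsilon> * (b * y * (L * (u + x)) + kP * b * x * y - kI * c * y\<^sup>2 + \<kappa> * b * x\<^sup>2))
        \<le> - 2 * r * (u\<^sup>2 + (\<alpha> * b + \<beta> + \<epsilon> * b) * (x\<^sup>2 + y\<^sup>2)))"

text \<open>With gains proportional to \<open>kP\<close> the dissipation in \<open>x\<close> and, through a fixed \<open>\<epsilon>\<close>, also the one
  in \<open>y\<close> grow with \<open>kP\<close>. Everything else that hits \<open>x\<close> and \<open>y\<close> is bounded, so only the decay of \<open>u\<close>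
  limits the rate; the margin \<open>\<delta> = \<rho> - r\<close> pays for the cross terms with \<open>u\<close>.\<close>

lemma decay_certificate_proportional_gains:
  fixes b c L \<gamma> \<rho> \<phi> r :: real
  assumes pos: "0 < b" "0 < c" "0 < L" "0 < \<phi>" "0 \<le> r" "r < \<rho>"
  shows "\<exists>k0>0. \<forall>kP>k0. \<exists>\<alpha> \<beta> \<epsilon>. decay_certificate b c L \<gamma> \<rho> kP (\<phi> * kP) (\<phi> * kP) \<alpha> \<beta> \<epsilon> r"
proof -
  define \<delta> where "\<delta> = \<rho> - r"
  have \<delta>: "0 < \<delta>" using pos by (simp add: \<delta>_def)
  \<comment> \<open>the three bounds absorb \<open>kP * b * x * y\<close>, absorb \<open>\<kappa> * b * x\<^sup>2\<close>, and keep \<open>V\<close> positive definite\<close>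
  define \<epsilon> where "\<epsilon> = min (\<phi> * c\<^sup>2 / (4 * b\<^sup>2)) (min (c / (4 * \<phi> * b)) (sqrt c / (2 * b)))"
  have \<epsilon>: "0 < \<epsilon>" using pos by (simp add: \<epsilon>_def)
  have e1: "\<epsilon> * b\<^sup>2 \<le> \<phi> * c\<^sup>2 / 4"
  proof -
    have "\<epsilon> * b\<^sup>2 \<le> \<phi> * c\<^sup>2 / (4 * b\<^sup>2) * b\<^sup>2" unfolding \<epsilon>_def by (intro mult_right_mono) auto
    then show ?thesis using pos by simp
  qed
  have e2: "\<epsilon> * \<phi> * b \<le> c / 4"
  proof -
    have "\<epsilon> * (\<phi> * b) \<le> c / (4 * \<phi> * b) * (\<phi> * b)"
      unfolding \<epsilon>_def using pos by (intro mult_right_mono) auto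
    then show ?thesis using pos by (simp add: mult_ac)
  qed
  have e3: "4 * \<epsilon>\<^sup>2 * b\<^sup>2 \<le> c"
  proof -
    have "2 * \<epsilon> * b \<le> 2 * (sqrt c / (2 * b)) * b"
      unfolding \<epsilon>_def using pos by (intro mult_right_mono mult_left_mono) auto
    then have "2 * \<epsilon> * b \<le> sqrt c" using pos by simp
    then have "(2 * \<epsilon> * b)\<^sup>2 \<le> (sqrt c)\<^sup>2" using \<epsilon> pos by (intro power_mono) auto
    then show ?thesis using pos by (simp add: power_mult_distrib)
  qed
  define M where "M = b + 1 + \<epsilon> * b"
  \<comment> \<open>\<open>B\<close> and \<open>C\<close> collect the coefficients of \<open>x\<^sup>2\<close> and \<open>y\<^sup>2\<close> that do not grow with \<open>kP\<close>\<close>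
  define B where "B = (2 * \<gamma> + b * L)\<^sup>2 / (4 * \<delta>) + b * L + \<epsilon> * b * L"
  define C where "C = (\<epsilon> * b * L)\<^sup>2 / (4 * \<delta>) + \<epsilon> * b * L"
  define k0 where "k0 = max 1 (max ((B + 2 * r * M) / (c / 2)) ((C + 2 * r * M) / (\<epsilon> * \<phi> * c / 2)))"
  show ?thesis
  proof (rule exI[of _ k0], intro conjI allI impI)
    have "1 \<le> k0" unfolding k0_def by (rule max.cobounded1)
    then show "0 < k0" by linarith
  next
    fix kP assume k: "k0 < kP"
    have kP: "0 < kP" using k by (simp add: k0_def)
    have kB: "B - kP * c / 2 \<le> - 2 * r * M"
    proof -
      have "(B + 2 * r * M) / (c / 2) \<le> kP" using k by (simp add: k0_def)
      then show ?thesis using pos by (simp add: field_simps)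
    qed
    have kC: "C - kP * (\<epsilon> * \<phi> * c) / 2 \<le> - 2 * r * M"
    proof -
      have "(C + 2 * r * M) / (\<epsilon> * \<phi> * c / 2) \<le> kP" using k by (simp add: k0_def)
      moreover have "0 < \<epsilon> * \<phi> * c / 2" using \<epsilon> pos by simp
      ultimately have "C + 2 * r * M \<le> kP * (\<epsilon> * \<phi> * c / 2)" by (simp only: pos_divide_le_eq)
      then show ?thesis by simp
    qed
    show "\<exists>\<alpha> \<beta> \<epsilon>. decay_certificate b c L \<gamma> \<rho> kP (\<phi> * kP) (\<phi> * kP) \<alpha> \<beta> \<epsilon> r"
    proof (intro exI)
      show "decay_certificate b c L \<gamma> \<rho> kP (\<phi> * kP) (\<phi> * kP) 1 1 \<epsilon> r"
        unfolding decay_certificate_def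
      proof (intro conjI allI impI)
        fix u x y :: real assume u: "0 \<le> u" and x: "0 \<le> x" and y: "0 \<le> y"
        have p1: "(2 * \<gamma> + b * L) * u * x \<le> \<delta> * u\<^sup>2 + (2 * \<gamma> + b * L)\<^sup>2 / (4 * \<delta>) * x\<^sup>2"
          by (rule weighted_young[OF \<delta>])
        have p2: "(\<epsilon> * b * L) * u * y \<le> \<delta> * u\<^sup>2 + (\<epsilon> * b * L)\<^sup>2 / (4 * \<delta>) * y\<^sup>2"
          by (rule weighted_young[OF \<delta>])
        have p3: "(\<epsilon> * b * L) * (x * y) \<le> (\<epsilon> * b * L) * (x\<^sup>2 + y\<^sup>2)"
          using \<epsilon> pos by (intro mult_left_mono mult_le_sum_squares) auto
        have p4: "kP * ((\<epsilon> * b) * x * y) \<le> kP * (c / 4 * x\<^sup>2 + (\<epsilon> * \<phi> * c / 4) * y\<^sup>2)"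
        proof (rule mult_left_mono)
          have "(\<epsilon> * b) * x * y \<le> c / 4 * x\<^sup>2 + (\<epsilon> * b)\<^sup>2 / (4 * (c / 4)) * y\<^sup>2"
            using pos by (intro weighted_young) simp
          also have "(\<epsilon> * b)\<^sup>2 / (4 * (c / 4)) = \<epsilon> / c * (\<epsilon> * b\<^sup>2)"
            by (simp add: power2_eq_square)
          also have "\<epsilon> / c * (\<epsilon> * b\<^sup>2) * y\<^sup>2 \<le> \<epsilon> / c * (\<phi> * c\<^sup>2 / 4) * y\<^sup>2"
            using \<epsilon> pos by (intro mult_right_mono mult_left_mono e1) auto
          also have "\<epsilon> / c * (\<phi> * c\<^sup>2 / 4) = \<epsilon> * \<phi> * c / 4" using pos by (simp add: power2_eq_square)
          finally show "(\<epsilon> * b) * x * y \<le> c / 4 * x\<^sup>2 + (\<epsilon> * \<phi> * c / 4) * y\<^sup>2" by simp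
        qed (use kP in simp)
        have p5: "kP * ((\<epsilon> * \<phi> * b) * x\<^sup>2) \<le> kP * (c / 4 * x\<^sup>2)"
          using kP by (intro mult_left_mono mult_right_mono e2) auto
        have p6: "(B - kP * c / 2) * x\<^sup>2 \<le> (- 2 * r * M) * x\<^sup>2" by (intro mult_right_mono kB) auto
        have p7: "(C - kP * (\<epsilon> * \<phi> * c) / 2) * y\<^sup>2 \<le> (- 2 * r * M) * y\<^sup>2"
          by (intro mult_right_mono kC) auto
        have p8: "0 \<le> kP * (\<epsilon> * \<phi> * c) * y\<^sup>2" using kP \<epsilon> pos by simp
        have "2 * u * (- \<rho> * u + \<gamma> * x) +
          (1 * b * x * (L * (u + x)) - 1 * kP * c * x\<^sup>2 +
           \<epsilon> * (b * y * (L * (u + x)) + kP * b * x * y - \<phi> * kP * c * y\<^sup>2 + \<phi> * kP * b * x\<^sup>2))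
          = - 2 * \<rho> * u\<^sup>2 + (2 * \<gamma> + b * L) * u * x + (\<epsilon> * b * L) * u * y + (\<epsilon> * b * L) * (x * y)
            + kP * ((\<epsilon> * b) * x * y) + kP * ((\<epsilon> * \<phi> * b) * x\<^sup>2)
            + b * L * x\<^sup>2 - kP * c * x\<^sup>2 - kP * (\<epsilon> * \<phi> * c) * y\<^sup>2"
          by (simp add: algebra_simps power2_eq_square)
        also have "\<dots> \<le> - 2 * \<rho> * u\<^sup>2 + (\<delta> * u\<^sup>2 + (2 * \<gamma> + b * L)\<^sup>2 / (4 * \<delta>) * x\<^sup>2)
            + (\<delta> * u\<^sup>2 + (\<epsilon> * b * L)\<^sup>2 / (4 * \<delta>) * y\<^sup>2) + (\<epsilon> * b * L) * (x\<^sup>2 + y\<^sup>2)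
            + kP * (c / 4 * x\<^sup>2 + (\<epsilon> * \<phi> * c / 4) * y\<^sup>2) + kP * (c / 4 * x\<^sup>2)
            + b * L * x\<^sup>2 - kP * c * x\<^sup>2 - kP * (\<epsilon> * \<phi> * c) * y\<^sup>2"
          using p1 p2 p3 p4 p5 by linarith
        also have "\<dots> = (- 2 * \<rho> + 2 * \<delta>) * u\<^sup>2 + (B - kP * c / 2) * x\<^sup>2
            + (C - kP * (\<epsilon> * \<phi> * c) / 2) * y\<^sup>2 - kP * (\<epsilon> * \<phi> * c) * y\<^sup>2 / 4"
          by (simp add: B_def C_def algebra_simps)
        also have "\<dots> \<le> (- 2 * r) * u\<^sup>2 + (- 2 * r * M) * x\<^sup>2 + (- 2 * r * M) * y\<^sup>2"
        proof -
          have "(- 2 * \<rho> + 2 * \<delta>) * u\<^sup>2 = (- 2 * r) * u\<^sup>2" by (simp add: \<delta>_def)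
          then show ?thesis using p6 p7 p8 by linarith
        qed
        also have "\<dots> = - 2 * r * (u\<^sup>2 + (1 * b + 1 + \<epsilon> * b) * (x\<^sup>2 + y\<^sup>2))"
          by (simp add: M_def algebra_simps)
        finally show "2 * u * (- \<rho> * u + \<gamma> * x) +
          (1 * b * x * (L * (u + x)) - 1 * kP * c * x\<^sup>2 +
           \<epsilon> * (b * y * (L * (u + x)) + kP * b * x * y - \<phi> * kP * c * y\<^sup>2 + \<phi> * kP * b * x\<^sup>2))
          \<le> - 2 * r * (u\<^sup>2 + (1 * b + 1 + \<epsilon> * b) * (x\<^sup>2 + y\<^sup>2))" .
      qed (use \<epsilon> e3 pos in auto)
    qed
  qed
qed

text \<open>When \<open>kI\<close> is fixed, the dissipation \<open>\<epsilon> * kI * c * y\<^sup>2\<close> does not grow with \<open>kP\<close>, but the cross term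
  \<open>\<epsilon> * kP * b * x * y\<close> does. Taking \<open>\<epsilon> = s / kP\<close> bounds the cross term; in return the rate \<open>r\<close>
  shrinks like \<open>1 / kP\<close>.\<close>

lemma decay_certificate_fixed_gains:
  fixes b c L \<gamma> \<rho> \<kappa> kI :: real
  assumes pos: "0 < b" "0 < c" "0 < L" "0 < \<kappa>" "0 < kI" "0 < \<rho>"
  shows "\<exists>k0>0. \<forall>kP>k0. \<exists>r>0. \<exists>\<alpha> \<beta> \<epsilon>. decay_certificate b c L \<gamma> \<rho> kP kI \<kappa> \<alpha> \<beta> \<epsilon> r"
proof -
  \<comment> \<open>\<open>s * b * x * y\<close> is absorbed by a quarter of the dissipation in x and a quarter of that in y\<close>
  define s where "s = \<kappa> * kI * c\<^sup>2 / (4 * b\<^sup>2)"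
  have s: "0 < s" using pos by (simp add: s_def)
  define D where "D = b\<^sup>2 * L\<^sup>2 / (kI * c)"
  have D: "0 < D" using pos by (simp add: D_def)
  define B where "B = \<kappa> * b * L + (2 * \<gamma> + \<kappa> * b * L)\<^sup>2 / (2 * \<rho>) + s * (D + \<kappa> * b)"
  define k0 where "k0 = max 1 (max (B / (\<kappa> * c / 2)) (max (s * D / (\<rho> / 2)) (4 * s\<^sup>2 * b\<^sup>2 / (\<kappa> * kI * c))))"
  show ?thesis
  proof (rule exI[of _ k0], intro conjI allI impI)
    have "1 \<le> k0" unfolding k0_def by (rule max.cobounded1)
    then show "0 < k0" by linarith
  next
    fix kP assume k: "k0 < kP"
    have kP: "1 \<le> kP" "0 < kP" using k by (auto simp: k0_def)
    define \<epsilon> where "\<epsilon> = s / kP"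
    have \<epsilon>: "0 < \<epsilon>" "\<epsilon> \<le> s" "kP * \<epsilon> = s" using s kP by (auto simp: \<epsilon>_def field_simps)
    have kB: "B \<le> kP * (\<kappa> * c / 2)"
    proof -
      have "B / (\<kappa> * c / 2) \<le> kP" using k by (simp add: k0_def)
      moreover have "0 < \<kappa> * c / 2" using pos by simp
      ultimately show ?thesis by (simp only: pos_divide_le_eq)
    qed
    have eD: "\<epsilon> * D \<le> \<rho> / 2"
    proof -
      have "s * D / (\<rho> / 2) \<le> kP" using k by (simp add: k0_def)
      then show ?thesis using pos kP by (simp add: \<epsilon>_def field_simps)
    qed
    have e3: "4 * \<epsilon>\<^sup>2 * b\<^sup>2 \<le> \<kappa> * kI * c"
    proof -
      have p: "0 < \<kappa> * kI * c" using pos by simp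
      have "4 * s\<^sup>2 * b\<^sup>2 / (\<kappa> * kI * c) \<le> kP" using k by (simp add: k0_def)
      then have "4 * s\<^sup>2 * b\<^sup>2 \<le> kP * (\<kappa> * kI * c)" using p by (simp only: pos_divide_le_eq)
      also have "\<dots> \<le> kP * kP * (\<kappa> * kI * c)" using kP p by (intro mult_right_mono) auto
      finally show ?thesis using kP by (simp add: \<epsilon>_def field_simps power2_eq_square)
    qed
    define M where "M = \<kappa> * b + kI + \<epsilon> * b"
    have M: "0 < M" using pos \<epsilon> by (simp add: M_def add_pos_pos)
    define r where "r = min (\<rho> / 2) (min (\<kappa> * kP * c / 4 / (2 * M)) (\<epsilon> * kI * c / 4 / (2 * M)))"
    have r: "0 < r" "2 * r \<le> \<rho>" using pos kP M \<epsilon> by (auto simp: r_def)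
    have rx: "2 * r * M \<le> \<kappa> * kP * c / 4"
    proof -
      have "r \<le> \<kappa> * kP * c / 4 / (2 * M)" by (simp add: r_def)
      then show ?thesis using M by (simp add: field_simps)
    qed
    have ry: "2 * r * M \<le> \<epsilon> * kI * c / 4"
    proof -
      have "r \<le> \<epsilon> * kI * c / 4 / (2 * M)" by (simp add: r_def)
      then show ?thesis using M by (simp add: field_simps)
    qed
    show "\<exists>r>0. \<exists>\<alpha> \<beta> \<epsilon>. decay_certificate b c L \<gamma> \<rho> kP kI \<kappa> \<alpha> \<beta> \<epsilon> r"
    proof (intro exI conjI)
      show "decay_certificate b c L \<gamma> \<rho> kP kI \<kappa> \<kappa> kI \<epsilon> r"
        unfolding decay_certificate_def
      proof (intro conjI allI impI)
        fix u x y :: real assume u: "0 \<le> u" and x: "0 \<le> x" and y: "0 \<le> y"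
        have p1: "(2 * \<gamma> + \<kappa> * b * L) * u * x \<le> \<rho> / 2 * u\<^sup>2 + (2 * \<gamma> + \<kappa> * b * L)\<^sup>2 / (4 * (\<rho> / 2)) * x\<^sup>2"
          using pos by (intro weighted_young) auto
        have y1: "b * L * y * z \<le> kI * c / 4 * y\<^sup>2 + D * z\<^sup>2" for z
        proof -
          have "b * L * y * z \<le> kI * c / 4 * y\<^sup>2 + (b * L)\<^sup>2 / (4 * (kI * c / 4)) * z\<^sup>2"
            using pos by (intro weighted_young) auto
          also have "(b * L)\<^sup>2 / (4 * (kI * c / 4)) = D" by (simp add: D_def power_mult_distrib)
          finally show ?thesis .
        qed
        have p2: "\<epsilon> * (b * L * y * u) \<le> \<epsilon> * (kI * c / 4 * y\<^sup>2 + D * u\<^sup>2)"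
          using \<epsilon> by (intro mult_left_mono y1) auto
        have p3: "\<epsilon> * (b * L * y * x) \<le> \<epsilon> * (kI * c / 4 * y\<^sup>2 + D * x\<^sup>2)"
          using \<epsilon> by (intro mult_left_mono y1) auto
        have p4: "\<epsilon> * (kP * b * x * y) \<le> \<kappa> * kP * c / 4 * x\<^sup>2 + \<epsilon> * (kI * c / 4) * y\<^sup>2"
        proof -
          have "\<epsilon> * (kP * b * x * y) = (s * b) * x * y" using \<epsilon>(3) by (simp add: mult_ac flip: \<epsilon>(3))
          also have "\<dots> \<le> \<kappa> * kP * c / 4 * x\<^sup>2 + (s * b)\<^sup>2 / (4 * (\<kappa> * kP * c / 4)) * y\<^sup>2"
            using pos kP by (intro weighted_young) auto
          also have "(s * b)\<^sup>2 / (4 * (\<kappa> * kP * c / 4)) = \<epsilon> * (s * b\<^sup>2 / (\<kappa> * c))"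
            using kP by (simp add: \<epsilon>_def power2_eq_square mult_ac)
          also have "s * b\<^sup>2 / (\<kappa> * c) = kI * c / 4"
            using pos by (simp add: s_def power2_eq_square)
          finally show ?thesis .
        qed
        have p5: "\<epsilon> * (D + \<kappa> * b) * x\<^sup>2 \<le> s * (D + \<kappa> * b) * x\<^sup>2"
          using \<epsilon> D pos by (intro mult_right_mono) auto
        have p6: "(B - kP * (\<kappa> * c / 2)) * x\<^sup>2 \<le> 0"
          using kB by (intro mult_nonpos_nonneg) auto
        have p7: "\<epsilon> * D * u\<^sup>2 \<le> \<rho> / 2 * u\<^sup>2" by (intro mult_right_mono eD) auto
        have q1: "2 * r * u\<^sup>2 \<le> \<rho> * u\<^sup>2" by (intro mult_right_mono r) auto
        have q2: "2 * r * M * x\<^sup>2 \<le> \<kappa> * kP * c / 4 * x\<^sup>2" by (intro mult_right_mono rx) auto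
        have q3: "2 * r * M * y\<^sup>2 \<le> \<epsilon> * kI * c / 4 * y\<^sup>2" by (intro mult_right_mono ry) auto
        have "2 * u * (- \<rho> * u + \<gamma> * x) +
          (\<kappa> * b * x * (L * (u + x)) - \<kappa> * kP * c * x\<^sup>2 +
           \<epsilon> * (b * y * (L * (u + x)) + kP * b * x * y - kI * c * y\<^sup>2 + \<kappa> * b * x\<^sup>2))
          = - 2 * \<rho> * u\<^sup>2 + (2 * \<gamma> + \<kappa> * b * L) * u * x + \<epsilon> * (b * L * y * u) + \<epsilon> * (b * L * y * x)
            + \<epsilon> * (kP * b * x * y) + \<epsilon> * (\<kappa> * b) * x\<^sup>2 + \<kappa> * b * L * x\<^sup>2 - \<kappa> * kP * c * x\<^sup>2
            - \<epsilon> * kI * c * y\<^sup>2"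
          by (simp add: algebra_simps power2_eq_square)
        also have "\<dots> \<le> - 2 * \<rho> * u\<^sup>2 + (\<rho> / 2 * u\<^sup>2 + (2 * \<gamma> + \<kappa> * b * L)\<^sup>2 / (4 * (\<rho> / 2)) * x\<^sup>2)
            + \<epsilon> * (kI * c / 4 * y\<^sup>2 + D * u\<^sup>2) + \<epsilon> * (kI * c / 4 * y\<^sup>2 + D * x\<^sup>2)
            + (\<kappa> * kP * c / 4 * x\<^sup>2 + \<epsilon> * (kI * c / 4) * y\<^sup>2) + \<epsilon> * (\<kappa> * b) * x\<^sup>2
            + \<kappa> * b * L * x\<^sup>2 - \<kappa> * kP * c * x\<^sup>2 - \<epsilon> * kI * c * y\<^sup>2"
          using p1 p2 p3 p4 by linarith
        also have "\<dots> = (- 2 * \<rho> + \<rho> / 2) * u\<^sup>2 + \<epsilon> * D * u\<^sup>2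
            + (B - kP * (\<kappa> * c / 2)) * x\<^sup>2 + (\<epsilon> * (D + \<kappa> * b) * x\<^sup>2 - s * (D + \<kappa> * b) * x\<^sup>2)
            - \<kappa> * kP * c / 4 * x\<^sup>2 - \<epsilon> * kI * c / 4 * y\<^sup>2"
          by (simp add: B_def algebra_simps)
        also have "\<dots> \<le> - \<rho> * u\<^sup>2 - \<kappa> * kP * c / 4 * x\<^sup>2 - \<epsilon> * kI * c / 4 * y\<^sup>2"
        proof -
          have "(- 2 * \<rho> + \<rho> / 2) * u\<^sup>2 = - \<rho> * u\<^sup>2 - \<rho> / 2 * u\<^sup>2" by (simp add: algebra_simps)
          then show ?thesis using p5 p6 p7 by linarith
        qed
        also have "\<dots> \<le> - 2 * r * u\<^sup>2 - 2 * r * M * x\<^sup>2 - 2 * r * M * y\<^sup>2"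
          using q1 q2 q3 by linarith
        also have "\<dots> = - 2 * r * (u\<^sup>2 + (\<kappa> * b + kI + \<epsilon> * b) * (x\<^sup>2 + y\<^sup>2))"
          by (simp add: M_def algebra_simps)
        finally show "2 * u * (- \<rho> * u + \<gamma> * x) +
          (\<kappa> * b * x * (L * (u + x)) - \<kappa> * kP * c * x\<^sup>2 +
           \<epsilon> * (b * y * (L * (u + x)) + kP * b * x * y - kI * c * y\<^sup>2 + \<kappa> * b * x\<^sup>2))
          \<le> - 2 * r * (u\<^sup>2 + (\<kappa> * b + kI + \<epsilon> * b) * (x\<^sup>2 + y\<^sup>2))" .
      qed (use \<epsilon> e3 pos r in auto)
    qed (rule r)
  qed
qed

section \<open>The Lyapunov function of the interconnection\<close>

text \<open>The fast subsystem is \<open>w' = p - kP * S w - kI * T \<xi>\<close>, \<open>\<xi>' = \<kappa> * F w\<close>. The symmetric weight \<open>Y\<close> has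
  \<open>Y * T = F\<^sup>T\<close>, so that the exchange of energy between \<open>w\<close> and \<open>\<xi>\<close> balances. One upper bound \<open>b\<close> and
  one lower bound \<open>c\<close> for all matrices keep the scalar inequalities short.\<close>

definition lyapunov_matrices ::
  "nat \<Rightarrow> real mat \<Rightarrow> real mat \<Rightarrow> real mat \<Rightarrow> real mat \<Rightarrow> real \<Rightarrow> real \<Rightarrow> bool" where
  "lyapunov_matrices m S T F Y b c \<longleftrightarrow>
     S \<in> carrier_mat m m \<and> T \<in> carrier_mat m m \<and> F \<in> carrier_mat m m \<and> Y \<in> carrier_mat m m \<and>
     Y\<^sup>T = Y \<and> Y * T = F\<^sup>T \<and> 0 < b \<and> 0 < c \<and>
     (\<forall>v\<in>carrier_vec m. c * (enorm v)\<^sup>2 \<le> v \<bullet> (Y *\<^sub>v v) \<and> c * (enorm v)\<^sup>2 \<le> v \<bullet> (Y * S *\<^sub>v v) \<and>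
        c * (enorm v)\<^sup>2 \<le> (enorm (T *\<^sub>v v))\<^sup>2 \<and>
        enorm (Y *\<^sub>v v) \<le> b * enorm v \<and> enorm (T *\<^sub>v v) \<le> b * enorm v \<and>
        enorm (T\<^sup>T *\<^sub>v (S *\<^sub>v v)) \<le> b * enorm v \<and> enorm (T *\<^sub>v (F *\<^sub>v v)) \<le> b * enorm v)"

text \<open>In the derivative of the first part, \<open>- \<alpha> * kI * (w \<bullet> (Y *\<^sub>v (T *\<^sub>v \<xi>)))\<close> and
  \<open>\<beta> * \<kappa> * (\<xi> \<bullet> (F *\<^sub>v w))\<close> cancel, because \<open>Y * T = F\<^sup>T\<close> and \<open>\<alpha> * kI = \<beta> * \<kappa>\<close>; what remains is the
  dissipation in \<open>w\<close> due to \<open>Y * S\<close>. There is none in \<open>\<xi>\<close>: it comes from the mixed term with weight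
  \<open>\<epsilon>\<close>, whose derivative contains \<open>- \<epsilon> * kI * (enorm (T *\<^sub>v \<xi>))\<^sup>2\<close> besides cross terms.\<close>

lemma fast_subsystem_lyapunov_derivative:
  assumes Mx: "lyapunov_matrices m S T F Y b c"
    and w: "has_derivative_traj m w (\<lambda>t. p t - kP \<cdot>\<^sub>v (S *\<^sub>v w t) - kI \<cdot>\<^sub>v (T *\<^sub>v \<xi> t))"
    and \<xi>: "has_derivative_traj m \<xi> (\<lambda>t. \<kappa> \<cdot>\<^sub>v (F *\<^sub>v w t))"
    and p: "p t \<in> carrier_vec m"
    and pos: "0 \<le> \<alpha>" "0 \<le> \<beta>" "0 \<le> \<epsilon>" "0 \<le> kP" "0 \<le> kI" "0 \<le> \<kappa>" and balance: "\<alpha> * kI = \<beta> * \<kappa>"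
    and t: "0 \<le> t"
  shows "\<exists>V'. ((\<lambda>s. (\<alpha> * (w s \<bullet> (Y *\<^sub>v w s)) + \<beta> * (\<xi> s \<bullet> \<xi> s)) / 2 + \<epsilon> * (w s \<bullet> (T *\<^sub>v \<xi> s)))
      has_real_derivative V') (at t within {0..}) \<and>
    V' \<le> \<alpha> * b * enorm (w t) * enorm (p t) - \<alpha> * kP * c * (enorm (w t))\<^sup>2 +
      \<epsilon> * (b * enorm (\<xi> t) * enorm (p t) + kP * b * enorm (w t) * enorm (\<xi> t)
           - kI * c * (enorm (\<xi> t))\<^sup>2 + \<kappa> * b * (enorm (w t))\<^sup>2)"
proof -
  note Mx = Mx[unfolded lyapunov_matrices_def]
  have S: "S \<in> carrier_mat m m" and T: "T \<in> carrier_mat m m" and F: "F \<in> carrier_mat m m"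
    and Y: "Y \<in> carrier_mat m m" and YT: "Y\<^sup>T = Y" and YTF: "Y * T = F\<^sup>T"
    using Mx by blast+
  have wt: "w t \<in> carrier_vec m" and xt: "\<xi> t \<in> carrier_vec m"
    using w \<xi> t by (auto simp: has_derivative_traj_def)
  define w' where "w' = p t - kP \<cdot>\<^sub>v (S *\<^sub>v w t) - kI \<cdot>\<^sub>v (T *\<^sub>v \<xi> t)"
  have w': "w' \<in> carrier_vec m" unfolding w'_def using p S T wt xt by auto
  have Sw: "S *\<^sub>v w t \<in> carrier_vec m" and Tx: "T *\<^sub>v \<xi> t \<in> carrier_vec m"
    and Fw: "F *\<^sub>v w t \<in> carrier_vec m" and Yw: "Y *\<^sub>v w t \<in> carrier_vec m"
    using S T F Y wt xt by auto
  let ?V = "\<lambda>s. (\<alpha> * (w s \<bullet> (Y *\<^sub>v w s)) + \<beta> * (\<xi> s \<bullet> \<xi> s)) / 2 + \<epsilon> * (w s \<bullet> (T *\<^sub>v \<xi> s))"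
  define V' where "V' = (\<alpha> * (w' \<bullet> (Y *\<^sub>v w t) + w t \<bullet> (Y *\<^sub>v w')) +
      \<beta> * ((\<kappa> \<cdot>\<^sub>v (F *\<^sub>v w t)) \<bullet> \<xi> t + \<xi> t \<bullet> (\<kappa> \<cdot>\<^sub>v (F *\<^sub>v w t)))) / 2 +
      \<epsilon> * (w' \<bullet> (T *\<^sub>v \<xi> t) + w t \<bullet> (T *\<^sub>v (\<kappa> \<cdot>\<^sub>v (F *\<^sub>v w t))))"
  have d: "(?V has_real_derivative V') (at t within {0..})"
    unfolding V'_def w'_def
    by (intro DERIV_add DERIV_cmult DERIV_cdivide
        has_real_derivative_scalar_prod[OF w has_derivative_traj_mult_mat[OF w Y] t]
        has_real_derivative_scalar_prod[OF w has_derivative_traj_mult_mat[OF \<xi> T] t]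
        has_real_derivative_scalar_prod[OF \<xi> \<xi> t])
  have sym: "w t \<bullet> (Y *\<^sub>v w') = w' \<bullet> (Y *\<^sub>v w t)"
    using transpose_vec_mult_scalar[OF Y w' wt] Y wt w' YT by (simp add: comm_scalar_prod[of _ m])
  have symS: "(S *\<^sub>v w t) \<bullet> (Y *\<^sub>v w t) = w t \<bullet> (Y * S *\<^sub>v w t)"
    using transpose_vec_mult_scalar[OF Y Sw wt] Y S wt YT Yw Sw
    by (simp add: comm_scalar_prod[of _ m])
  have symT: "(T *\<^sub>v \<xi> t) \<bullet> (Y *\<^sub>v w t) = \<xi> t \<bullet> (F *\<^sub>v w t)"
  proof -
    have "(T *\<^sub>v \<xi> t) \<bullet> (Y *\<^sub>v w t) = (Y\<^sup>T *\<^sub>v (T *\<^sub>v \<xi> t)) \<bullet> w t"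
      using transpose_vec_mult_scalar[OF Y wt Tx] by simp
    also have "Y\<^sup>T *\<^sub>v (T *\<^sub>v \<xi> t) = F\<^sup>T *\<^sub>v \<xi> t"
      unfolding YT YTF[symmetric] using Y T xt by simp
    also have "(F\<^sup>T *\<^sub>v \<xi> t) \<bullet> w t = \<xi> t \<bullet> (F *\<^sub>v w t)"
      by (rule transpose_vec_mult_scalar[OF F wt xt])
    finally show ?thesis .
  qed
  have ip: "w' \<bullet> a = p t \<bullet> a - kP * ((S *\<^sub>v w t) \<bullet> a) - kI * ((T *\<^sub>v \<xi> t) \<bullet> a)"
    if a: "a \<in> carrier_vec m" for a
    unfolding w'_def using p Sw Tx a
    by (simp add: minus_scalar_prod_distrib[of _ m])
  have TF: "T *\<^sub>v (\<kappa> \<cdot>\<^sub>v (F *\<^sub>v w t)) = \<kappa> \<cdot>\<^sub>v (T *\<^sub>v (F *\<^sub>v w t))"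
    by (rule mult_mat_vec[OF T Fw])
  have TFw: "T *\<^sub>v (F *\<^sub>v w t) \<in> carrier_vec m" using T Fw by auto
  have V'_eq: "V' = \<alpha> * (p t \<bullet> (Y *\<^sub>v w t)) - \<alpha> * kP * (w t \<bullet> (Y * S *\<^sub>v w t))
      + \<epsilon> * (p t \<bullet> (T *\<^sub>v \<xi> t) - kP * ((S *\<^sub>v w t) \<bullet> (T *\<^sub>v \<xi> t))
        - kI * ((T *\<^sub>v \<xi> t) \<bullet> (T *\<^sub>v \<xi> t)) + \<kappa> * (w t \<bullet> (T *\<^sub>v (F *\<^sub>v w t))))"
  proof -
    have xF: "(\<kappa> \<cdot>\<^sub>v (F *\<^sub>v w t)) \<bullet> \<xi> t = \<kappa> * (\<xi> t \<bullet> (F *\<^sub>v w t))"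
      "\<xi> t \<bullet> (\<kappa> \<cdot>\<^sub>v (F *\<^sub>v w t)) = \<kappa> * (\<xi> t \<bullet> (F *\<^sub>v w t))"
      "w t \<bullet> (\<kappa> \<cdot>\<^sub>v (T *\<^sub>v (F *\<^sub>v w t))) = \<kappa> * (w t \<bullet> (T *\<^sub>v (F *\<^sub>v w t)))"
      using Fw xt wt TFw by (simp_all add: comm_scalar_prod[of _ m])
    have "V' = \<alpha> * (w' \<bullet> (Y *\<^sub>v w t)) + \<beta> * \<kappa> * (\<xi> t \<bullet> (F *\<^sub>v w t))
        + \<epsilon> * (w' \<bullet> (T *\<^sub>v \<xi> t) + \<kappa> * (w t \<bullet> (T *\<^sub>v (F *\<^sub>v w t))))"
      unfolding V'_def sym TF xF by (simp add: algebra_simps)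
    also have "\<dots> = \<alpha> * (p t \<bullet> (Y *\<^sub>v w t)) - \<alpha> * kP * (w t \<bullet> (Y * S *\<^sub>v w t))
        - \<alpha> * kI * (\<xi> t \<bullet> (F *\<^sub>v w t)) + \<beta> * \<kappa> * (\<xi> t \<bullet> (F *\<^sub>v w t))
        + \<epsilon> * (p t \<bullet> (T *\<^sub>v \<xi> t) - kP * ((S *\<^sub>v w t) \<bullet> (T *\<^sub>v \<xi> t))
        - kI * ((T *\<^sub>v \<xi> t) \<bullet> (T *\<^sub>v \<xi> t)) + \<kappa> * (w t \<bullet> (T *\<^sub>v (F *\<^sub>v w t))))"
      unfolding ip[OF Yw] ip[OF Tx] symS symT by (simp add: algebra_simps)
    finally show ?thesis using balance by simp
  qed
  have b: "0 < b" using Mx by blast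
  have i1: "p t \<bullet> (Y *\<^sub>v w t) \<le> b * enorm (w t) * enorm (p t)"
  proof -
    have "p t \<bullet> (Y *\<^sub>v w t) \<le> enorm (p t) * enorm (Y *\<^sub>v w t)"
      using scalar_prod_le_enorm[OF p Yw] by simp
    also have "\<dots> \<le> enorm (p t) * (b * enorm (w t))" using Mx wt by (intro mult_left_mono) auto
    finally show ?thesis by (simp add: mult_ac)
  qed
  have i2: "p t \<bullet> (T *\<^sub>v \<xi> t) \<le> b * enorm (\<xi> t) * enorm (p t)"
  proof -
    have "p t \<bullet> (T *\<^sub>v \<xi> t) \<le> enorm (p t) * enorm (T *\<^sub>v \<xi> t)"
      using scalar_prod_le_enorm[OF p Tx] by simp
    also have "\<dots> \<le> enorm (p t) * (b * enorm (\<xi> t))" using Mx xt by (intro mult_left_mono) auto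
    finally show ?thesis by (simp add: mult_ac)
  qed
  have i3: "- ((S *\<^sub>v w t) \<bullet> (T *\<^sub>v \<xi> t)) \<le> b * enorm (w t) * enorm (\<xi> t)"
  proof -
    have TSw: "T\<^sup>T *\<^sub>v (S *\<^sub>v w t) \<in> carrier_vec m" using T Sw by auto
    have "(S *\<^sub>v w t) \<bullet> (T *\<^sub>v \<xi> t) = (T\<^sup>T *\<^sub>v (S *\<^sub>v w t)) \<bullet> \<xi> t"
      using transpose_vec_mult_scalar[OF T xt Sw] by simp
    then have "- ((S *\<^sub>v w t) \<bullet> (T *\<^sub>v \<xi> t)) \<le> enorm (T\<^sup>T *\<^sub>v (S *\<^sub>v w t)) * enorm (\<xi> t)"
      using scalar_prod_le_enorm[OF TSw xt] by simp
    also have "\<dots> \<le> (b * enorm (w t)) * enorm (\<xi> t)" using Mx wt by (intro mult_right_mono) auto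
    finally show ?thesis .
  qed
  have i4: "w t \<bullet> (T *\<^sub>v (F *\<^sub>v w t)) \<le> b * (enorm (w t))\<^sup>2"
  proof -
    have "w t \<bullet> (T *\<^sub>v (F *\<^sub>v w t)) \<le> enorm (w t) * enorm (T *\<^sub>v (F *\<^sub>v w t))"
      using scalar_prod_le_enorm[OF wt TFw] by simp
    also have "\<dots> \<le> enorm (w t) * (b * enorm (w t))" using Mx wt by (intro mult_left_mono) auto
    finally show ?thesis by (simp add: power2_eq_square mult_ac)
  qed
  have i5: "c * (enorm (w t))\<^sup>2 \<le> w t \<bullet> (Y * S *\<^sub>v w t)" using Mx wt by blast
  have i6: "c * (enorm (\<xi> t))\<^sup>2 \<le> (T *\<^sub>v \<xi> t) \<bullet> (T *\<^sub>v \<xi> t)"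
    using Mx xt unfolding enorm_square[symmetric] by blast
  have j1: "\<alpha> * (p t \<bullet> (Y *\<^sub>v w t)) \<le> \<alpha> * (b * enorm (w t) * enorm (p t))"
    by (intro mult_left_mono i1 pos)
  have j2: "(\<alpha> * kP) * (c * (enorm (w t))\<^sup>2) \<le> (\<alpha> * kP) * (w t \<bullet> (Y * S *\<^sub>v w t))"
    by (intro mult_left_mono i5 mult_nonneg_nonneg pos)
  have j3: "kP * (- ((S *\<^sub>v w t) \<bullet> (T *\<^sub>v \<xi> t))) \<le> kP * (b * enorm (w t) * enorm (\<xi> t))"
    by (intro mult_left_mono i3 pos)
  have j4: "kI * (c * (enorm (\<xi> t))\<^sup>2) \<le> kI * ((T *\<^sub>v \<xi> t) \<bullet> (T *\<^sub>v \<xi> t))"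
    by (intro mult_left_mono i6 pos)
  have j5: "\<kappa> * (w t \<bullet> (T *\<^sub>v (F *\<^sub>v w t))) \<le> \<kappa> * (b * (enorm (w t))\<^sup>2)"
    by (intro mult_left_mono i4 pos)
  have j6: "\<epsilon> * (p t \<bullet> (T *\<^sub>v \<xi> t) - kP * ((S *\<^sub>v w t) \<bullet> (T *\<^sub>v \<xi> t))
        - kI * ((T *\<^sub>v \<xi> t) \<bullet> (T *\<^sub>v \<xi> t)) + \<kappa> * (w t \<bullet> (T *\<^sub>v (F *\<^sub>v w t))))
    \<le> \<epsilon> * (b * enorm (\<xi> t) * enorm (p t) + kP * b * enorm (w t) * enorm (\<xi> t)
           - kI * c * (enorm (\<xi> t))\<^sup>2 + \<kappa> * b * (enorm (w t))\<^sup>2)"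
    by (rule mult_left_mono[OF _ pos(3)]) (use i2 j3 j4 j5 in \<open>simp add: mult.assoc\<close>)
  have "V' \<le> \<alpha> * b * enorm (w t) * enorm (p t) - \<alpha> * kP * c * (enorm (w t))\<^sup>2 +
      \<epsilon> * (b * enorm (\<xi> t) * enorm (p t) + kP * b * enorm (w t) * enorm (\<xi> t)
           - kI * c * (enorm (\<xi> t))\<^sup>2 + \<kappa> * b * (enorm (w t))\<^sup>2)"
    unfolding V'_eq using j1 j2 j6 by (simp add: mult.assoc)
  with d show ?thesis by blast
qed

text \<open>The bound on \<open>\<epsilon>\<close> makes the mixed term at most half of the lower bound of the diagonal part.\<close>

lemma fast_lyapunov_bounds:
  assumes Mx: "lyapunov_matrices m S T F Y b c"
    and cert: "decay_certificate b c L \<gamma> \<rho> kP kI \<kappa> \<alpha> \<beta> \<epsilon> r"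
    and w: "w \<in> carrier_vec m" and \<xi>: "\<xi> \<in> carrier_vec m"
  shows "(\<alpha> * c * (enorm w)\<^sup>2 + \<beta> * (enorm \<xi>)\<^sup>2) / 4
      \<le> (\<alpha> * (w \<bullet> (Y *\<^sub>v w)) + \<beta> * (\<xi> \<bullet> \<xi>)) / 2 + \<epsilon> * (w \<bullet> (T *\<^sub>v \<xi>))"
    and "(\<alpha> * (w \<bullet> (Y *\<^sub>v w)) + \<beta> * (\<xi> \<bullet> \<xi>)) / 2 + \<epsilon> * (w \<bullet> (T *\<^sub>v \<xi>))
      \<le> (\<alpha> * b + \<beta> + \<epsilon> * b) * ((enorm w)\<^sup>2 + (enorm \<xi>)\<^sup>2)"
proof -
  note Mx = Mx[unfolded lyapunov_matrices_def]
  have pos: "0 < \<alpha>" "0 < \<beta>" "0 \<le> \<epsilon>" and e: "4 * \<epsilon>\<^sup>2 * b\<^sup>2 \<le> \<alpha> * \<beta> * c"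
    using cert unfolding decay_certificate_def by blast+
  have T: "T \<in> carrier_mat m m" and Y: "Y \<in> carrier_mat m m" and bc: "0 < b" "0 < c"
    using Mx by blast+
  let ?x = "enorm w" and ?y = "enorm \<xi>"
  have Tx: "T *\<^sub>v \<xi> \<in> carrier_vec m" and Yw: "Y *\<^sub>v w \<in> carrier_vec m" using T Y w \<xi> by auto
  have cross: "\<bar>w \<bullet> (T *\<^sub>v \<xi>)\<bar> \<le> b * ?x * ?y"
  proof -
    have "\<bar>w \<bullet> (T *\<^sub>v \<xi>)\<bar> \<le> ?x * enorm (T *\<^sub>v \<xi>)" by (rule scalar_prod_le_enorm[OF w Tx])
    also have "\<dots> \<le> ?x * (b * ?y)" using Mx \<xi> by (intro mult_left_mono) auto
    finally show ?thesis by (simp add: mult_ac)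
  qed
  have upper: "w \<bullet> (Y *\<^sub>v w) \<le> b * ?x\<^sup>2"
  proof -
    have "w \<bullet> (Y *\<^sub>v w) \<le> ?x * enorm (Y *\<^sub>v w)" using scalar_prod_le_enorm[OF w Yw] by simp
    also have "\<dots> \<le> ?x * (b * ?x)" using Mx w by (intro mult_left_mono) auto
    finally show ?thesis by (simp add: power2_eq_square mult_ac)
  qed
  have lower: "c * ?x\<^sup>2 \<le> w \<bullet> (Y *\<^sub>v w)" using Mx w by blast
  have xi: "\<xi> \<bullet> \<xi> = ?y\<^sup>2" by (simp add: enorm_square)
  have ec: "\<epsilon> * \<bar>w \<bullet> (T *\<^sub>v \<xi>)\<bar> \<le> \<epsilon> * (b * ?x * ?y)" by (intro mult_left_mono cross pos)
  have "\<epsilon> * (b * ?x * ?y) \<le> (\<alpha> * c * ?x\<^sup>2 + \<beta> * ?y\<^sup>2) / 4"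
  proof (rule power2_le_imp_le)
    have "16 * (\<epsilon> * (b * ?x * ?y))\<^sup>2 = 4 * (4 * \<epsilon>\<^sup>2 * b\<^sup>2) * (?x\<^sup>2 * ?y\<^sup>2)"
      by (simp add: power_mult_distrib)
    also have "\<dots> \<le> 4 * (\<alpha> * \<beta> * c) * (?x\<^sup>2 * ?y\<^sup>2)"
      by (intro mult_right_mono mult_left_mono e) auto
    also have "\<dots> \<le> (\<alpha> * c * ?x\<^sup>2 + \<beta> * ?y\<^sup>2)\<^sup>2"
    proof -
      have "0 \<le> (\<alpha> * c * ?x\<^sup>2 - \<beta> * ?y\<^sup>2)\<^sup>2" by simp
      then show ?thesis by (simp add: power2_eq_square algebra_simps)
    qed
    finally show "(\<epsilon> * (b * ?x * ?y))\<^sup>2 \<le> ((\<alpha> * c * ?x\<^sup>2 + \<beta> * ?y\<^sup>2) / 4)\<^sup>2"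
      by (simp add: power_divide)
    show "0 \<le> (\<alpha> * c * ?x\<^sup>2 + \<beta> * ?y\<^sup>2) / 4" using pos bc by simp
  qed
  moreover have "\<alpha> * (c * ?x\<^sup>2) \<le> \<alpha> * (w \<bullet> (Y *\<^sub>v w))" using lower pos by (intro mult_left_mono) auto
  moreover have "- (\<epsilon> * \<bar>w \<bullet> (T *\<^sub>v \<xi>)\<bar>) \<le> \<epsilon> * (w \<bullet> (T *\<^sub>v \<xi>))"
    using mult_left_mono[of "- \<bar>w \<bullet> (T *\<^sub>v \<xi>)\<bar>" "w \<bullet> (T *\<^sub>v \<xi>)" \<epsilon>] pos by simp
  ultimately show "(\<alpha> * c * ?x\<^sup>2 + \<beta> * ?y\<^sup>2) / 4
      \<le> (\<alpha> * (w \<bullet> (Y *\<^sub>v w)) + \<beta> * (\<xi> \<bullet> \<xi>)) / 2 + \<epsilon> * (w \<bullet> (T *\<^sub>v \<xi>))"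
    unfolding xi using ec by (simp add: mult.assoc field_simps)
  have aux: "(A + B) / 2 + E \<le> R"
    if "E \<le> E1" "E2 \<le> E3" "A \<le> A'" "0 \<le> A'" "0 \<le> P" "0 \<le> Q" "0 \<le> B"
      "R = A' + B + E3 + (P + Q)" "E1 \<le> E2" for A A' B E E1 E2 E3 P Q R :: real
    using that by (simp add: field_simps)
  have "\<epsilon> * (w \<bullet> (T *\<^sub>v \<xi>)) \<le> \<epsilon> * \<bar>w \<bullet> (T *\<^sub>v \<xi>)\<bar>" using pos by (intro mult_left_mono) auto
  moreover have "\<epsilon> * (b * ?x * ?y) \<le> \<epsilon> * b * (?x\<^sup>2 + ?y\<^sup>2)"
    using mult_left_mono[OF mult_le_sum_squares[of ?x ?y], of "\<epsilon> * b"] pos bc by (simp add: mult_ac)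
  moreover have "\<alpha> * (w \<bullet> (Y *\<^sub>v w)) \<le> \<alpha> * (b * ?x\<^sup>2)" using upper pos by (intro mult_left_mono) auto
  moreover have "0 \<le> \<alpha> * (b * ?x\<^sup>2)" "0 \<le> \<alpha> * b * ?y\<^sup>2" "0 \<le> \<beta> * ?x\<^sup>2" "0 \<le> \<beta> * ?y\<^sup>2"
    using pos bc by auto
  moreover have "(\<alpha> * b + \<beta> + \<epsilon> * b) * (?x\<^sup>2 + ?y\<^sup>2) = \<alpha> * (b * ?x\<^sup>2) + \<beta> * ?y\<^sup>2
      + \<epsilon> * b * (?x\<^sup>2 + ?y\<^sup>2) + (\<alpha> * b * ?y\<^sup>2 + \<beta> * ?x\<^sup>2)"
    by (simp add: algebra_simps)
  ultimately show "(\<alpha> * (w \<bullet> (Y *\<^sub>v w)) + \<beta> * (\<xi> \<bullet> \<xi>)) / 2 + \<epsilon> * (w \<bullet> (T *\<^sub>v \<xi>))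
      \<le> (\<alpha> * b + \<beta> + \<epsilon> * b) * (?x\<^sup>2 + ?y\<^sup>2)"
    unfolding xi using ec by (rule aux)
qed

text \<open>At each time the majorant of \<open>U e\<close> given by the perturbed blended dynamics, squared and added to
  \<open>V\<close>, touches \<open>U\<^sup>2 + V\<close> from above, and the certificate bounds its derivative by
  \<open>- 2 * r * (U\<^sup>2 + V)\<close>. Squares are summed so that all cross terms are quadratic in the norms.\<close>

lemma interconnection_decay:
  fixes f :: "'a::banach \<Rightarrow> 'a" and e :: "real \<Rightarrow> 'a"
  assumes U_lower: "\<And>a. norm a \<le> U a" and U_upper: "\<And>a. U a \<le> C * norm a"
    and U_lip: "\<And>a b. U a \<le> U b + K * norm (a - b)" and K: "0 \<le> K"
    and U_decay: "\<And>a. \<exists>y. y 0 = a \<and> (\<forall>t\<ge>0. (y has_vector_derivative f (y t)) (at t within {0..})) \<and>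
       (\<forall>t\<ge>0. U (y t) \<le> exp (- \<rho> * t) * U a)"
    and Mx: "lyapunov_matrices m S T F Y b c"
    and cert: "decay_certificate b c L (K * \<gamma>) \<rho> kP kI \<kappa> \<alpha> \<beta> \<epsilon> r"
    and gains: "0 \<le> kP" "0 \<le> kI" "0 \<le> \<kappa>" "0 \<le> L"
    and e: "\<And>t. 0 \<le> t \<Longrightarrow> (e has_vector_derivative f (e t) + g t) (at t within {0..})"
    and g: "\<And>t. 0 \<le> t \<Longrightarrow> norm (g t) \<le> \<gamma> * enorm (w t)"
    and w: "has_derivative_traj m w (\<lambda>t. p t - kP \<cdot>\<^sub>v (S *\<^sub>v w t) - kI \<cdot>\<^sub>v (T *\<^sub>v \<xi> t))"
    and \<xi>: "has_derivative_traj m \<xi> (\<lambda>t. \<kappa> \<cdot>\<^sub>v (F *\<^sub>v w t))"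
    and p: "\<And>t. 0 \<le> t \<Longrightarrow> p t \<in> carrier_vec m"
      "\<And>t. 0 \<le> t \<Longrightarrow> enorm (p t) \<le> L * (norm (e t) + enorm (w t))"
    and t: "0 \<le> t"
  shows "(norm (e t))\<^sup>2 + (\<alpha> * c * (enorm (w t))\<^sup>2 + \<beta> * (enorm (\<xi> t))\<^sup>2) / 4
    \<le> exp (- 2 * r * t) * (C\<^sup>2 * (norm (e 0))\<^sup>2 + (\<alpha> * b + \<beta> + \<epsilon> * b) * ((enorm (w 0))\<^sup>2 + (enorm (\<xi> 0))\<^sup>2))"
proof -
  define V where "V = (\<lambda>s. (\<alpha> * (w s \<bullet> (Y *\<^sub>v w s)) + \<beta> * (\<xi> s \<bullet> \<xi> s)) / 2 + \<epsilon> * (w s \<bullet> (T *\<^sub>v \<xi> s)))"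
  have wc: "w s \<in> carrier_vec m" and xc: "\<xi> s \<in> carrier_vec m" if "0 \<le> s" for s
    using w \<xi> that by (auto simp: has_derivative_traj_def)
  have pos: "0 < \<alpha>" "0 < \<beta>" "0 \<le> \<epsilon>" "0 \<le> r" and balance: "\<alpha> * kI = \<beta> * \<kappa>"
    using cert unfolding decay_certificate_def by blast+
  have bc: "0 < b" "0 < c" using Mx unfolding lyapunov_matrices_def by blast+
  have V_lower: "(\<alpha> * c * (enorm (w s))\<^sup>2 + \<beta> * (enorm (\<xi> s))\<^sup>2) / 4 \<le> V s"
    and V_upper: "V s \<le> (\<alpha> * b + \<beta> + \<epsilon> * b) * ((enorm (w s))\<^sup>2 + (enorm (\<xi> s))\<^sup>2)"
    if "0 \<le> s" for s
    unfolding V_def by (rule fast_lyapunov_bounds[OF Mx cert wc[OF that] xc[OF that]])+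
  have U0: "0 \<le> U a" for a using U_lower[of a] norm_ge_zero[of a] by linarith
  have V_deriv: "\<exists>V'. (V has_real_derivative V') (at s within {0..}) \<and>
    V' \<le> \<alpha> * b * enorm (w s) * enorm (p s) - \<alpha> * kP * c * (enorm (w s))\<^sup>2 +
      \<epsilon> * (b * enorm (\<xi> s) * enorm (p s) + kP * b * enorm (w s) * enorm (\<xi> s)
           - kI * c * (enorm (\<xi> s))\<^sup>2 + \<kappa> * b * (enorm (w s))\<^sup>2)" if s: "0 \<le> s" for s
    unfolding V_def
    by (rule fast_subsystem_lyapunov_derivative[OF Mx w \<xi> p(1)[OF s] _ _ _ _ _ _ balance s])
      (use pos gains in auto)
  define W where "W = (\<lambda>s. (U (e s))\<^sup>2 + V s)"
  have "W t \<le> exp (- 2 * r * t) * W 0"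
  proof (rule exp_bound_of_right_majorant[OF _ _ t])
    have ce: "continuous_on {0..} e"
      unfolding continuous_on_eq_continuous_within by (auto intro: has_vector_derivative_continuous e)
    have cV: "continuous_on {0..} V"
      unfolding continuous_on_eq_continuous_within using V_deriv by (auto intro: DERIV_continuous)
    have "K-lipschitz_on UNIV U"
    proof (rule lipschitz_onI[OF _ K])
      show "dist (U a) (U b) \<le> K * dist a b" for a b
        using U_lip[of a b] U_lip[of b a] by (simp add: dist_real_def dist_norm norm_minus_commute abs_le_iff)
    qed
    then have "continuous_on UNIV U" by (rule lipschitz_on_continuous_on)
    then have "continuous_on {0..} (\<lambda>s. U (e s))"
      by (rule continuous_on_compose2[OF _ ce]) auto
    with cV show "continuous_on {0..} W" unfolding W_def by (intro continuous_intros)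
  next
    fix s :: real assume s: "0 \<le> s"
    obtain y where y: "y 0 = e s" "\<And>h. 0 \<le> h \<Longrightarrow> (y has_vector_derivative f (y h)) (at h within {0..})"
      "\<And>h. 0 \<le> h \<Longrightarrow> U (y h) \<le> exp (- \<rho> * h) * U (e s)"
      using U_decay[of "e s"] by blast
    \<comment> \<open>the unperturbed solution that passes through e s at time s\<close>
    define z where "z = (\<lambda>h. y (h - s))"
    have z_deriv: "(z has_vector_derivative f (e s)) (at s within {s..})"
    proof -
      have shift: "((\<lambda>h. h - s) has_vector_derivative 1) (at s within {s..})"
        by (auto intro!: derivative_eq_intros)
      have "(y has_vector_derivative f (e s)) (at (s - s) within (\<lambda>h. h - s) ` {s..})"
        using y(2)[of 0] y(1) by (auto intro: has_vector_derivative_within_subset)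
      from vector_diff_chain_within[OF shift this] show ?thesis by (simp add: z_def o_def)
    qed
    have e_deriv: "(e has_vector_derivative f (e s) + g s) (at s within {s..})"
      using s by (intro has_vector_derivative_within_subset[OF e]) auto
    have "z s = e s" by (simp add: z_def y)
    moreover have "U (z h) \<le> exp (- \<rho> * (h - s)) * U (e s)" if "s \<le> h" for h
      using y(3)[of "h - s"] that by (simp add: z_def)
    ultimately obtain B where B: "B s = U (e s)" "\<forall>h\<ge>s. U (e h) \<le> B h"
      "(B has_real_derivative - \<rho> * U (e s) + K * norm (g s)) (at s within {s..})"
      using lyapunov_majorant_of_perturbed[of K U z s e f \<rho> "g s", OF K U_lip _ z_deriv _ e_deriv]
      by blast
    obtain V' where V': "(V has_real_derivative V') (at s within {0..})"
      "V' \<le> \<alpha> * b * enorm (w s) * enorm (p s) - \<alpha> * kP * c * (enorm (w s))\<^sup>2 +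
      \<epsilon> * (b * enorm (\<xi> s) * enorm (p s) + kP * b * enorm (w s) * enorm (\<xi> s)
           - kI * c * (enorm (\<xi> s))\<^sup>2 + \<kappa> * b * (enorm (w s))\<^sup>2)"
      using V_deriv[OF s] by blast
    define D where "D = (\<lambda>h. (B h)\<^sup>2 + V h)"
    define D' where "D' = 2 * U (e s) * (- \<rho> * U (e s) + K * norm (g s)) + V'"
    have "(D has_real_derivative D') (at s within {s..})"
      unfolding D_def D'_def
      by (rule derivative_eq_intros B(3) has_field_derivative_subset[OF V'(1)] refl)+
        (use s B(1) in auto)
    moreover have "W h \<le> D h" if "s \<le> h" for h
      unfolding W_def D_def using B(2) that U0 by (intro add_right_mono power_mono) auto
    moreover have "D s = W s" by (simp add: D_def W_def B(1))
    moreover have "D' \<le> - 2 * r * W s"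
    proof -
      let ?u = "U (e s)" and ?x = "enorm (w s)" and ?y = "enorm (\<xi> s)"
      have pu: "enorm (p s) \<le> L * (?u + ?x)"
        using p(2)[OF s] mult_left_mono[OF U_lower[of "e s"] gains(4)] by (simp add: algebra_simps)
      have "2 * ?u * (- \<rho> * ?u + K * norm (g s)) \<le> 2 * ?u * (- \<rho> * ?u + K * \<gamma> * ?x)"
        using U0[of "e s"] mult_left_mono[OF g[OF s] K]
        by (intro mult_left_mono) (simp_all add: mult.assoc)
      moreover have "\<alpha> * b * ?x * enorm (p s) \<le> \<alpha> * b * ?x * (L * (?u + ?x))"
        using pos bc pu by (intro mult_left_mono) auto
      moreover have "\<epsilon> * (b * ?y * enorm (p s) + kP * b * ?x * ?y - kI * c * ?y\<^sup>2 + \<kappa> * b * ?x\<^sup>2)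
        \<le> \<epsilon> * (b * ?y * (L * (?u + ?x)) + kP * b * ?x * ?y - kI * c * ?y\<^sup>2 + \<kappa> * b * ?x\<^sup>2)"
        using pos bc pu by (intro mult_left_mono add_right_mono diff_right_mono) auto
      ultimately have "D' \<le> 2 * ?u * (- \<rho> * ?u + K * \<gamma> * ?x) +
        (\<alpha> * b * ?x * (L * (?u + ?x)) - \<alpha> * kP * c * ?x\<^sup>2 +
         \<epsilon> * (b * ?y * (L * (?u + ?x)) + kP * b * ?x * ?y - kI * c * ?y\<^sup>2 + \<kappa> * b * ?x\<^sup>2))"
        unfolding D'_def using V'(2) by linarith
      also have "\<dots> \<le> - 2 * r * (?u\<^sup>2 + (\<alpha> * b + \<beta> + \<epsilon> * b) * (?x\<^sup>2 + ?y\<^sup>2))"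
        using cert U0[of "e s"] unfolding decay_certificate_def by (elim conjE allE impE) auto
      also have "\<dots> \<le> - 2 * r * W s"
        unfolding W_def using V_upper[OF s] pos by (simp add: mult_left_mono)
      finally show ?thesis .
    qed
    ultimately show "\<exists>B d. B s = W s \<and> (\<forall>h\<ge>s. W h \<le> B h) \<and>
      (B has_real_derivative d) (at s within {s..}) \<and> d \<le> - 2 * r * W s" by blast
  qed
  moreover have "(norm (e t))\<^sup>2 + (\<alpha> * c * (enorm (w t))\<^sup>2 + \<beta> * (enorm (\<xi> t))\<^sup>2) / 4 \<le> W t"
    unfolding W_def using V_lower[OF t] U_lower[of "e t"] by (intro add_mono power_mono) auto
  moreover have "W 0 \<le> C\<^sup>2 * (norm (e 0))\<^sup>2 + (\<alpha> * b + \<beta> + \<epsilon> * b) * ((enorm (w 0))\<^sup>2 + (enorm (\<xi> 0))\<^sup>2)"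
    unfolding W_def power_mult_distrib[symmetric]
    using V_upper[of 0] U_upper[of "e 0"] U0 by (intro add_mono power_mono) auto
  then have "exp (- 2 * r * t) * W 0 \<le> exp (- 2 * r * t) * (C\<^sup>2 * (norm (e 0))\<^sup>2 +
      (\<alpha> * b + \<beta> + \<epsilon> * b) * ((enorm (w 0))\<^sup>2 + (enorm (\<xi> 0))\<^sup>2))"
    by (intro mult_left_mono) auto
  ultimately show ?thesis by linarith
qed

text \<open>Merges the finitely many separate constants into one upper and one lower bound.\<close>

lemma lyapunov_matrices_exist:
  assumes carrier: "S \<in> carrier_mat m m" "T \<in> carrier_mat m m" "F \<in> carrier_mat m m" "Y \<in> carrier_mat m m"
    and Y: "Y\<^sup>T = Y" "Y * T = F\<^sup>T" "coercive m Y" "coercive m (Y * S)"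
    and Ti: "Ti \<in> carrier_mat m m" "Ti * T = 1\<^sub>m m"
  shows "\<exists>b c. lyapunov_matrices m S T F Y b c"
proof -
  obtain c1 where c1: "c1 > 0" "\<And>v. v \<in> carrier_vec m \<Longrightarrow> c1 * (enorm v)\<^sup>2 \<le> v \<bullet> (Y *\<^sub>v v)"
    using Y(3) unfolding coercive_def by blast
  obtain c2 where c2: "c2 > 0" "\<And>v. v \<in> carrier_vec m \<Longrightarrow> c2 * (enorm v)\<^sup>2 \<le> v \<bullet> (Y * S *\<^sub>v v)"
    using Y(4) unfolding coercive_def by blast
  obtain c3 where c3: "c3 > 0" "\<And>v. v \<in> carrier_vec m \<Longrightarrow> c3 * enorm v \<le> enorm (T *\<^sub>v v)"
    using left_invertible_bounded_below[OF carrier(2) Ti] by blast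
  have bound: "\<exists>b>0. \<forall>v\<in>carrier_vec m. enorm (A *\<^sub>v v) \<le> b * enorm v" if "A \<in> carrier_mat m m" for A
    using mult_mat_vec_enorm_bounded[of A] that by simp
  obtain b1 where b1: "b1 > 0" "\<And>v. v \<in> carrier_vec m \<Longrightarrow> enorm (Y *\<^sub>v v) \<le> b1 * enorm v"
    using bound[OF carrier(4)] by blast
  obtain b2 where b2: "b2 > 0" "\<And>v. v \<in> carrier_vec m \<Longrightarrow> enorm (T *\<^sub>v v) \<le> b2 * enorm v"
    using bound[OF carrier(2)] by blast
  have "T\<^sup>T * S \<in> carrier_mat m m" "T * F \<in> carrier_mat m m" using carrier by auto
  then obtain b3 b4 where b3: "b3 > 0" "\<And>v. v \<in> carrier_vec m \<Longrightarrow> enorm (T\<^sup>T * S *\<^sub>v v) \<le> b3 * enorm v"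
    and b4: "b4 > 0" "\<And>v. v \<in> carrier_vec m \<Longrightarrow> enorm (T * F *\<^sub>v v) \<le> b4 * enorm v"
    using bound by metis
  define b where "b = b1 + b2 + b3 + b4"
  define c where "c = min c1 (min c2 (c3\<^sup>2))"
  have raise: "x \<le> b * enorm v" if "x \<le> b' * enorm v" "b' \<le> b" for x b' v
    using that mult_right_mono[of b' b "enorm v"] by simp
  have lower: "c * (enorm v)\<^sup>2 \<le> x" if "c' * (enorm v)\<^sup>2 \<le> x" "c \<le> c'" for x c' v
    using that mult_right_mono[of c c' "(enorm v)\<^sup>2"] by simp
  have "lyapunov_matrices m S T F Y b c"
    unfolding lyapunov_matrices_def
  proof (intro conjI ballI carrier Y)
    show "0 < b" using b1 b2 b3 b4 by (simp add: b_def)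
    show "0 < c" using c1 c2 c3 by (simp add: c_def)
    fix v :: "real vec" assume v: "v \<in> carrier_vec m"
    show "c * (enorm v)\<^sup>2 \<le> v \<bullet> (Y *\<^sub>v v)" by (rule lower[OF c1(2)[OF v]]) (simp add: c_def)
    show "c * (enorm v)\<^sup>2 \<le> v \<bullet> (Y * S *\<^sub>v v)" by (rule lower[OF c2(2)[OF v]]) (simp add: c_def)
    have "c3\<^sup>2 * (enorm v)\<^sup>2 \<le> (enorm (T *\<^sub>v v))\<^sup>2"
      unfolding power_mult_distrib[symmetric] using c3(1) c3(2)[OF v] by (intro power_mono) auto
    then show "c * (enorm v)\<^sup>2 \<le> (enorm (T *\<^sub>v v))\<^sup>2" by (rule lower) (simp add: c_def)
    show "enorm (Y *\<^sub>v v) \<le> b * enorm v" by (rule raise[OF b1(2)[OF v]])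
        (use b1 b2 b3 b4 in \<open>simp add: b_def\<close>)
    show "enorm (T *\<^sub>v v) \<le> b * enorm v" by (rule raise[OF b2(2)[OF v]])
        (use b1 b2 b3 b4 in \<open>simp add: b_def\<close>)
    have "enorm (T\<^sup>T *\<^sub>v (S *\<^sub>v v)) \<le> b3 * enorm v" using b3(2)[OF v] carrier v by simp
    then show "enorm (T\<^sup>T *\<^sub>v (S *\<^sub>v v)) \<le> b * enorm v" by (rule raise) (use b1 b2 b3 b4 in \<open>simp add: b_def\<close>)
    have "enorm (T *\<^sub>v (F *\<^sub>v v)) \<le> b4 * enorm v" using b4(2)[OF v] carrier v by simp
    then show "enorm (T *\<^sub>v (F *\<^sub>v v)) \<le> b * enorm v" by (rule raise) (use b1 b2 b3 b4 in \<open>simp add: b_def\<close>)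
  qed
  then show ?thesis by blast
qed

section \<open>Orthogonal coordinates of the network\<close>

text \<open>The network and an equilibrium of its blended dynamics. The gains stay outside, because the
  constants of the Lyapunov argument must not depend on them.\<close>

locale blended_setup =
  fixes cpl :: coupling and N n q :: nat and G :: "(nat \<times> nat) set" and E :: "real mat"
    and h :: "nat \<Rightarrow> real vec \<Rightarrow> real vec" and Z W R :: "real mat"
    and zs :: "nat \<Rightarrow> real vec" and ws :: "real vec"
  assumes N: "0 < N" and G: "connected_graph N G" and E: "E \<in> carrier_mat q n" and qn: "q \<le> n"
    and lip: "\<And>i. i < N \<Longrightarrow> globally_lipschitz n (h i)"
    and Z: "Z \<in> carrier_mat n (n - q)" and Z_basis: "orthonormal_basis_cols Z (mat_kernel E)"
    and W: "W \<in> carrier_mat n q"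
    and W_basis: "orthonormal_basis_cols W (vec_module.orthogonal_complement n (mat_kernel E))"
    and R: "R \<in> carrier_mat N (N - 1)" and R_basis: "orthonormal_basis_cols R (mat_kernel ((ones N)\<^sup>T))"
    and equil: "blended_equilibrium N n q h Z W zs ws"

begin

lemma gram: "Z\<^sup>T * Z = 1\<^sub>m (n - q)" "W\<^sup>T * W = 1\<^sub>m q" "R\<^sup>T * R = 1\<^sub>m (N - 1)"
  by (rule orthonormal_basis_cols_gram[OF Z_basis Z] orthonormal_basis_cols_gram[OF W_basis W]
      orthonormal_basis_cols_gram[OF R_basis R])+

lemma EZ_vec: "v \<in> carrier_vec (n - q) \<Longrightarrow> E *\<^sub>v (Z *\<^sub>v v) = 0\<^sub>v q"
  using orthonormal_basis_cols_image[OF Z_basis Z] E by (auto simp: mat_kernel_def)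

lemma EZ: "E * Z = 0\<^sub>m q (n - q)"
proof (rule mat_eq_of_mult_vec[of _ q "n - q"])
  fix v :: "real vec" assume v: "v \<in> carrier_vec (n - q)"
  show "E * Z *\<^sub>v v = 0\<^sub>m q (n - q) *\<^sub>v v"
    using EZ_vec[OF v] E Z v by (simp add: zero_mat_mult_vec)
qed (use E Z in auto)

lemma W_orthogonal:
  assumes "v \<in> carrier_vec q" "u \<in> carrier_vec n" "E *\<^sub>v u = 0\<^sub>v q"
  shows "(W *\<^sub>v v) \<bullet> u = 0"
proof -
  interpret vec_module "TYPE(real)" n .
  have "u \<in> mat_kernel E" using assms E by (auto simp: mat_kernel_def)
  then show ?thesis
    using orthonormal_basis_cols_image[OF W_basis W assms(1)] by (auto simp: orthogonal_complement_def)
qed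

lemma ZW: "Z\<^sup>T * W = 0\<^sub>m (n - q) q"
proof (rule mat_eq_of_mult_vec[of _ "n - q" q])
  fix v :: "real vec" assume v: "v \<in> carrier_vec q"
  have Wv: "W *\<^sub>v v \<in> carrier_vec n" using W v by auto
  define x where "x = Z\<^sup>T *\<^sub>v (W *\<^sub>v v)"
  have x: "x \<in> carrier_vec (n - q)" using Z Wv by (auto simp: x_def)
  have Zx: "Z *\<^sub>v x \<in> carrier_vec n" using Z x by auto
  have "x \<bullet> x = (W *\<^sub>v v) \<bullet> (Z *\<^sub>v x)"
    using transpose_vec_mult_scalar[OF Z x Wv] by (simp add: x_def)
  also have "\<dots> = 0" by (rule W_orthogonal[OF v Zx EZ_vec[OF x]])
  finally have "enorm x = 0" by (simp add: enorm_def)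
  then have "x = 0\<^sub>v (n - q)" using x by (simp add: enorm_eq_0_iff)
  then show "Z\<^sup>T * W *\<^sub>v v = 0\<^sub>m (n - q) q *\<^sub>v v"
    using Z W v unfolding x_def by (simp add: zero_mat_mult_vec)
qed (use W Z in auto)

lemma ZW_split: "Z * Z\<^sup>T + W * W\<^sup>T = 1\<^sub>m n"
  using qn by (intro right_inverse_of_orthonormal_split[OF Z W _ gram(1,2) ZW]) simp

lemma R_ones: "(ones N)\<^sup>T * R = 0\<^sub>m 1 (N - 1)"
proof (rule mat_eq_of_mult_vec[of _ 1 "N - 1"])
  fix v :: "real vec" assume v: "v \<in> carrier_vec (N - 1)"
  have "(ones N)\<^sup>T *\<^sub>v (R *\<^sub>v v) = 0\<^sub>v 1"
    using orthonormal_basis_cols_image[OF R_basis R v] by (auto simp: mat_kernel_def ones_def)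
  then show "(ones N)\<^sup>T * R *\<^sub>v v = 0\<^sub>m 1 (N - 1) *\<^sub>v v"
    using R v assoc_mult_mat_vec[of "(ones N)\<^sup>T" 1 N R "N - 1" v] by (simp add: zero_mat_mult_vec)
next
  show "(ones N)\<^sup>T * R \<in> carrier_mat 1 (N - 1)"
    by (rule mult_carrier_mat[OF _ R]) simp
qed simp

text \<open>The vector \<open>ones N\<close>, normalized by \<open>sqrt N\<close>, completes the columns of \<open>R\<close> to an orthonormal
  basis.\<close>

lemma R_split: "R * R\<^sup>T + (1 / real N) \<cdot>\<^sub>m (ones N * (ones N)\<^sup>T) = 1\<^sub>m N"
proof -
  define u :: "real mat" where "u = mat N 1 (\<lambda>_. 1 / sqrt (real N))"
  have u: "u \<in> carrier_mat N 1" by (simp add: u_def)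
  have u_ones: "u = (1 / sqrt (real N)) \<cdot>\<^sub>m ones N" by (rule eq_matI) (auto simp: u_def ones_def)
  have uu: "u\<^sup>T * u = 1\<^sub>m 1"
    using N by (intro eq_matI) (auto simp: u_def scalar_prod_def)
  have "(R\<^sup>T * ones N)\<^sup>T = (ones N)\<^sup>T * R"
    using R by (subst transpose_mult[of _ "N - 1" N _ 1]) auto
  then have "(R\<^sup>T * ones N)\<^sup>T = 0\<^sub>m 1 (N - 1)" by (simp add: R_ones)
  then have "R\<^sup>T * ones N = 0\<^sub>m (N - 1) 1" by (metis transpose_transpose zero_transpose_mat)
  then have Ru: "R\<^sup>T * u = 0\<^sub>m (N - 1) 1"
    unfolding u_ones using R by (simp add: mult_smult_distrib[of _ "N - 1" N _ 1])
  have "R * R\<^sup>T + u * u\<^sup>T = 1\<^sub>m N"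
    using N by (intro right_inverse_of_orthonormal_split[OF R u _ gram(3) uu Ru]) simp
  moreover have "u * u\<^sup>T = (1 / real N) \<cdot>\<^sub>m (ones N * (ones N)\<^sup>T)"
    using N by (intro eq_matI) (auto simp: u_def ones_def scalar_prod_def)
  ultimately show ?thesis by simp
qed

text \<open>The matrix \<open>E\<close> vanishes on the columns of \<open>Z\<close>, so only the part \<open>W * W\<^sup>T\<close> of the identity
  contributes.\<close>

lemma E_eq: "E * W * W\<^sup>T = E"
proof -
  have "E = E * (Z * Z\<^sup>T + W * W\<^sup>T)" unfolding ZW_split using E by simp
  also have "\<dots> = E * (Z * Z\<^sup>T) + E * (W * W\<^sup>T)"
    using E Z W by (intro mult_add_distrib_mat[of _ q n]) auto
  also have "E * (Z * Z\<^sup>T) = E * Z * Z\<^sup>T"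
    using E Z by (intro assoc_mult_mat[symmetric, of _ q n _ "n - q"]) auto
  also have "\<dots> = 0\<^sub>m q n" unfolding EZ using Z by simp
  also have "E * (W * W\<^sup>T) = E * W * W\<^sup>T"
    using E W by (intro assoc_mult_mat[symmetric, of _ q n _ q]) auto
  finally show ?thesis using E W by simp
qed

text \<open>If \<open>E\<close> annihilates \<open>W *\<^sub>v v\<close>, then this vector is orthogonal to itself.\<close>

lemma EW_inverse:
  obtains Mi where "Mi \<in> carrier_mat q q" "Mi * (E * W) = 1\<^sub>m q" "(E * W) * Mi = 1\<^sub>m q"
proof (rule left_inverse_of_trivial_kernel[of "E * W" q])
  fix v assume v: "v \<in> carrier_vec q" and "E * W *\<^sub>v v = 0\<^sub>v q"
  then have "E *\<^sub>v (W *\<^sub>v v) = 0\<^sub>v q" using E W by simp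
  moreover have Wv: "W *\<^sub>v v \<in> carrier_vec n" using W v by auto
  ultimately have "(W *\<^sub>v v) \<bullet> (W *\<^sub>v v) = 0" using W_orthogonal[OF v Wv] by simp
  then have "W *\<^sub>v v = 0\<^sub>v n" using Wv by (simp add: enorm_def flip: enorm_eq_0_iff)
  then have "W\<^sup>T *\<^sub>v (W *\<^sub>v v) = 0\<^sub>v q" using W by auto
  then show "v = 0\<^sub>v q" using W v gram(2) assoc_mult_mat_vec[of "W\<^sup>T" q n W q v] by simp
qed (use E W that in auto)

abbreviation H :: "real vec \<Rightarrow> real vec" where "H \<equiv> stacked_h N n h"

abbreviation xs :: "real vec" where "xs \<equiv> x_star N n q Z W zs ws"

abbreviation LP :: "real mat" where "LP \<equiv> Lambda_P N G R"

abbreviation LI :: "real mat" where "LI \<equiv> Lambda_I cpl N G R"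

text \<open>The maps between the stacked state and its coordinates, and the dimensions of the latter.\<close>

abbreviation Zall :: "real mat" where "Zall \<equiv> 1\<^sub>m N \<otimes>\<^sub>K Z"

abbreviation Wall :: "real mat" where "Wall \<equiv> ones N \<otimes>\<^sub>K W"

abbreviation RW :: "real mat" where "RW \<equiv> R \<otimes>\<^sub>K W"

abbreviation ZallT :: "real mat" where "ZallT \<equiv> 1\<^sub>m N \<otimes>\<^sub>K Z\<^sup>T"

abbreviation WallT :: "real mat" where "WallT \<equiv> (ones N)\<^sup>T \<otimes>\<^sub>K W\<^sup>T"

abbreviation RWT :: "real mat" where "RWT \<equiv> R\<^sup>T \<otimes>\<^sub>K W\<^sup>T"

abbreviation RqT :: "real mat" where "RqT \<equiv> R\<^sup>T \<otimes>\<^sub>K 1\<^sub>m q"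

abbreviation dZ :: nat where "dZ \<equiv> N * (n - q)"

abbreviation dR :: nat where "dR \<equiv> (N - 1) * q"

abbreviation xis :: "real \<Rightarrow> real vec" where "xis \<equiv> xi_star cpl N n q G E h Z W R zs ws"

abbreviation error_bound :: "real \<Rightarrow> real \<Rightarrow> real \<Rightarrow> real \<Rightarrow> real \<Rightarrow> bool" where
  "error_bound \<equiv> error_exp_bound cpl N n q G E h Z W R zs ws"

abbreviation mas_bound :: "real \<Rightarrow> real \<Rightarrow> real \<Rightarrow> real \<Rightarrow> real \<Rightarrow> bool" where
  "mas_bound \<equiv> mas_exp_bound cpl N n q G E h Z W R zs ws"

text \<open>The matrices of the fast subsystem, named as in \<open>lyapunov_matrices\<close>.\<close>

abbreviation S_mat :: "real mat" where "S_mat \<equiv> LP \<otimes>\<^sub>K (W\<^sup>T * E\<^sup>T * E * W)"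

abbreviation T_mat :: "real mat" where "T_mat \<equiv> LI \<otimes>\<^sub>K (W\<^sup>T * E\<^sup>T)"

abbreviation F_mat :: "real mat" where "F_mat \<equiv> LP \<otimes>\<^sub>K (gain_K E W * E * W)"

lemma WE: "W\<^sup>T * E\<^sup>T = (E * W)\<^sup>T"
  using E W by (simp add: transpose_mult)

lemma gain_K_eq: "gain_K E W = (E * W) * (E * W)\<^sup>T"
  unfolding gain_K_def WE[symmetric] using E W by (intro assoc_mult_mat[of _ q q _ n]) auto

lemma LP_carrier [simp]: "LP \<in> carrier_mat (N - 1) (N - 1)"
  by (rule Lambda_P_carrier[OF R])

lemma LI_carrier [simp]: "LI \<in> carrier_mat (N - 1) (N - 1)"
  by (cases cpl) (use LP_carrier in \<open>simp_all add: Lambda_I_def\<close>)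

text \<open>The simplifier rewrites \<open>N - 1\<close> to \<open>N - Suc 0\<close>, where the rules have to match as well.\<close>

lemmas Suc_carrier [simp] = LP_carrier[unfolded One_nat_def] LI_carrier[unfolded One_nat_def]

lemma coercive_LP: "coercive (N - 1) LP"
  by (rule coercive_Lambda_P[OF G N R gram(3) R_ones])

text \<open>The inverse of a Kronecker product is taken factor by factor; the matrix on the left is coercive
  in case (A) and the identity in case (B).\<close>

lemma integral_gain_invertible:
  obtains Ti where "Ti \<in> carrier_mat dR dR" "Ti * T_mat = 1\<^sub>m dR"
    "T_mat * Ti = 1\<^sub>m dR"
proof -
  obtain Mi where Mi: "Mi \<in> carrier_mat q q" "Mi * (E * W) = 1\<^sub>m q" "(E * W) * Mi = 1\<^sub>m q"
    by (rule EW_inverse)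
  have EW: "E * W \<in> carrier_mat q q" using E W by auto
  have "Mi\<^sup>T * (E * W)\<^sup>T = 1\<^sub>m q"
    unfolding transpose_mult[OF EW Mi(1), symmetric] Mi(3) by simp
  moreover have "(E * W)\<^sup>T * Mi\<^sup>T = 1\<^sub>m q"
    unfolding transpose_mult[OF Mi(1) EW, symmetric] Mi(2) by simp
  ultimately have MiT: "Mi\<^sup>T * (E * W)\<^sup>T = 1\<^sub>m q" "(E * W)\<^sup>T * Mi\<^sup>T = 1\<^sub>m q" by blast+
  obtain Li where Li: "Li \<in> carrier_mat (N - 1) (N - 1)" "Li * LI = 1\<^sub>m (N - 1)" "LI * Li = 1\<^sub>m (N - 1)"
  proof (cases cpl)
    case CoupA
    then show ?thesis
      using coercive_left_inverse[OF LP_carrier coercive_LP] that by (auto simp: Lambda_I_def)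
  next
    case CoupB
    then show ?thesis using that[of "1\<^sub>m (N - 1)"] by (simp add: Lambda_I_def)
  qed
  have "(Li \<otimes>\<^sub>K Mi\<^sup>T) * T_mat = 1\<^sub>m dR"
    unfolding WE using Li Mi EW
    by (subst kron_mult[of _ "N - 1" "N - 1" _ q q _ "N - 1" _ q]) (auto simp: MiT kron_one)
  moreover have "T_mat * (Li \<otimes>\<^sub>K Mi\<^sup>T) = 1\<^sub>m dR"
    unfolding WE using Li Mi EW
    by (subst kron_mult[of _ "N - 1" "N - 1" _ q q _ "N - 1" _ q]) (auto simp: MiT kron_one)
  moreover have "Li \<otimes>\<^sub>K Mi\<^sup>T \<in> carrier_mat dR dR" using Li Mi by auto
  ultimately show ?thesis using that by blast
qed

text \<open>With \<open>M = E * W\<close> and \<open>A = M\<^sup>T * M\<close> the three matrices are \<open>LP \<otimes>\<^sub>K A\<close>, \<open>LI \<otimes>\<^sub>K M\<^sup>T\<close> and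
  \<open>LP \<otimes>\<^sub>K (M * M\<^sup>T * M)\<close>, and the transpose of the last one is \<open>LP \<otimes>\<^sub>K (A * M\<^sup>T)\<close>. So \<open>Y\<close> is
  \<open>1\<^sub>m (N - 1) \<otimes>\<^sub>K A\<close> in case (A), where \<open>LI = LP\<close>, and \<open>LP \<otimes>\<^sub>K A\<close> in case (B), where \<open>LI\<close> is the
  identity. Because \<open>gain_K E W\<close> is \<open>M * M\<^sup>T\<close>, the weight \<open>Y\<close> comes out symmetric and positive.\<close>

lemma setup_lyapunov_matrices:
  "\<exists>Y b c. lyapunov_matrices dR S_mat T_mat F_mat Y b c"
proof -
  define M where "M = E * W"
  define A where "A = M\<^sup>T * M"
  have M: "M \<in> carrier_mat q q" using E W by (auto simp: M_def)
  have A: "A \<in> carrier_mat q q" using M by (auto simp: A_def)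
  have AT: "A\<^sup>T = A" using M by (simp add: A_def transpose_mult[of _ q q])
  obtain Mi where Mi: "Mi \<in> carrier_mat q q" "Mi * M = 1\<^sub>m q"
    unfolding M_def using EW_inverse by metis
  have one: "1\<^sub>m (N - 1) \<in> carrier_mat (N - 1) (N - 1)" by simp
  have oneq: "1\<^sub>m q \<in> carrier_mat q q" by simp
  have "coercive q A" unfolding A_def by (rule coercive_gram[OF M Mi])
  then obtain Ai where Ai: "Ai \<in> carrier_mat q q" "Ai * A = 1\<^sub>m q"
    using coercive_left_inverse[OF A] by metis
  obtain Li where Li: "Li \<in> carrier_mat (N - 1) (N - 1)" "Li * LP = 1\<^sub>m (N - 1)"
    using coercive_left_inverse[OF LP_carrier coercive_LP] by metis
  have LPT: "LP\<^sup>T = LP" by (rule Lambda_P_symmetric[OF G R])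
  have S: "S_mat = LP \<otimes>\<^sub>K A"
  proof -
    have "W\<^sup>T * E\<^sup>T * E * W = A"
      unfolding WE A_def M_def using E W by (intro assoc_mult_mat[of _ q q _ n]) auto
    then show ?thesis by simp
  qed
  have T: "T_mat = LI \<otimes>\<^sub>K M\<^sup>T" by (simp add: WE M_def)
  have F: "F_mat = LP \<otimes>\<^sub>K (M * M\<^sup>T * M)"
  proof -
    have "gain_K E W * E * W = M * M\<^sup>T * M"
      unfolding gain_K_eq unfolding M_def[symmetric] using E W M
      by (subst assoc_mult_mat[of _ q q E n W q]) (auto simp: M_def)
    then show ?thesis by simp
  qed
  have MMM: "(M * M\<^sup>T * M)\<^sup>T = A * M\<^sup>T"
  proof -
    have "(M * M\<^sup>T * M)\<^sup>T = M\<^sup>T * (M * M\<^sup>T)\<^sup>T" using M by (intro transpose_mult[of _ q q]) auto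
    also have "(M * M\<^sup>T)\<^sup>T = M * M\<^sup>T" using transpose_mult[of M q q "M\<^sup>T" q] M by simp
    also have "M\<^sup>T * (M * M\<^sup>T) = A * M\<^sup>T"
      unfolding A_def using M by (intro assoc_mult_mat[symmetric, of _ q q _ q _ q]) auto
    finally show ?thesis .
  qed
  have FT: "F_mat\<^sup>T = LP \<otimes>\<^sub>K (A * M\<^sup>T)"
    unfolding F kron_transpose LPT MMM ..
  have carrier: "LP \<otimes>\<^sub>K B \<in> carrier_mat dR dR"
    "1\<^sub>m (N - 1) \<otimes>\<^sub>K B \<in> carrier_mat dR dR" if "B \<in> carrier_mat q q" for B
    using that by auto
  have left_inv: "(L' \<otimes>\<^sub>K B') * (L \<otimes>\<^sub>K B) = 1\<^sub>m dR"
    if "L' \<in> carrier_mat (N - 1) (N - 1)" "L \<in> carrier_mat (N - 1) (N - 1)" "L' * L = 1\<^sub>m (N - 1)"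
      "B' \<in> carrier_mat q q" "B \<in> carrier_mat q q" "B' * B = 1\<^sub>m q" for L L' B B'
    using that by (simp add: kron_mult[of _ "N - 1" "N - 1" _ q q _ "N - 1" _ q] kron_one)
  note km = kron_mult[of _ "N - 1" "N - 1" _ q q _ "N - 1" _ q]
  have sandwich: "(1\<^sub>m (N - 1) \<otimes>\<^sub>K B)\<^sup>T * (LP \<otimes>\<^sub>K 1\<^sub>m q) * (1\<^sub>m (N - 1) \<otimes>\<^sub>K B) = LP \<otimes>\<^sub>K (B\<^sup>T * B)"
    if B: "B \<in> carrier_mat q q" for B
  proof -
    have "(1\<^sub>m (N - 1) \<otimes>\<^sub>K B\<^sup>T) * (LP \<otimes>\<^sub>K 1\<^sub>m q) = LP \<otimes>\<^sub>K B\<^sup>T"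
      using B LP_carrier by (subst km) (auto simp: left_mult_one_mat[OF Suc_carrier(1)])
    moreover have "(LP \<otimes>\<^sub>K B\<^sup>T) * (1\<^sub>m (N - 1) \<otimes>\<^sub>K B) = LP \<otimes>\<^sub>K (B\<^sup>T * B)"
      using B LP_carrier by (subst km) (auto simp: right_mult_one_mat[OF Suc_carrier(1)])
    ultimately show ?thesis by (simp add: kron_transpose)
  qed
  have coercive_sandwich: "coercive dR (LP \<otimes>\<^sub>K (B\<^sup>T * B))"
    if B: "B \<in> carrier_mat q q" "B' \<in> carrier_mat q q" "B' * B = 1\<^sub>m q" for B B'
    unfolding sandwich[OF B(1), symmetric]
    by (rule coercive_congruence[OF _ coercive_kron_one[OF LP_carrier coercive_LP]])
      (use B carrier oneq one left_inv[OF one one _ B(2) B(1) B(3)] in auto)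
  obtain Ti where Ti: "Ti \<in> carrier_mat dR dR" "Ti * T_mat = 1\<^sub>m dR"
    using integral_gain_invertible by metis
  have Tc: "T_mat \<in> carrier_mat dR dR"
    unfolding T using M by auto
  have Sc: "S_mat \<in> carrier_mat dR dR" unfolding S by (rule carrier(1)[OF A])
  have Fc: "F_mat \<in> carrier_mat dR dR" unfolding F using M by (intro carrier(1)) auto
  show ?thesis
  proof (cases cpl)
    case CoupA
    define Y where "Y = 1\<^sub>m (N - 1) \<otimes>\<^sub>K A"
    have Y: "Y \<in> carrier_mat dR dR" unfolding Y_def by (rule carrier(2)[OF A])
    have "Y\<^sup>T = Y" unfolding Y_def kron_transpose AT by simp
    moreover have "Y * T_mat = F_mat\<^sup>T"
      unfolding FT T Y_def using A M LP_carrier CoupA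
      by (subst km) (auto simp: Lambda_I_def left_mult_one_mat[OF Suc_carrier(1)])
    moreover have "coercive dR Y"
    proof -
      have "Y = (1\<^sub>m (N - 1) \<otimes>\<^sub>K M)\<^sup>T * (1\<^sub>m (N - 1) \<otimes>\<^sub>K M)"
        unfolding Y_def A_def kron_transpose using M by (subst km) auto
      also have "coercive dR \<dots>"
        by (rule coercive_gram[OF carrier(2)[OF M] carrier(2)[OF Mi(1)]])
          (rule left_inv[OF one one _ Mi(1) M Mi(2)], simp)
      finally show ?thesis .
    qed
    moreover have "coercive dR (Y * S_mat)"
    proof -
      have "Y * S_mat = LP \<otimes>\<^sub>K (A\<^sup>T * A)"
        unfolding S Y_def AT using A LP_carrier by (subst km)
            (auto simp: left_mult_one_mat[OF Suc_carrier(1)])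
      then show ?thesis using coercive_sandwich[OF A Ai] by simp
    qed
    ultimately show ?thesis using lyapunov_matrices_exist[OF Sc Tc Fc Y _ _ _ _ Ti] by blast
  next
    case CoupB
    define Y where "Y = LP \<otimes>\<^sub>K A"
    have Y: "Y \<in> carrier_mat dR dR" unfolding Y_def by (rule carrier(1)[OF A])
    have YT: "Y\<^sup>T = Y" unfolding Y_def kron_transpose AT LPT by simp
    moreover have "Y * T_mat = F_mat\<^sup>T"
      unfolding FT T Y_def using A M LP_carrier CoupB
      by (subst km) (auto simp: Lambda_I_def right_mult_one_mat[OF Suc_carrier(1)])
    moreover have "coercive dR Y"
      unfolding Y_def using coercive_sandwich[OF M Mi] by (simp add: A_def)
    moreover have "coercive dR (Y * S_mat)"
    proof -
      have "Y * S_mat = Y\<^sup>T * Y" unfolding YT by (simp add: S Y_def)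
      then show ?thesis
        using coercive_gram[OF Y _ left_inv[OF Li(1) LP_carrier Li(2) Ai(1) A Ai(2), folded Y_def]] Li Ai
        by auto
    qed
    ultimately show ?thesis using lyapunov_matrices_exist[OF Sc Tc Fc Y _ _ _ _ Ti] by blast
  qed
qed

section \<open>The blended dynamics in error coordinates\<close>

lemma H_carrier [simp]: "H x \<in> carrier_vec (N * n)"
  by (simp add: stacked_h_def)

lemma h_carrier: "i < N \<Longrightarrow> v \<in> carrier_vec n \<Longrightarrow> h i v \<in> carrier_vec n"
  using lip[of i] by (auto simp: globally_lipschitz_def)

lemma H_stack: "(\<And>i. i < N \<Longrightarrow> v i \<in> carrier_vec n) \<Longrightarrow> H (stack N n v) = stack N n (\<lambda>i. h i (v i))"
  unfolding stacked_h_def by (rule stack_cong) (simp add: block_stack)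

lemma H_lipschitz:
  obtains L where "0 \<le> L" "\<And>x y. x \<in> carrier_vec (N * n) \<Longrightarrow> y \<in> carrier_vec (N * n) \<Longrightarrow>
    enorm (H x - H y) \<le> L * enorm (x - y)"
proof -
  have "\<forall>i. \<exists>L. i < N \<longrightarrow> 0 \<le> L \<and> (\<forall>u\<in>carrier_vec n. \<forall>v\<in>carrier_vec n. enorm (h i u - h i v)
      \<le> L * enorm (u - v))"
    using lipschitz_bound_nonneg[OF lip] by metis
  then obtain l where l: "\<And>i. i < N \<Longrightarrow> 0 \<le> l i" "\<And>i u v. i < N \<Longrightarrow> u \<in> carrier_vec n \<Longrightarrow> v \<in> carrier_vec n \<Longrightarrow>
      enorm (h i u - h i v) \<le> l i * enorm (u - v)"
    by metis
  define L where "L = (\<Sum>i<N. l i)"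
  have L: "0 \<le> L" unfolding L_def using l by (intro sum_nonneg) auto
  have lL: "l i \<le> L" if "i < N" for i
    unfolding L_def using that l(1) by (intro member_le_sum) auto
  have "enorm (H x - H y) \<le> L * enorm (x - y)" if x: "x \<in> carrier_vec (N * n)"
      and y: "y \<in> carrier_vec (N * n)" for x y
  proof (rule power2_le_imp_le)
    have hx: "h i (block n i x) \<in> carrier_vec n" "h i (block n i y) \<in> carrier_vec n" if "i < N" for i
      using that by (auto intro: h_carrier)
    have "H x - H y = stack N n (\<lambda>i. h i (block n i x) - h i (block n i y))"
      unfolding stacked_h_def using hx by (intro stack_diff[symmetric])
    then have "(enorm (H x - H y))\<^sup>2 = (\<Sum>i<N. (enorm (h i (block n i x) - h i (block n i y)))\<^sup>2)"
      using enorm_stack_square[of N "\<lambda>i. h i (block n i x) - h i (block n i y)" n] hx by simp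
    also have "\<dots> \<le> (\<Sum>i<N. (L * enorm (block n i (x - y)))\<^sup>2)"
    proof (intro sum_mono power_mono)
      fix i assume "i \<in> {..<N}"
      then have i: "i < N" by simp
      have "enorm (h i (block n i x) - h i (block n i y)) \<le> l i * enorm (block n i x - block n i y)"
        by (rule l(2)[OF i]) auto
      also have "\<dots> \<le> L * enorm (block n i (x - y))"
        unfolding block_diff[OF i x y] by (intro mult_right_mono lL i) auto
      finally show "enorm (h i (block n i x) - h i (block n i y)) \<le> L * enorm (block n i (x - y))" .
    qed simp
    also have "\<dots> = L\<^sup>2 * (\<Sum>i<N. (enorm (block n i (x - y)))\<^sup>2)"
      by (simp add: power_mult_distrib sum_distrib_left)
    also have "(\<Sum>i<N. (enorm (block n i (x - y)))\<^sup>2) = (enorm (x - y))\<^sup>2"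
      using enorm_stack_square[of N "\<lambda>i. block n i (x - y)" n] stack_block[of "x - y" N n] x y by simp
    finally show "(enorm (H x - H y))\<^sup>2 \<le> (L * enorm (x - y))\<^sup>2" by (simp add: power_mult_distrib)
  qed (use L in simp)
  with L show ?thesis by (rule that)
qed

lemma equil_carrier: "i < N \<Longrightarrow> zs i \<in> carrier_vec (n - q)" "ws \<in> carrier_vec q"
  using equil by (auto simp: blended_equilibrium_def)

text \<open>The deviation of the network from the equilibrium when the agents agree in the \<open>W\<close> directions; the
  vector \<open>e\<close> consists of the \<open>z\<close> errors followed by the error of the mean of \<open>w\<close>.\<close>

definition assemble :: "real vec \<Rightarrow> real vec" where
  "assemble e = Zall *\<^sub>v vec_first e dZ + Wall *\<^sub>v vec_last e q"

text \<open>The velocity of the coordinates \<open>e\<close> when the stacked state has velocity \<open>y\<close>.\<close>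

definition drift :: "real vec \<Rightarrow> real vec" where
  "drift y = (ZallT *\<^sub>v y) @\<^sub>v ((1 / real N) \<cdot>\<^sub>v (WallT *\<^sub>v y))"

text \<open>The blended dynamics with its equilibrium moved to the origin.\<close>

definition blended_field :: "real vec \<Rightarrow> real vec" where
  "blended_field e = drift (H (assemble e + xs))"

abbreviation d :: nat where "d \<equiv> dZ + q"

lemma coordinate_matrices [simp]:
  "1\<^sub>m N \<otimes>\<^sub>K Z \<in> carrier_mat (N * n) dZ"
  "ones N \<otimes>\<^sub>K W \<in> carrier_mat (N * n) q"
  "R \<otimes>\<^sub>K W \<in> carrier_mat (N * n) dR"
  "1\<^sub>m N \<otimes>\<^sub>K Z\<^sup>T \<in> carrier_mat dZ (N * n)"
  "(ones N)\<^sup>T \<otimes>\<^sub>K W\<^sup>T \<in> carrier_mat q (N * n)"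
  "R\<^sup>T \<otimes>\<^sub>K W\<^sup>T \<in> carrier_mat dR (N * n)"
proof -
  have "ones N \<otimes>\<^sub>K W \<in> carrier_mat (N * n) (1 * q)" by (rule kron_carrier[OF ones_carrier W])
  then show "ones N \<otimes>\<^sub>K W \<in> carrier_mat (N * n) q" by simp
  have "(ones N)\<^sup>T \<otimes>\<^sub>K W\<^sup>T \<in> carrier_mat (1 * q) (N * n)" by (rule kron_carrier) (use W in auto)
  then show "(ones N)\<^sup>T \<otimes>\<^sub>K W\<^sup>T \<in> carrier_mat q (N * n)" by simp
qed (use Z W R in auto)

lemma assemble_carrier [simp]: "assemble e \<in> carrier_vec (N * n)"
  unfolding assemble_def by (intro add_carrier_vec mult_mat_vec_carrier[OF coordinate_matrices(1)]
      mult_mat_vec_carrier[OF coordinate_matrices(2)]) auto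

lemma drift_carrier [simp]: "y \<in> carrier_vec (N * n) \<Longrightarrow> drift y \<in> carrier_vec d"
  unfolding drift_def
  using mult_mat_vec_carrier[OF coordinate_matrices(4), of y]
      mult_mat_vec_carrier[OF coordinate_matrices(5), of y]
  by auto

lemma xs_carrier [simp]: "xs \<in> carrier_vec (N * n)"
  unfolding x_star_def using equil_carrier
  by (intro add_carrier_vec mult_mat_vec_carrier[OF coordinate_matrices(1)]
      mult_mat_vec_carrier[OF coordinate_matrices(2)]) auto

lemma assemble_diff:
  assumes "e \<in> carrier_vec d" "e' \<in> carrier_vec d"
  shows "assemble e - assemble e' = assemble (e - e')"
proof -
  have f: "vec_first (e - e') dZ = vec_first e dZ - vec_first e' dZ"
    using assms by (auto simp: vec_first_def)
  have l: "vec_last (e - e') q = vec_last e q - vec_last e' q"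
    using assms by (auto simp: vec_last_def)
  let ?z = "Zall *\<^sub>v vec_first e dZ" and ?z' = "Zall *\<^sub>v vec_first e' dZ"
  let ?w = "Wall *\<^sub>v vec_last e q" and ?w' = "Wall *\<^sub>v vec_last e' q"
  have c: "?z \<in> carrier_vec (N * n)" "?z' \<in> carrier_vec (N * n)" "?w \<in> carrier_vec (N * n)" "?w' \<in> carrier_vec (N * n)"
    by (intro mult_mat_vec_carrier[OF coordinate_matrices(1)]
        mult_mat_vec_carrier[OF coordinate_matrices(2)]; simp)+
  have "assemble (e - e') = (?z - ?z') + (?w - ?w')"
    unfolding assemble_def f l
    using mult_minus_distrib_mat_vec[OF coordinate_matrices(1), of "vec_first e dZ" "vec_first e' dZ"]
      mult_minus_distrib_mat_vec[OF coordinate_matrices(2), of "vec_last e q" "vec_last e' q"] by simp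
  also have "\<dots> = (?z + ?w) - (?z' + ?w')" using c by (rule vec_diff_add_diff)
  finally show ?thesis unfolding assemble_def ..
qed

lemma drift_diff:
  assumes "y \<in> carrier_vec (N * n)" "y' \<in> carrier_vec (N * n)"
  shows "drift y - drift y' = drift (y - y')"
proof -
  note c = mult_mat_vec_carrier[OF coordinate_matrices(4)] mult_mat_vec_carrier[OF coordinate_matrices(5)]
  have 1: "ZallT *\<^sub>v (y - y') = ZallT *\<^sub>v y - ZallT *\<^sub>v y'"
    by (rule mult_minus_distrib_mat_vec[OF coordinate_matrices(4) assms])
  have 2: "WallT *\<^sub>v (y - y') = WallT *\<^sub>v y - WallT *\<^sub>v y'"
    by (rule mult_minus_distrib_mat_vec[OF coordinate_matrices(5) assms])
  show ?thesis
    unfolding drift_def 1 2 using c[OF assms(1)] c[OF assms(2)]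
    by (intro eq_vecI) (auto simp: right_diff_distrib diff_divide_distrib)
qed

lemma assemble_bounded: "\<exists>b>0. \<forall>e\<in>carrier_vec d. enorm (assemble e) \<le> b * enorm e"
proof -
  obtain b1 where b1: "b1 > 0" "\<And>v. v \<in> carrier_vec dZ \<Longrightarrow> enorm (Zall *\<^sub>v v) \<le> b1 * enorm v"
    using mult_mat_vec_enorm_bounded[of Zall] carrier_matD[OF coordinate_matrices(1)] by auto
  obtain b2 where b2: "b2 > 0" "\<And>v. v \<in> carrier_vec q \<Longrightarrow> enorm (Wall *\<^sub>v v) \<le> b2 * enorm v"
    using mult_mat_vec_enorm_bounded[of Wall] carrier_matD[OF coordinate_matrices(2)] by auto
  show ?thesis
  proof (intro exI[of _ "b1 + b2"] conjI ballI)
    fix e :: "real vec" assume e: "e \<in> carrier_vec d"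
    let ?f = "vec_first e dZ" and ?l = "vec_last e q"
    have "?f @\<^sub>v ?l = e" using e by simp
    then have fl: "enorm ?f \<le> enorm e" "enorm ?l \<le> enorm e"
      using enorm_append_le(1)[of ?f ?l] enorm_append_le(2)[of ?l ?f] by simp_all
    have "enorm (assemble e) \<le> enorm (Zall *\<^sub>v ?f) + enorm (Wall *\<^sub>v ?l)"
      unfolding assemble_def
      by (rule enorm_triangle; rule mult_mat_vec_carrier[OF coordinate_matrices(1)]
          mult_mat_vec_carrier[OF coordinate_matrices(2)]; simp)
    also have "\<dots> \<le> b1 * enorm ?f + b2 * enorm ?l" by (intro add_mono b1 b2) auto
    also have "\<dots> \<le> b1 * enorm e + b2 * enorm e" using b1 b2 fl by (intro add_mono mult_left_mono) auto
    finally show "enorm (assemble e) \<le> (b1 + b2) * enorm e" by (simp add: distrib_right)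
  qed (use b1 b2 in simp)
qed

lemma drift_bounded: "\<exists>b>0. \<forall>y\<in>carrier_vec (N * n). enorm (drift y) \<le> b * enorm y"
proof -
  obtain b1 where b1: "b1 > 0" "\<And>v. v \<in> carrier_vec (N * n) \<Longrightarrow> enorm (ZallT *\<^sub>v v) \<le> b1 * enorm v"
    using mult_mat_vec_enorm_bounded[of ZallT] carrier_matD[OF coordinate_matrices(4)] by auto
  obtain b2 where b2: "b2 > 0" "\<And>v. v \<in> carrier_vec (N * n) \<Longrightarrow> enorm (WallT *\<^sub>v v) \<le> b2 * enorm v"
    using mult_mat_vec_enorm_bounded[of WallT] carrier_matD[OF coordinate_matrices(5)] by auto
  show ?thesis
  proof (intro exI[of _ "b1 + 1 / real N * b2"] conjI ballI)
    fix y :: "real vec" assume y: "y \<in> carrier_vec (N * n)"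
    have "enorm (drift y) \<le> enorm (ZallT *\<^sub>v y) + 1 / real N * enorm (WallT *\<^sub>v y)"
      unfolding drift_def by (rule order_trans[OF enorm_append_le_add]) (simp add: enorm_smult)
    also have "\<dots> \<le> b1 * enorm y + 1 / real N * (b2 * enorm y)"
      by (intro add_mono mult_left_mono b1 b2 y) auto
    finally show "enorm (drift y) \<le> (b1 + 1 / real N * b2) * enorm y" by (simp add: distrib_right)
  qed (use b1 b2 in \<open>simp add: add_pos_nonneg\<close>)
qed

lemma xs_stack: "xs = stack N n (\<lambda>i. Z *\<^sub>v zs i + W *\<^sub>v ws)"
proof -
  have "xs = stack N n (\<lambda>i. Z *\<^sub>v zs i) + stack N n (\<lambda>i. W *\<^sub>v ws)"
    unfolding x_star_def ones_kron_mult_vec[OF W equil_carrier(2)]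
    by (subst kron_one_mult_stack[OF Z equil_carrier(1)]) simp_all
  also have "\<dots> = stack N n (\<lambda>i. Z *\<^sub>v zs i + W *\<^sub>v ws)"
    by (rule stack_add[symmetric]) (use Z W equil_carrier in auto)
  finally show ?thesis .
qed

lemma assemble_stack:
  "assemble e = stack N n (\<lambda>i. Z *\<^sub>v block (n - q) i (vec_first e dZ) + W *\<^sub>v vec_last e q)"
proof -
  let ?f = "vec_first e dZ"
  have "assemble e = Zall *\<^sub>v stack N (n - q) (\<lambda>i. block (n - q) i ?f) + Wall *\<^sub>v vec_last e q"
    unfolding assemble_def by (simp add: stack_block)
  also have "\<dots> = stack N n (\<lambda>i. Z *\<^sub>v block (n - q) i ?f) + stack N n (\<lambda>i. W *\<^sub>v vec_last e q)"
    by (subst kron_one_mult_stack[OF Z]) (simp_all add: ones_kron_mult_vec[OF W])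
  also have "\<dots> = stack N n (\<lambda>i. Z *\<^sub>v block (n - q) i ?f + W *\<^sub>v vec_last e q)"
    by (rule stack_add[symmetric]; rule mult_mat_vec_carrier[OF Z] mult_mat_vec_carrier[OF W]; simp)
  finally show ?thesis .
qed

lemma drift_stack:
  assumes v: "\<And>i. i < N \<Longrightarrow> v i \<in> carrier_vec n"
  shows "drift (stack N n v) = stack N (n - q) (\<lambda>i. Z\<^sup>T *\<^sub>v v i) @\<^sub>v
    ((1 / real N) \<cdot>\<^sub>v finsum_vec TYPE(real) q (\<lambda>i. W\<^sup>T *\<^sub>v v i) {..<N})"
proof -
  have "Z\<^sup>T \<in> carrier_mat (n - q) n" "W\<^sup>T \<in> carrier_mat q n" using Z W by auto
  then show ?thesis
    unfolding drift_def using v by (simp add: kron_one_mult_stack ones_transpose_kron_mult_stack)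
qed

lemma blended_field_eq:
  fixes e :: "real vec"
  defines "z \<equiv> \<lambda>i. block (n - q) i (vec_first e dZ) + zs i" and "w \<equiv> vec_last e q + ws"
  shows "blended_field e = stack N (n - q) (\<lambda>i. blended_z h Z W i z w) @\<^sub>v blended_w N q h Z W z w"
proof -
  have c: "Z *\<^sub>v z i + W *\<^sub>v w \<in> carrier_vec n" if "i < N" for i
    using that Z W equil_carrier by (auto simp: z_def w_def)
  let ?f = "vec_first e dZ"
  have "assemble e + xs = stack N n (\<lambda>i. (Z *\<^sub>v block (n - q) i ?f + W *\<^sub>v vec_last e q) + (Z *\<^sub>v zs i + W *\<^sub>v ws))"
    unfolding assemble_stack xs_stack
    by (rule stack_add[symmetric]) (use Z W equil_carrier in auto)
  also have "\<dots> = stack N n (\<lambda>i. Z *\<^sub>v z i + W *\<^sub>v w)"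
  proof (rule stack_cong)
    fix i assume i: "i < N"
    note zi = equil_carrier(1)[OF i]
    have "Z *\<^sub>v z i = Z *\<^sub>v block (n - q) i ?f + Z *\<^sub>v zs i"
      unfolding z_def by (rule mult_add_distrib_mat_vec[OF Z _ zi]) simp
    moreover have "W *\<^sub>v w = W *\<^sub>v vec_last e q + W *\<^sub>v ws"
      unfolding w_def by (rule mult_add_distrib_mat_vec[OF W _ equil_carrier(2)]) simp
    moreover have "Z *\<^sub>v block (n - q) i ?f \<in> carrier_vec n" "Z *\<^sub>v zs i \<in> carrier_vec n"
      "W *\<^sub>v vec_last e q \<in> carrier_vec n" "W *\<^sub>v ws \<in> carrier_vec n"
      by (rule mult_mat_vec_carrier[OF Z] mult_mat_vec_carrier[OF W], simp add: zi equil_carrier)+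
    ultimately show "(Z *\<^sub>v block (n - q) i ?f + W *\<^sub>v vec_last e q) + (Z *\<^sub>v zs i + W *\<^sub>v ws)
        = Z *\<^sub>v z i + W *\<^sub>v w"
      by (intro eq_vecI) auto
  qed
  finally have "H (assemble e + xs) = stack N n (\<lambda>i. h i (Z *\<^sub>v z i + W *\<^sub>v w))"
    by (simp add: H_stack c)
  then show ?thesis
    unfolding blended_field_def blended_z_def blended_w_def
    by (simp add: drift_stack h_carrier c)
qed

lemma assemble_zero: "assemble (0\<^sub>v d) = 0\<^sub>v (N * n)"
proof -
  obtain b where "b > 0" "enorm (assemble (0\<^sub>v d)) \<le> b * enorm (0\<^sub>v d)"
    using assemble_bounded by (metis zero_carrier_vec)
  then have "enorm (assemble (0\<^sub>v d)) = 0" using enorm_nonneg[of "assemble (0\<^sub>v d)"] by simp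
  then show ?thesis by (simp only: enorm_eq_0_iff[OF assemble_carrier])
qed

lemma blended_field_zero: "blended_field (0\<^sub>v d) = 0\<^sub>v d"
proof -
  have c: "Z *\<^sub>v zs i + W *\<^sub>v ws \<in> carrier_vec n" if "i < N" for i
    using that Z W equil_carrier by auto
  have "blended_field (0\<^sub>v d) = drift (stack N n (\<lambda>i. h i (Z *\<^sub>v zs i + W *\<^sub>v ws)))"
    unfolding blended_field_def assemble_zero using xs_carrier
        by (simp add: xs_stack H_stack c del: xs_carrier)
  also have "\<dots> = stack N (n - q) (\<lambda>i. blended_z h Z W i zs ws) @\<^sub>v blended_w N q h Z W zs ws"
    by (simp add: drift_stack h_carrier c blended_z_def blended_w_def)
  also have "stack N (n - q) (\<lambda>i. blended_z h Z W i zs ws) = stack N (n - q) (\<lambda>i. 0\<^sub>v (n - q))"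
    using equil by (intro stack_cong) (auto simp: blended_equilibrium_def)
  also have "blended_w N q h Z W zs ws = 0\<^sub>v q" using equil by (simp add: blended_equilibrium_def)
  also have "stack N (n - q) (\<lambda>i. 0\<^sub>v (n - q)) @\<^sub>v 0\<^sub>v q = 0\<^sub>v d"
    by (rule eq_vecI) (auto simp: stack_index div_mod_less_mult)
  finally show ?thesis .
qed

lemma blended_field_carrier [simp]: "blended_field e \<in> carrier_vec d"
  unfolding blended_field_def by simp

text \<open>Transports the assumed stability of the blended dynamics, which is stated agent by agent, to the
  single vector field \<open>blended_field\<close>.\<close>

lemma blended_field_solution:
  assumes y: "has_derivative_traj d y (\<lambda>t. blended_field (y t))"
  defines "z \<equiv> \<lambda>i t. block (n - q) i (vec_first (y t) dZ) + zs i"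
    and "w \<equiv> \<lambda>t. vec_last (y t) q + ws"
  shows "blended_solution N n q h Z W z w"
    and "0 \<le> t \<Longrightarrow> (stack N (n - q) (\<lambda>i. z i t) - stack N (n - q) zs) @\<^sub>v (w t - ws) = y t"
proof -
  have eq: "blended_field (y t) = stack N (n - q) (\<lambda>i. blended_z h Z W i (\<lambda>j. z j t) (w t)) @\<^sub>v
      blended_w N q h Z W (\<lambda>j. z j t) (w t)" for t
    unfolding blended_field_eq z_def w_def ..
  have bw: "blended_w N q h Z W (\<lambda>j. z j t) (w t) \<in> carrier_vec q" for t
  proof -
    have "(\<lambda>i. W\<^sup>T *\<^sub>v h i (Z *\<^sub>v z i t + W *\<^sub>v w t)) \<in> {..<N} \<rightarrow> carrier_vec q"
      using W by (auto intro!: carrier_vecI)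
    from finsum_vec_closed[OF this] show ?thesis unfolding blended_w_def by simp
  qed
  have bz: "blended_z h Z W i (\<lambda>j. z j t) (w t) \<in> carrier_vec (n - q)" for i t
    unfolding blended_z_def by (rule carrier_vecI) (use Z in simp)
  have "has_derivative_traj (n - q) (z i) (\<lambda>t. blended_z h Z W i (\<lambda>j. z j t) (w t))" if i: "i < N" for i
  proof -
    have "has_derivative_traj (n - q) (\<lambda>t. block (n - q) i (vec_first (y t) dZ))
        (\<lambda>t. block (n - q) i (vec_first (blended_field (y t)) dZ))"
      by (rule has_derivative_traj_block[OF has_derivative_traj_first[OF y] i])
    then have "has_derivative_traj (n - q) (z i)
        (\<lambda>t. block (n - q) i (vec_first (blended_field (y t)) dZ))"
      unfolding z_def by (rule has_derivative_traj_add_const[OF _ equil_carrier(1)[OF i]])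
    moreover have "block (n - q) i (vec_first (blended_field (y t)) dZ)
        = blended_z h Z W i (\<lambda>j. z j t) (w t)" for t
      unfolding eq vec_first_append[OF stack_carrier]
      by (rule block_stack[OF i, where v = "\<lambda>i. blended_z h Z W i (\<lambda>j. z j t) (w t)", OF bz])
    ultimately show ?thesis by simp
  qed
  moreover have "has_derivative_traj q w (\<lambda>t. blended_w N q h Z W (\<lambda>j. z j t) (w t))"
  proof -
    have "has_derivative_traj q w (\<lambda>t. vec_last (blended_field (y t)) q)"
      unfolding w_def by (rule has_derivative_traj_add_const[OF has_derivative_traj_last[OF y] equil_carrier(2)])
    moreover have "vec_last (blended_field (y t)) q = blended_w N q h Z W (\<lambda>j. z j t) (w t)" for t
      unfolding eq by (rule vec_last_append[OF stack_carrier bw])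
    ultimately show ?thesis by simp
  qed
  ultimately show "blended_solution N n q h Z W z w" by (simp add: blended_solution_def)
  assume t: "0 \<le> t"
  then have yc: "y t \<in> carrier_vec d" using y by (auto simp: has_derivative_traj_def)
  have "stack N (n - q) (\<lambda>i. z i t) - stack N (n - q) zs = stack N (n - q) (\<lambda>i. z i t - zs i)"
    by (rule stack_diff[symmetric]) (use equil_carrier in \<open>auto simp: z_def\<close>)
  also have "\<dots> = stack N (n - q) (\<lambda>i. block (n - q) i (vec_first (y t) dZ))"
    unfolding z_def using carrier_vecD[OF equil_carrier(1)] by (intro stack_cong eq_vecI)
        (auto simp: block_def)
  also have "\<dots> = vec_first (y t) dZ" by (simp add: stack_block)
  finally have 1: "stack N (n - q) (\<lambda>i. z i t) - stack N (n - q) zs = vec_first (y t) dZ" .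
  have 2: "w t - ws = vec_last (y t) q"
    unfolding w_def using carrier_vecD[OF equil_carrier(2)] by (intro eq_vecI) (auto simp: vec_last_def)
  show "(stack N (n - q) (\<lambda>i. z i t) - stack N (n - q) zs) @\<^sub>v (w t - ws) = y t"
    unfolding 1 2 using yc by simp
qed

lemma H_assemble_diff:
  assumes L: "0 \<le> L" "\<And>x y. x \<in> carrier_vec (N * n) \<Longrightarrow> y \<in> carrier_vec (N * n) \<Longrightarrow> enorm (H x - H y)
      \<le> L * enorm (x - y)"
    and b: "\<And>e. e \<in> carrier_vec d \<Longrightarrow> enorm (assemble e) \<le> b * enorm e"
    and v: "v \<in> carrier_vec d" and w: "w \<in> carrier_vec d"
  shows "enorm (H (assemble v + xs) - H (assemble w + xs)) \<le> L * (b * enorm (v - w))"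
proof -
  have "enorm (H (assemble v + xs) - H (assemble w + xs)) \<le> L * enorm ((assemble v + xs) - (assemble w + xs))"
    by (rule L(2)) auto
  also have "(assemble v + xs) - (assemble w + xs) = assemble v - assemble w"
    by (rule vec_add_diff_add[OF assemble_carrier assemble_carrier xs_carrier])
  also have "\<dots> = assemble (v - w)" by (rule assemble_diff[OF v w])
  also have "L * enorm (assemble (v - w)) \<le> L * (b * enorm (v - w))"
    using v w L(1) by (intro mult_left_mono b) auto
  finally show ?thesis .
qed

lemma blended_field_lipschitz:
  "\<exists>L. \<forall>v\<in>carrier_vec d. \<forall>w\<in>carrier_vec d. enorm (blended_field v - blended_field w) \<le> L * enorm (v - w)"
proof -
  obtain L where L: "0 \<le> L" "\<And>x y. x \<in> carrier_vec (N * n) \<Longrightarrow> y \<in> carrier_vec (N * n) \<Longrightarrow>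
      enorm (H x - H y) \<le> L * enorm (x - y)"
    by (rule H_lipschitz) blast
  obtain ba where ba: "\<And>e. e \<in> carrier_vec d \<Longrightarrow> enorm (assemble e) \<le> ba * enorm e"
    using assemble_bounded by blast
  obtain bd where bd: "bd > 0" "\<And>y. y \<in> carrier_vec (N * n) \<Longrightarrow> enorm (drift y) \<le> bd * enorm y"
    using drift_bounded by blast
  have "enorm (blended_field v - blended_field w) \<le> bd * (L * ba) * enorm (v - w)"
    if v: "v \<in> carrier_vec d" and w: "w \<in> carrier_vec d" for v w
  proof -
    have "enorm (blended_field v - blended_field w) = enorm (drift (H (assemble v + xs) - H (assemble w + xs)))"
      unfolding blended_field_def by (simp add: drift_diff)
    also have "\<dots> \<le> bd * enorm (H (assemble v + xs) - H (assemble w + xs))" by (rule bd(2)) auto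
    also have "\<dots> \<le> bd * (L * (ba * enorm (v - w)))"
      using bd(1) by (intro mult_left_mono H_assemble_diff L ba v w) auto
    finally show ?thesis by (simp add: mult.assoc)
  qed
  then show ?thesis by blast
qed

section \<open>Exponential decay of the error system\<close>

text \<open>Separates the part of the state that the blended dynamics knows from the disagreement of the
  agents.\<close>

lemma error_state:
  assumes z: "z \<in> carrier_vec dZ" and w: "w \<in> carrier_vec q" and u: "u \<in> carrier_vec dR"
  shows "Zall *\<^sub>v (z + stack N (n - q) zs) + Wall *\<^sub>v (w + ws) + RW *\<^sub>v u
    = (assemble (z @\<^sub>v w) + xs) + RW *\<^sub>v u"
proof -
  let ?a = "Zall *\<^sub>v z" and ?b = "Zall *\<^sub>v stack N (n - q) zs"
  let ?c = "Wall *\<^sub>v w" and ?e = "Wall *\<^sub>v ws"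
  have "Zall *\<^sub>v (z + stack N (n - q) zs) = ?a + ?b"
    by (rule mult_add_distrib_mat_vec[OF coordinate_matrices(1) z stack_carrier])
  moreover have "Wall *\<^sub>v (w + ws) = ?c + ?e"
    by (rule mult_add_distrib_mat_vec[OF coordinate_matrices(2) w equil_carrier(2)])
  moreover have "?a \<in> carrier_vec (N * n)" "?b \<in> carrier_vec (N * n)"
    by (rule mult_mat_vec_carrier[OF coordinate_matrices(1)]; simp add: z)+
  moreover have "?c \<in> carrier_vec (N * n)" "?e \<in> carrier_vec (N * n)"
    by (rule mult_mat_vec_carrier[OF coordinate_matrices(2)]; simp add: w equil_carrier)+
  moreover have "?a + ?b + (?c + ?e) = (?a + ?c) + (?b + ?e)"
    if "?a \<in> carrier_vec (N * n)" "?b \<in> carrier_vec (N * n)" "?c \<in> carrier_vec (N * n)" "?e \<in> carrier_vec (N * n)"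
    using carrier_vecD[OF that(1)] carrier_vecD[OF that(2)] carrier_vecD[OF that(3)] carrier_vecD[OF that(4)]
    by (intro eq_vecI) (simp_all del: dim_mult_mat_vec index_mult_mat_vec)
  ultimately have "Zall *\<^sub>v (z + stack N (n - q) zs) + Wall *\<^sub>v (w + ws) = (?a + ?c) + (?b + ?e)"
    by simp
  also have "\<dots> = assemble (z @\<^sub>v w) + xs"
    unfolding assemble_def x_star_def vec_first_append[OF z] vec_last_append[OF z w] ..
  finally show ?thesis by simp
qed

text \<open>The actual velocity of \<open>e\<close> differs from \<open>blended_field e\<close> by a Lipschitz function of the
  disagreement \<open>RW *\<^sub>v wt\<close>, and the term \<open>p\<close> that drives \<open>wt\<close> vanishes at the equilibrium, so it is bounded by
  the distance from it. All constants are fixed before the gains are chosen.\<close>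

lemma error_exp_bound_of_certificate:
  assumes ges: "blended_ges N n q h Z W zs ws \<mu>" and \<rho>: "0 < \<rho>" "\<rho> < \<mu>"
  shows "\<exists>b c L \<gamma>. 0 < b \<and> 0 < c \<and> 0 < L \<and>
    (\<forall>kP kI \<kappa> \<alpha> \<beta> \<epsilon> r. 0 \<le> kP \<longrightarrow> 0 \<le> kI \<longrightarrow> 0 \<le> \<kappa> \<longrightarrow>
       decay_certificate b c L \<gamma> \<rho> kP kI \<kappa> \<alpha> \<beta> \<epsilon> r \<longrightarrow>
       (\<exists>C. error_bound \<kappa> kP kI C r))"
proof -
  obtain c0 where c0: "\<And>z w. blended_solution N n q h Z W z w \<Longrightarrow>
      exp_bound c0 \<mu> (\<lambda>t. (stack N (n - q) (\<lambda>i. z i t) - stack N (n - q) zs) @\<^sub>v (w t - ws))"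
    using ges unfolding blended_ges_def by blast
  have field_ges: "enorm (y t) \<le> c0 * exp (- \<mu> * t) * enorm (y 0)"
    if y: "has_derivative_traj d y (\<lambda>t. blended_field (y t))" and t: "0 \<le> t" for y t
  proof -
    note bound = c0[OF blended_field_solution(1)[OF y], unfolded exp_bound_def, rule_format, OF t]
    show ?thesis
      using bound unfolding blended_field_solution(2)[OF y t] blended_field_solution(2)[OF y order_refl] .
  qed
  obtain Lf where Lf: "\<And>v w. v \<in> carrier_vec d \<Longrightarrow> w \<in> carrier_vec d \<Longrightarrow>
      enorm (blended_field v - blended_field w) \<le> Lf * enorm (v - w)"
    using blended_field_lipschitz by blast
  have ex: "\<exists>F U C K. (\<forall>v\<in>carrier_vec d. F (interpolate d v) = interpolate d (blended_field v))
      \<and> 0 \<le> K \<and> 0 \<le> C \<and>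
    (\<forall>a. norm a \<le> U a \<and> U a \<le> C * norm a) \<and> (\<forall>a b. U a \<le> U b + K * norm (a - b)) \<and>
    (\<forall>a. \<exists>y. y 0 = a \<and> (\<forall>t\<ge>0. (y has_vector_derivative F (y t)) (at t within {0..})) \<and>
       (\<forall>t\<ge>0. U (y t) \<le> exp (- \<rho> * t) * U a))"
    by (rule vector_field_converse_lyapunov[of d blended_field Lf c0 \<mu> \<rho>, OF blended_field_carrier Lf
        blended_field_zero field_ges \<rho>]) assumption+
  obtain F :: "(real \<Rightarrow>\<^sub>C real) \<Rightarrow> (real \<Rightarrow>\<^sub>C real)" and U C K where
    F: "\<And>v. v \<in> carrier_vec d \<Longrightarrow> F (interpolate d v) = interpolate d (blended_field v)"
    and K: "0 \<le> K" and C: "0 \<le> C" and U1: "\<And>a. norm a \<le> U a" and U2: "\<And>a. U a \<le> C * norm a"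
    and U3: "\<And>a b. U a \<le> U b + K * norm (a - b)"
    and U4: "\<And>a. \<exists>y. y 0 = a \<and> (\<forall>t\<ge>0. (y has_vector_derivative F (y t)) (at t within {0..})) \<and>
       (\<forall>t\<ge>0. U (y t) \<le> exp (- \<rho> * t) * U a)"
    using ex by (elim exE conjE) (metis (no_types, lifting))
  obtain Y b c where Mx: "lyapunov_matrices dR S_mat T_mat F_mat Y b c"
    using setup_lyapunov_matrices by blast
  have bc: "0 < b" "0 < c" using Mx unfolding lyapunov_matrices_def by blast+
  obtain LH where LH: "0 \<le> LH" "\<And>x y. x \<in> carrier_vec (N * n) \<Longrightarrow> y \<in> carrier_vec (N * n) \<Longrightarrow>
      enorm (H x - H y) \<le> LH * enorm (x - y)"
    by (rule H_lipschitz) blast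
  obtain ba where ba: "ba > 0" "\<And>e. e \<in> carrier_vec d \<Longrightarrow> enorm (assemble e) \<le> ba * enorm e"
    using assemble_bounded by blast
  obtain bd where bd: "bd > 0" "\<And>y. y \<in> carrier_vec (N * n) \<Longrightarrow> enorm (drift y) \<le> bd * enorm y"
    using drift_bounded by blast
  obtain bR where bR: "bR > 0" "\<And>v. v \<in> carrier_vec dR \<Longrightarrow> enorm (RW *\<^sub>v v) \<le> bR * enorm v"
    using mult_mat_vec_enorm_bounded[of RW] carrier_matD[OF coordinate_matrices(3)] by auto
  obtain bT where bT: "bT > 0" "\<And>v. v \<in> carrier_vec (N * n) \<Longrightarrow> enorm (RWT *\<^sub>v v) \<le> bT * enorm v"
    using mult_mat_vec_enorm_bounded[of RWT] carrier_matD[OF coordinate_matrices(6)] by auto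
  define \<gamma> where "\<gamma> = real d * bd * LH * bR"
  \<comment> \<open>the summand 1 keeps L positive\<close>
  define L where "L = bT * LH * (ba * real d + bR) + 1"
  have L: "0 < L" unfolding L_def using bT LH ba bR by (intro add_nonneg_pos mult_nonneg_nonneg) auto
  have "\<exists>D. error_bound \<kappa> kP kI D r"
    if gains: "0 \<le> kP" "0 \<le> kI" "0 \<le> \<kappa>" and cert: "decay_certificate b c L (K * \<gamma>) \<rho> kP kI \<kappa> \<alpha> \<beta> \<epsilon> r"
    for kP kI \<kappa> \<alpha> \<beta> \<epsilon> r
  proof -
    have pos: "0 < \<alpha>" "0 < \<beta>" "0 \<le> \<epsilon>" using cert unfolding decay_certificate_def by blast+
    define M where "M = \<alpha> * b + \<beta> + \<epsilon> * b"
    have M: "0 \<le> M" using pos bc by (simp add: M_def)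
    \<comment> \<open>D1 and D2 compare the Lyapunov function with the square of the Euclidean norm of the error\<close>
    define D1 where "D1 = (real d)\<^sup>2 + 4 / (\<alpha> * c) + 4 / \<beta>"
    define D2 where "D2 = C\<^sup>2 * (real d)\<^sup>2 + M"
    have D: "0 \<le> D1" "0 \<le> D2" using pos bc M by (auto simp: D1_def D2_def)
    have "exp_bound (sqrt (D1 * D2)) r (\<lambda>t. z\<delta> t @\<^sub>v w\<delta> t @\<^sub>v wt t @\<^sub>v \<xi>\<delta> t)"
      if sol: "error_solution cpl N n q G E h Z W R zs ws \<kappa> kP kI z\<delta> w\<delta> wt \<xi>\<delta>" for z\<delta> w\<delta> wt \<xi>\<delta>
      unfolding exp_bound_def
    proof (intro allI impI)
      fix t :: real assume t: "0 \<le> t"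
      define x where "x = (\<lambda>t. Zall *\<^sub>v (z\<delta> t + stack N (n - q) zs) +
          Wall *\<^sub>v (w\<delta> t + ws) + RW *\<^sub>v wt t)"
      define p where "p = (\<lambda>t. RWT *\<^sub>v (H (x t) - H xs))"
      have z': "has_derivative_traj dZ z\<delta> (\<lambda>t. ZallT *\<^sub>v H (x t))"
        and w': "has_derivative_traj q w\<delta> (\<lambda>t. (1 / real N) \<cdot>\<^sub>v (WallT *\<^sub>v H (x t)))"
        and wt': "has_derivative_traj dR wt (\<lambda>t. p t - kP \<cdot>\<^sub>v (S_mat *\<^sub>v wt t) - kI \<cdot>\<^sub>v (T_mat *\<^sub>v \<xi>\<delta> t))"
        and xi': "has_derivative_traj dR \<xi>\<delta> (\<lambda>t. \<kappa> \<cdot>\<^sub>v (F_mat *\<^sub>v wt t))"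
        using sol unfolding error_solution_def Let_def x_def p_def by blast+
      have zc: "z\<delta> s \<in> carrier_vec dZ" and wc: "w\<delta> s \<in> carrier_vec q"
        and wtc: "wt s \<in> carrier_vec dR" if "0 \<le> s" for s
        using z' w' wt' that by (auto simp: has_derivative_traj_def)
      define e where "e = (\<lambda>s. z\<delta> s @\<^sub>v w\<delta> s)"
      have ec: "e s \<in> carrier_vec d" if "0 \<le> s" for s using zc[OF that] wc[OF that] by (auto simp: e_def)
      have e': "has_derivative_traj d e (\<lambda>t. drift (H (x t)))"
        unfolding e_def drift_def by (rule has_derivative_traj_append[OF z' w'])
      have xeq: "x s = (assemble (e s) + xs) + RW *\<^sub>v wt s" if "0 \<le> s" for s
        unfolding x_def e_def by (rule error_state[OF zc wc wtc]) (rule that)+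
      have Rw: "RW *\<^sub>v wt s \<in> carrier_vec (N * n)" if "0 \<le> s" for s
        by (rule mult_mat_vec_carrier[OF coordinate_matrices(3) wtc[OF that]])
      have xc: "x s \<in> carrier_vec (N * n)" if "0 \<le> s" for s
        unfolding xeq[OF that] by (intro add_carrier_vec assemble_carrier xs_carrier Rw[OF that])
      have ax: "assemble (e s) + xs \<in> carrier_vec (N * n)" for s by (intro add_carrier_vec) auto
      define ei where "ei = (\<lambda>s. interpolate d (e s))"
      define g where "g = (\<lambda>s. interpolate d (drift (H (x s)) - blended_field (e s)))"
      have ei': "(ei has_vector_derivative F (ei s) + g s) (at s within {0..})" if s: "0 \<le> s" for s
      proof -
        have "(ei has_vector_derivative interpolate d (drift (H (x s)))) (at s within {0..})"
          unfolding ei_def by (rule interpolate_has_vector_derivative[OF e' s])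
        moreover have "interpolate d (drift (H (x s))) = F (ei s) + g s"
          unfolding ei_def g_def F[OF ec[OF s]] by (simp add: interpolate_diff)
        ultimately show ?thesis by simp
      qed
      have g: "norm (g s) \<le> \<gamma> * enorm (wt s)" if s: "0 \<le> s" for s
      proof -
        have dx: "x s - (assemble (e s) + xs) = RW *\<^sub>v wt s"
          unfolding xeq[OF s] by (rule vec_add_diff_left[OF ax Rw[OF s]])
        have "norm (g s) \<le> real d * enorm (drift (H (x s)) - blended_field (e s))"
          unfolding g_def by (rule norm_interpolate_le) simp
        also have "drift (H (x s)) - blended_field (e s) = drift (H (x s) - H (assemble (e s) + xs))"
          unfolding blended_field_def by (simp add: drift_diff)
        also have "enorm (drift (H (x s) - H (assemble (e s) + xs)))
            \<le> bd * enorm (H (x s) - H (assemble (e s) + xs))"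
          by (rule bd(2)) simp
        also have "enorm (H (x s) - H (assemble (e s) + xs)) \<le> LH * enorm (RW *\<^sub>v wt s)"
          using LH(2)[OF xc[OF s] ax[of s]] unfolding dx .
        also have "enorm (RW *\<^sub>v wt s) \<le> bR * enorm (wt s)" by (rule bR(2)[OF wtc[OF s]])
        finally show ?thesis using bd LH by (simp add: \<gamma>_def mult.assoc mult_left_mono)
      qed
      have pc: "p s \<in> carrier_vec dR" for s
        unfolding p_def by (rule mult_mat_vec_carrier[OF coordinate_matrices(6)]) simp
      have pL: "enorm (p s) \<le> L * (norm (ei s) + enorm (wt s))" if s: "0 \<le> s" for s
      proof -
        have dx: "x s - xs = assemble (e s) + RW *\<^sub>v wt s"
          unfolding xeq[OF s] by (rule vec_add_add_diff_mid[OF assemble_carrier Rw[OF s] xs_carrier])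
        have "enorm (e s) \<le> real d * norm (ei s)"
          using enorm_sample_le[of d "ei s"] ec[OF s] by (simp add: ei_def)
        then have es: "ba * enorm (e s) \<le> ba * (real d * norm (ei s))" using ba(1)
            by (intro mult_left_mono) auto
        have "enorm (p s) \<le> bT * enorm (H (x s) - H xs)" unfolding p_def by (rule bT(2)) simp
        also have "enorm (H (x s) - H xs) \<le> LH * enorm (x s - xs)" by (rule LH(2)[OF xc[OF s] xs_carrier])
        also have "enorm (x s - xs) \<le> enorm (assemble (e s)) + enorm (RW *\<^sub>v wt s)"
          unfolding dx by (rule enorm_triangle[OF assemble_carrier Rw[OF s]])
        also have "\<dots> \<le> ba * (real d * norm (ei s)) + bR * enorm (wt s)"
          using ba(2)[OF ec[OF s]] bR(2)[OF wtc[OF s]] es by linarith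
        also have "\<dots> \<le> (ba * real d + bR) * (norm (ei s) + enorm (wt s))"
          using ba(1) bR(1) by (simp add: algebra_simps)
        finally have "enorm (p s) \<le> bT * (LH * ((ba * real d + bR) * (norm (ei s) + enorm (wt s))))"
          using bT LH by (simp add: mult_left_mono)
        also have "\<dots> \<le> L * (norm (ei s) + enorm (wt s))" by (simp add: L_def algebra_simps)
        finally show ?thesis .
      qed
      let ?X = "\<lambda>s. z\<delta> s @\<^sub>v w\<delta> s @\<^sub>v wt s @\<^sub>v \<xi>\<delta> s"
      have X: "(enorm (?X s))\<^sup>2 = (enorm (e s))\<^sup>2 + ((enorm (wt s))\<^sup>2 + (enorm (\<xi>\<delta> s))\<^sup>2)" for s
        by (simp add: e_def enorm_append_square)
      let ?Now = "(norm (ei t))\<^sup>2 + (\<alpha> * c * (enorm (wt t))\<^sup>2 + \<beta> * (enorm (\<xi>\<delta> t))\<^sup>2) / 4"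
      let ?Init = "C\<^sup>2 * (norm (ei 0))\<^sup>2 + M * ((enorm (wt 0))\<^sup>2 + (enorm (\<xi>\<delta> 0))\<^sup>2)"
      have V: "?Now \<le> exp (- 2 * r * t) * ?Init"
        unfolding M_def
        by (rule interconnection_decay[where f = F and e = ei and g = g and w = wt and \<xi> = \<xi>\<delta>
            and p = p and t = t,
            OF U1 U2 U3 K U4 Mx cert gains less_imp_le[OF L] ei' g wt' xi' pc pL t]) assumption+
      have "(enorm (?X t))\<^sup>2 \<le> D1 * ?Now"
      proof -
        have "enorm (e t) \<le> real d * norm (ei t)"
          using enorm_sample_le[of d "ei t"] ec[OF t] by (simp add: ei_def)
        then have "(enorm (e t))\<^sup>2 \<le> (real d * norm (ei t))\<^sup>2" by (intro power_mono) auto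
        then have 1: "(enorm (e t))\<^sup>2 \<le> (real d)\<^sup>2 * (norm (ei t))\<^sup>2" by (simp add: power_mult_distrib)
        let ?A = "(norm (ei t))\<^sup>2" and ?B = "\<alpha> * c * (enorm (wt t))\<^sup>2 / 4" and ?C = "\<beta> * (enorm (\<xi>\<delta> t))\<^sup>2 / 4"
        have nn: "0 \<le> ?A" "0 \<le> ?B" "0 \<le> ?C" using pos bc by auto
        have D1': "(real d)\<^sup>2 \<le> D1" "4 / (\<alpha> * c) \<le> D1" "4 / \<beta> \<le> D1" using pos bc by (auto simp: D1_def)
        have "(enorm (?X t))\<^sup>2 \<le> (real d)\<^sup>2 * ?A + (4 / (\<alpha> * c) * ?B + 4 / \<beta> * ?C)"
          unfolding X using 1 pos bc by simp
        also have "\<dots> \<le> D1 * ?A + (D1 * ?B + D1 * ?C)"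
          by (intro add_mono mult_right_mono D1' nn)
        finally show ?thesis by (simp add: algebra_simps add_divide_distrib)
      qed
      also have "\<dots> \<le> D1 * (exp (- 2 * r * t) * (D2 * (enorm (?X 0))\<^sup>2))"
      proof (intro mult_left_mono[OF _ D(1)] order_trans[OF V] mult_left_mono)
        have "norm (ei 0) \<le> real d * enorm (e 0)"
          unfolding ei_def by (rule norm_interpolate_le[OF ec]) simp
        then have "(norm (ei 0))\<^sup>2 \<le> (real d * enorm (e 0))\<^sup>2" by (intro power_mono) auto
        then have "C\<^sup>2 * (norm (ei 0))\<^sup>2 \<le> C\<^sup>2 * ((real d)\<^sup>2 * (enorm (e 0))\<^sup>2)"
          by (intro mult_left_mono) (auto simp: power_mult_distrib)
        moreover have "0 \<le> M * (enorm (e 0))\<^sup>2" "0 \<le> C\<^sup>2 * (real d)\<^sup>2 * ((enorm (wt 0))\<^sup>2 + (enorm (\<xi>\<delta> 0))\<^sup>2)"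
          using M by auto
        moreover have "D2 * ((enorm (e 0))\<^sup>2 + ((enorm (wt 0))\<^sup>2 + (enorm (\<xi>\<delta> 0))\<^sup>2)) =
            C\<^sup>2 * ((real d)\<^sup>2 * (enorm (e 0))\<^sup>2) + M * ((enorm (wt 0))\<^sup>2 + (enorm (\<xi>\<delta> 0))\<^sup>2) +
            (M * (enorm (e 0))\<^sup>2 + C\<^sup>2 * (real d)\<^sup>2 * ((enorm (wt 0))\<^sup>2 + (enorm (\<xi>\<delta> 0))\<^sup>2))"
          unfolding D2_def by (simp only: algebra_simps)
        ultimately show "?Init \<le> D2 * (enorm (?X 0))\<^sup>2" unfolding X by linarith
      qed simp
      also have "\<dots> = (sqrt (D1 * D2) * exp (- r * t) * enorm (?X 0))\<^sup>2"
      proof -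
        have "(exp (- r * t))\<^sup>2 = exp (- 2 * r * t)" by (simp add: power2_eq_square flip: exp_add)
        then show ?thesis using D by (simp add: power_mult_distrib mult_ac)
      qed
      finally show "enorm (?X t) \<le> sqrt (D1 * D2) * exp (- r * t) * enorm (?X 0)"
        by (rule power2_le_imp_le) (use D in simp)
    qed
    then show ?thesis unfolding error_exp_bound_def by blast
  qed
  note step = this
  show ?thesis
    by (rule exI[of _ b], rule exI[of _ c], rule exI[of _ L], rule exI[of _ "K * \<gamma>"],
        intro conjI allI impI) (fact bc(1), fact bc(2), fact L, rule step)
qed

section \<open>The multi-agent system in error coordinates\<close>

abbreviation Lap :: "real mat" where "Lap \<equiv> laplacian N G"

text \<open>Stacked counterpart of \<open>Lambda_I\<close>, to which \<open>R\<close> compresses it.\<close>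

definition integral_coupling :: "real mat" where
  "integral_coupling = (case cpl of CoupA \<Rightarrow> Lap | CoupB \<Rightarrow> 1\<^sub>m N)"

abbreviation PropM :: "real mat" where "PropM \<equiv> Lap \<otimes>\<^sub>K (E\<^sup>T * E)"

abbreviation IntM :: "real mat" where "IntM \<equiv> integral_coupling \<otimes>\<^sub>K E\<^sup>T"

abbreviation EstM :: "real mat" where "EstM \<equiv> Lap \<otimes>\<^sub>K (gain_K E W * E)"

lemma integral_coupling_carrier [simp]: "integral_coupling \<in> carrier_mat N N"
  by (simp add: integral_coupling_def split: coupling.split)

lemma K_carrier [simp]: "gain_K E W \<in> carrier_mat q q"
  unfolding gain_K_eq using E W by auto

lemma stacked_matrices [simp]:
  "Lap \<otimes>\<^sub>K (E\<^sup>T * E) \<in> carrier_mat (N * n) (N * n)"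
  "integral_coupling \<otimes>\<^sub>K E\<^sup>T \<in> carrier_mat (N * n) (N * q)"
  "Lap \<otimes>\<^sub>K (gain_K E W * E) \<in> carrier_mat (N * q) (N * n)"
  "R\<^sup>T \<otimes>\<^sub>K 1\<^sub>m q \<in> carrier_mat dR (N * q)"
  using E R K_carrier by (auto intro!: kron_carrier mult_carrier_mat[of _ q q])

text \<open>The point \<open>xis kI\<close> is defined through \<open>mat_inverse\<close>, which returns an inverse since \<open>T_mat\<close> is
  invertible; at this point the integral feedback balances the disagreement of the agents' drifts at
  the equilibrium.\<close>

lemma integral_gain_xi_star:
  assumes "0 < kI"
  shows "xis kI \<in> carrier_vec dR"
    and "kI \<cdot>\<^sub>v (T_mat *\<^sub>v xis kI) = RWT *\<^sub>v H xs"
proof -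
  let ?m = "dR"
  have T: "T_mat \<in> carrier_mat ?m ?m" using E W by (intro kron_carrier LI_carrier) auto
  obtain Ti where Ti: "Ti \<in> carrier_mat ?m ?m" "Ti * T_mat = 1\<^sub>m ?m" "T_mat * Ti = 1\<^sub>m ?m"
    by (rule integral_gain_invertible)
  have "T_mat \<in> Units (ring_mat TYPE(real) ?m ())"
    using T Ti unfolding Units_def ring_mat_def by auto
  then have "mat_inverse T_mat \<noteq> None" using mat_inverse(1)[OF T, where b = "()"] by blast
  then obtain B where B: "mat_inverse T_mat = Some B" by blast
  have TB: "T_mat * B = 1\<^sub>m ?m" and Bc: "B \<in> carrier_mat ?m ?m" using mat_inverse(2)[OF T B] by blast+
  define y where "y = RWT *\<^sub>v H xs"
  have y: "y \<in> carrier_vec ?m"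
    unfolding y_def by (rule mult_mat_vec_carrier[OF coordinate_matrices(6)]) simp
  have By: "B *\<^sub>v y \<in> carrier_vec ?m" by (rule mult_mat_vec_carrier[OF Bc y])
  have xi: "xis kI = (1 / kI) \<cdot>\<^sub>v (B *\<^sub>v y)"
    unfolding xi_star_def B y_def by simp
  show "xis kI \<in> carrier_vec ?m" unfolding xi using By by simp
  have "T_mat *\<^sub>v ((1 / kI) \<cdot>\<^sub>v (B *\<^sub>v y)) = (1 / kI) \<cdot>\<^sub>v (T_mat *\<^sub>v (B *\<^sub>v y))"
    by (rule mult_mat_vec[OF T By])
  also have "T_mat *\<^sub>v (B *\<^sub>v y) = y"
    using assoc_mult_mat_vec[OF T Bc y] y by (simp add: TB)
  finally have "kI \<cdot>\<^sub>v (T_mat *\<^sub>v xis kI) = kI \<cdot>\<^sub>v ((1 / kI) \<cdot>\<^sub>v y)"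
    unfolding xi by simp
  then show "kI \<cdot>\<^sub>v (T_mat *\<^sub>v xis kI) = RWT *\<^sub>v H xs"
    unfolding y_def[symmetric] using assms by (simp add: smult_smult_assoc)
qed

lemma stack_control:
  assumes x: "\<And>i. i < N \<Longrightarrow> x i \<in> carrier_vec n" and \<xi>: "\<And>i. i < N \<Longrightarrow> \<xi> i \<in> carrier_vec q"
  shows "i < N \<Longrightarrow> control cpl q G E kP kI (\<lambda>j. E *\<^sub>v x j) \<xi> i \<in> carrier_vec n"
    and "stack N n (\<lambda>i. control cpl q G E kP kI (\<lambda>j. E *\<^sub>v x j) \<xi> i)
      = - (kP \<cdot>\<^sub>v (PropM *\<^sub>v stack N n x)) - kI \<cdot>\<^sub>v (IntM *\<^sub>v stack N q \<xi>)"
proof -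
  have ET: "E\<^sup>T \<in> carrier_mat n q" using E by simp
  have y: "E *\<^sub>v x i \<in> carrier_vec q" if "i < N" for i by (rule mult_mat_vec_carrier[OF E x[OF that]])
  define \<sigma> where "\<sigma> = (\<lambda>v i. finsum_vec TYPE(real) q (\<lambda>j. v j - v i) (nbrs G i))"
  have \<sigma>y: "\<sigma> (\<lambda>j. E *\<^sub>v x j) i \<in> carrier_vec q" and \<sigma>\<xi>: "\<sigma> \<xi> i \<in> carrier_vec q" if "i < N" for i
    unfolding \<sigma>_def using that neighbour_difference_stack(1)[OF G, of "\<lambda>j. E *\<^sub>v x j"] neighbour_difference_stack(1)[OF G, of \<xi>] y \<xi>
    by blast+
  define ui where "ui = (\<lambda>i. case cpl of CoupA \<Rightarrow> kI \<cdot>\<^sub>v (E\<^sup>T *\<^sub>v \<sigma> \<xi> i) | CoupB \<Rightarrow> - (kI \<cdot>\<^sub>v (E\<^sup>T *\<^sub>v \<xi> i)))"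
  have control: "control cpl q G E kP kI (\<lambda>j. E *\<^sub>v x j) \<xi> i = kP \<cdot>\<^sub>v (E\<^sup>T *\<^sub>v \<sigma> (\<lambda>j. E *\<^sub>v x j) i) + ui i" for i
    by (simp add: control_def \<sigma>_def ui_def split: coupling.split)
  have up: "E\<^sup>T *\<^sub>v \<sigma> (\<lambda>j. E *\<^sub>v x j) i \<in> carrier_vec n" if "i < N" for i
    by (rule mult_mat_vec_carrier[OF ET \<sigma>y[OF that]])
  have ui: "ui i \<in> carrier_vec n" if "i < N" for i
    using mult_mat_vec_carrier[OF ET \<sigma>\<xi>[OF that]] mult_mat_vec_carrier[OF ET \<xi>[OF that]]
    by (auto simp: ui_def split: coupling.split)
  show "i < N \<Longrightarrow> control cpl q G E kP kI (\<lambda>j. E *\<^sub>v x j) \<xi> i \<in> carrier_vec n"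
    unfolding control using up ui by auto
  have neg: "A *\<^sub>v (- v) = - (A *\<^sub>v v)" if "A \<in> carrier_mat a b" "v \<in> carrier_vec b"
      for A :: "real mat" and v a b
  proof -
    have "- v = (- 1) \<cdot>\<^sub>v v" by (auto intro!: eq_vecI)
    then have "A *\<^sub>v (- v) = (- 1) \<cdot>\<^sub>v (A *\<^sub>v v)" using mult_mat_vec[OF that] by simp
    then show ?thesis by (auto intro!: eq_vecI)
  qed
  have consensus: "stack N n (\<lambda>i. E\<^sup>T *\<^sub>v \<sigma> v i) = - ((Lap \<otimes>\<^sub>K E\<^sup>T) *\<^sub>v stack N q v)"
    if v: "\<And>i. i < N \<Longrightarrow> v i \<in> carrier_vec q" for v
  proof -
    have Lq: "Lap \<otimes>\<^sub>K 1\<^sub>m q \<in> carrier_mat (N * q) (N * q)" by (intro kron_carrier) auto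
    have "stack N n (\<lambda>i. E\<^sup>T *\<^sub>v \<sigma> v i) = (1\<^sub>m N \<otimes>\<^sub>K E\<^sup>T) *\<^sub>v stack N q (\<sigma> v)"
      by (rule kron_one_mult_stack[OF ET, symmetric])
        (unfold \<sigma>_def, rule neighbour_difference_stack(1)[OF G v])
    also have "stack N q (\<sigma> v) = - ((Lap \<otimes>\<^sub>K 1\<^sub>m q) *\<^sub>v stack N q v)"
      unfolding \<sigma>_def by (rule neighbour_difference_stack(2)[OF G v])
    also have "(1\<^sub>m N \<otimes>\<^sub>K E\<^sup>T) *\<^sub>v (- ((Lap \<otimes>\<^sub>K 1\<^sub>m q) *\<^sub>v stack N q v))
        = - ((1\<^sub>m N \<otimes>\<^sub>K E\<^sup>T) *\<^sub>v ((Lap \<otimes>\<^sub>K 1\<^sub>m q) *\<^sub>v stack N q v))"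
      by (rule neg[OF kron_carrier[OF one_carrier_mat ET] mult_mat_vec_carrier[OF Lq stack_carrier]])
    also have "(1\<^sub>m N \<otimes>\<^sub>K E\<^sup>T) *\<^sub>v ((Lap \<otimes>\<^sub>K 1\<^sub>m q) *\<^sub>v stack N q v) = (Lap \<otimes>\<^sub>K E\<^sup>T) *\<^sub>v stack N q v"
      using ET by (subst kron_mult_vec[OF one_carrier_mat ET laplacian_carrier one_carrier_mat stack_carrier])
        (simp add: left_mult_one_mat[OF laplacian_carrier])
    finally show ?thesis .
  qed
  have P: "stack N n (\<lambda>i. E\<^sup>T *\<^sub>v \<sigma> (\<lambda>j. E *\<^sub>v x j) i) = - (PropM *\<^sub>v stack N n x)"
  proof -
    have "stack N q (\<lambda>j. E *\<^sub>v x j) = (1\<^sub>m N \<otimes>\<^sub>K E) *\<^sub>v stack N n x"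
      by (rule kron_one_mult_stack[OF E x, symmetric])
    moreover have "(Lap \<otimes>\<^sub>K E\<^sup>T) *\<^sub>v ((1\<^sub>m N \<otimes>\<^sub>K E) *\<^sub>v stack N n x) = PropM *\<^sub>v stack N n x"
      by (subst kron_mult_vec[OF laplacian_carrier ET one_carrier_mat E stack_carrier])
        (simp add: right_mult_one_mat[OF laplacian_carrier])
    ultimately show ?thesis using consensus[OF y] by simp
  qed
  have I: "stack N n ui = - (kI \<cdot>\<^sub>v (IntM *\<^sub>v stack N q \<xi>))"
  proof (cases cpl)
    case CoupA
    have "stack N n ui = kI \<cdot>\<^sub>v stack N n (\<lambda>i. E\<^sup>T *\<^sub>v \<sigma> \<xi> i)"
      unfolding ui_def CoupA coupling.case by (rule stack_smult) (rule mult_mat_vec_carrier[OF ET \<sigma>\<xi>])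
    also have "\<dots> = - (kI \<cdot>\<^sub>v ((Lap \<otimes>\<^sub>K E\<^sup>T) *\<^sub>v stack N q \<xi>))"
    proof -
      have "stack N n (\<lambda>i. E\<^sup>T *\<^sub>v \<sigma> \<xi> i) = - ((Lap \<otimes>\<^sub>K E\<^sup>T) *\<^sub>v stack N q \<xi>)"
        by (rule consensus[OF \<xi>])
      then show ?thesis by (auto intro!: eq_vecI)
    qed
    finally show ?thesis unfolding integral_coupling_def using CoupA by simp
  next
    case CoupB
    have "stack N n ui = stack N n (\<lambda>i. (- kI) \<cdot>\<^sub>v (E\<^sup>T *\<^sub>v \<xi> i))"
      unfolding ui_def CoupB coupling.case by (intro stack_cong) (auto intro!: eq_vecI)
    also have "\<dots> = (- kI) \<cdot>\<^sub>v stack N n (\<lambda>i. E\<^sup>T *\<^sub>v \<xi> i)"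
      by (rule stack_smult) (rule mult_mat_vec_carrier[OF ET \<xi>])
    also have "stack N n (\<lambda>i. E\<^sup>T *\<^sub>v \<xi> i) = (1\<^sub>m N \<otimes>\<^sub>K E\<^sup>T) *\<^sub>v stack N q \<xi>"
      by (rule kron_one_mult_stack[OF ET \<xi>, symmetric])
    also have "(- kI) \<cdot>\<^sub>v ((1\<^sub>m N \<otimes>\<^sub>K E\<^sup>T) *\<^sub>v stack N q \<xi>) = - (kI \<cdot>\<^sub>v ((1\<^sub>m N \<otimes>\<^sub>K E\<^sup>T) *\<^sub>v stack N q \<xi>))"
      by (auto intro!: eq_vecI)
    finally show ?thesis unfolding integral_coupling_def using CoupB by simp
  qed
  have "stack N n (\<lambda>i. control cpl q G E kP kI (\<lambda>j. E *\<^sub>v x j) \<xi> i)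
      = stack N n (\<lambda>i. kP \<cdot>\<^sub>v (E\<^sup>T *\<^sub>v \<sigma> (\<lambda>j. E *\<^sub>v x j) i)) + stack N n ui"
    unfolding control using up ui by (intro stack_add) auto
  also have "stack N n (\<lambda>i. kP \<cdot>\<^sub>v (E\<^sup>T *\<^sub>v \<sigma> (\<lambda>j. E *\<^sub>v x j) i))
      = kP \<cdot>\<^sub>v stack N n (\<lambda>i. E\<^sup>T *\<^sub>v \<sigma> (\<lambda>j. E *\<^sub>v x j) i)"
    by (rule stack_smult[OF up])
  also have "kP \<cdot>\<^sub>v stack N n (\<lambda>i. E\<^sup>T *\<^sub>v \<sigma> (\<lambda>j. E *\<^sub>v x j) i) + stack N n ui
      = - (kP \<cdot>\<^sub>v (PropM *\<^sub>v stack N n x)) - kI \<cdot>\<^sub>v (IntM *\<^sub>v stack N q \<xi>)"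
    unfolding P I
  proof -
    have "a \<cdot>\<^sub>v (- v) + - (b \<cdot>\<^sub>v w) = - (a \<cdot>\<^sub>v v) - b \<cdot>\<^sub>v w"
      if "v \<in> carrier_vec k" "w \<in> carrier_vec k" for a b :: real and v w k
      using that by (intro eq_vecI) auto
    then show "kP \<cdot>\<^sub>v - (PropM *\<^sub>v stack N n x) + - (kI \<cdot>\<^sub>v (IntM *\<^sub>v stack N q \<xi>))
      = - (kP \<cdot>\<^sub>v (PropM *\<^sub>v stack N n x)) - kI \<cdot>\<^sub>v (IntM *\<^sub>v stack N q \<xi>)"
      using mult_mat_vec_carrier[OF stacked_matrices(1) stack_carrier]
          mult_mat_vec_carrier[OF stacked_matrices(2) stack_carrier]
      by blast
  qed
  finally show "stack N n (\<lambda>i. control cpl q G E kP kI (\<lambda>j. E *\<^sub>v x j) \<xi> i)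
      = - (kP \<cdot>\<^sub>v (PropM *\<^sub>v stack N n x)) - kI \<cdot>\<^sub>v (IntM *\<^sub>v stack N q \<xi>)" .
qed

lemma mas_stacked_form:
  assumes sol: "mas_solution cpl N n q G E h W \<kappa> kP kI x \<xi>"
  defines "X \<equiv> \<lambda>t. stack N n (\<lambda>i. x i t)" and "\<Xi> \<equiv> \<lambda>t. stack N q (\<lambda>i. \<xi> i t)"
  shows "has_derivative_traj (N * n) X (\<lambda>t. H (X t) - kP \<cdot>\<^sub>v (PropM *\<^sub>v X t)
      - kI \<cdot>\<^sub>v (IntM *\<^sub>v \<Xi> t))"
    and "has_derivative_traj (N * q) \<Xi> (\<lambda>t. \<kappa> \<cdot>\<^sub>v (EstM *\<^sub>v X t))"
    and "cpl = CoupB \<Longrightarrow> ((ones N)\<^sup>T \<otimes>\<^sub>K 1\<^sub>m q) *\<^sub>v \<Xi> 0 = 0\<^sub>v q"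
proof -
  have x': "\<And>i. i < N \<Longrightarrow> has_derivative_traj n (x i)
      (\<lambda>t. h i (x i t) + control cpl q G E kP kI (\<lambda>j. E *\<^sub>v x j t) (\<lambda>j. \<xi> j t) i)"
    and \<xi>': "\<And>i. i < N \<Longrightarrow> has_derivative_traj q (\<xi> i) (\<lambda>t. (- \<kappa>) \<cdot>\<^sub>v (gain_K E W *\<^sub>v
           finsum_vec TYPE(real) q (\<lambda>j. E *\<^sub>v x j t - E *\<^sub>v x i t) (nbrs G i)))"
    and B: "cpl = CoupB \<Longrightarrow> finsum_vec TYPE(real) q (\<lambda>i. \<xi> i 0) {..<N} = 0\<^sub>v q"
    using sol unfolding mas_solution_def by blast+
  have xc: "x i t \<in> carrier_vec n" and \<xi>c: "\<xi> i t \<in> carrier_vec q" if "i < N" "0 \<le> t" for i t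
    using x'[OF that(1)] \<xi>'[OF that(1)] that(2) by (auto simp: has_derivative_traj_def)
  have hx: "h i (x i t) \<in> carrier_vec n" if "i < N" "0 \<le> t" for i t
    using h_carrier xc that by blast
  show "has_derivative_traj (N * n) X (\<lambda>t. H (X t) - kP \<cdot>\<^sub>v (PropM *\<^sub>v X t)
      - kI \<cdot>\<^sub>v (IntM *\<^sub>v \<Xi> t))"
  proof (rule has_derivative_traj_cong)
    show "has_derivative_traj (N * n) X (\<lambda>t. stack N n (\<lambda>i. h i (x i t) +
        control cpl q G E kP kI (\<lambda>j. E *\<^sub>v x j t) (\<lambda>j. \<xi> j t) i))"
      unfolding X_def by (rule has_derivative_traj_stack[OF x'])
    fix t :: real assume t: "0 \<le> t"
    note c = stack_control[of "\<lambda>j. x j t" "\<lambda>j. \<xi> j t", OF xc[OF _ t] \<xi>c[OF _ t]]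
    have "stack N n (\<lambda>i. h i (x i t) + control cpl q G E kP kI (\<lambda>j. E *\<^sub>v x j t) (\<lambda>j. \<xi> j t) i)
      = stack N n (\<lambda>i. h i (x i t)) + stack N n (\<lambda>i. control cpl q G E kP kI (\<lambda>j. E *\<^sub>v x j t) (\<lambda>j. \<xi> j t) i)"
      by (rule stack_add) (rule hx[OF _ t], assumption, rule c(1), assumption+)
    also have "stack N n (\<lambda>i. h i (x i t)) = H (X t)"
      unfolding X_def by (rule H_stack[symmetric]) (rule xc[OF _ t])
    also have "stack N n (\<lambda>i. control cpl q G E kP kI (\<lambda>j. E *\<^sub>v x j t) (\<lambda>j. \<xi> j t) i)
      = - (kP \<cdot>\<^sub>v (PropM *\<^sub>v X t)) - kI \<cdot>\<^sub>v (IntM *\<^sub>v \<Xi> t)"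
      unfolding X_def \<Xi>_def by (rule c(2)) assumption+
    also have "H (X t) + (- (kP \<cdot>\<^sub>v (PropM *\<^sub>v X t)) - kI \<cdot>\<^sub>v (IntM *\<^sub>v \<Xi> t))
      = H (X t) - kP \<cdot>\<^sub>v (PropM *\<^sub>v X t) - kI \<cdot>\<^sub>v (IntM *\<^sub>v \<Xi> t)"
    proof -
      have "a + (- b - c) = a - b - c" if "a \<in> carrier_vec k" "b \<in> carrier_vec k" "c \<in> carrier_vec k"
        for a b c :: "real vec" and k using that by (intro eq_vecI) auto
      moreover have "kP \<cdot>\<^sub>v (PropM *\<^sub>v X t) \<in> carrier_vec (N * n)"
        unfolding X_def by (simp only: smult_carrier_vec) (rule mult_mat_vec_carrier[OF stacked_matrices(1) stack_carrier])
      moreover have "kI \<cdot>\<^sub>v (IntM *\<^sub>v \<Xi> t) \<in> carrier_vec (N * n)"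
        unfolding \<Xi>_def by (simp only: smult_carrier_vec) (rule mult_mat_vec_carrier[OF stacked_matrices(2) stack_carrier])
      ultimately show ?thesis using H_carrier by blast
    qed
    finally show "stack N n (\<lambda>i. h i (x i t) + control cpl q G E kP kI (\<lambda>j. E *\<^sub>v x j t) (\<lambda>j. \<xi> j t) i)
      = H (X t) - kP \<cdot>\<^sub>v (PropM *\<^sub>v X t) - kI \<cdot>\<^sub>v (IntM *\<^sub>v \<Xi> t)" .
  qed (rule refl)
  show "has_derivative_traj (N * q) \<Xi> (\<lambda>t. \<kappa> \<cdot>\<^sub>v (EstM *\<^sub>v X t))"
  proof (rule has_derivative_traj_cong)
    show "has_derivative_traj (N * q) \<Xi> (\<lambda>t. stack N q (\<lambda>i. (- \<kappa>) \<cdot>\<^sub>v (gain_K E W *\<^sub>v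
        finsum_vec TYPE(real) q (\<lambda>j. E *\<^sub>v x j t - E *\<^sub>v x i t) (nbrs G i))))"
      unfolding \<Xi>_def by (rule has_derivative_traj_stack[OF \<xi>'])
    fix t :: real assume t: "0 \<le> t"
    have y: "E *\<^sub>v x i t \<in> carrier_vec q" if "i < N" for i by (rule mult_mat_vec_carrier[OF E xc[OF that t]])
    let ?\<sigma> = "\<lambda>i. finsum_vec TYPE(real) q (\<lambda>j. E *\<^sub>v x j t - E *\<^sub>v x i t) (nbrs G i)"
    have \<sigma>: "?\<sigma> i \<in> carrier_vec q" if "i < N" for i
      using neighbour_difference_stack(1)[OF G, of "\<lambda>j. E *\<^sub>v x j t"] y that by blast
    have Lq: "Lap \<otimes>\<^sub>K 1\<^sub>m q \<in> carrier_mat (N * q) (N * q)" by (intro kron_carrier) auto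
    have KE: "gain_K E W * E \<in> carrier_mat q n" by (rule mult_carrier_mat[OF K_carrier E])
    have "stack N q (\<lambda>i. (- \<kappa>) \<cdot>\<^sub>v (gain_K E W *\<^sub>v ?\<sigma> i)) = (- \<kappa>) \<cdot>\<^sub>v stack N q (\<lambda>i. gain_K E W *\<^sub>v ?\<sigma> i)"
      by (rule stack_smult) (rule mult_mat_vec_carrier[OF K_carrier \<sigma>])
    also have "stack N q (\<lambda>i. gain_K E W *\<^sub>v ?\<sigma> i) = (1\<^sub>m N \<otimes>\<^sub>K gain_K E W) *\<^sub>v stack N q ?\<sigma>"
      by (rule kron_one_mult_stack[OF K_carrier \<sigma>, symmetric])
    also have "stack N q ?\<sigma> = - ((Lap \<otimes>\<^sub>K 1\<^sub>m q) *\<^sub>v stack N q (\<lambda>j. E *\<^sub>v x j t))"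
      by (rule neighbour_difference_stack(2)[OF G y])
    also have "stack N q (\<lambda>j. E *\<^sub>v x j t) = (1\<^sub>m N \<otimes>\<^sub>K E) *\<^sub>v X t"
      unfolding X_def by (rule kron_one_mult_stack[OF E xc[OF _ t], symmetric])
    also have "(Lap \<otimes>\<^sub>K 1\<^sub>m q) *\<^sub>v ((1\<^sub>m N \<otimes>\<^sub>K E) *\<^sub>v X t) = (Lap \<otimes>\<^sub>K E) *\<^sub>v X t"
      unfolding X_def using E
      by (subst kron_mult_vec[OF laplacian_carrier one_carrier_mat one_carrier_mat E stack_carrier])
        (simp add: right_mult_one_mat[OF laplacian_carrier])
    also have "- ((Lap \<otimes>\<^sub>K E) *\<^sub>v X t) = (- 1) \<cdot>\<^sub>v ((Lap \<otimes>\<^sub>K E) *\<^sub>v X t)" by (auto intro!: eq_vecI)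
    also have "(1\<^sub>m N \<otimes>\<^sub>K gain_K E W) *\<^sub>v ((- 1) \<cdot>\<^sub>v ((Lap \<otimes>\<^sub>K E) *\<^sub>v X t))
      = (- 1) \<cdot>\<^sub>v ((1\<^sub>m N \<otimes>\<^sub>K gain_K E W) *\<^sub>v ((Lap \<otimes>\<^sub>K E) *\<^sub>v X t))"
      unfolding X_def
      by (rule mult_mat_vec[OF kron_carrier[OF one_carrier_mat K_carrier]
            mult_mat_vec_carrier[OF kron_carrier[OF laplacian_carrier E] stack_carrier]])
    also have "(1\<^sub>m N \<otimes>\<^sub>K gain_K E W) *\<^sub>v ((Lap \<otimes>\<^sub>K E) *\<^sub>v X t) = EstM *\<^sub>v X t"
      unfolding X_def
      by (subst kron_mult_vec[OF one_carrier_mat K_carrier laplacian_carrier E stack_carrier])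
        (simp add: left_mult_one_mat[OF laplacian_carrier])
    finally show "stack N q (\<lambda>i. (- \<kappa>) \<cdot>\<^sub>v (gain_K E W *\<^sub>v ?\<sigma> i)) = \<kappa> \<cdot>\<^sub>v (EstM *\<^sub>v X t)"
      by (simp add: smult_smult_assoc)
  qed (rule refl)
  assume "cpl = CoupB"
  have "((ones N)\<^sup>T \<otimes>\<^sub>K 1\<^sub>m q) *\<^sub>v \<Xi> 0 = finsum_vec TYPE(real) q (\<lambda>i. 1\<^sub>m q *\<^sub>v \<xi> i 0) {..<N}"
    unfolding \<Xi>_def by (rule ones_transpose_kron_mult_stack[OF one_carrier_mat \<xi>c]) simp_all
  also have "\<dots> = finsum_vec TYPE(real) q (\<lambda>i. \<xi> i 0) {..<N}"
  proof (rule eq_vecI)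
    have c: "(\<lambda>i. 1\<^sub>m q *\<^sub>v \<xi> i 0) \<in> {..<N} \<rightarrow> carrier_vec q" "(\<lambda>i. \<xi> i 0) \<in> {..<N} \<rightarrow> carrier_vec q"
      using \<xi>c by auto
    note d = carrier_vecD[OF finsum_vec_closed[OF c(1)]] carrier_vecD[OF finsum_vec_closed[OF c(2)]]
    show "dim_vec (finsum_vec TYPE(real) q (\<lambda>i. 1\<^sub>m q *\<^sub>v \<xi> i 0) {..<N})
        = dim_vec (finsum_vec TYPE(real) q (\<lambda>i. \<xi> i 0) {..<N})"
      using d by simp
    fix k assume "k < dim_vec (finsum_vec TYPE(real) q (\<lambda>i. \<xi> i 0) {..<N})"
    then have k: "k < q" using d by simp
    show "finsum_vec TYPE(real) q (\<lambda>i. 1\<^sub>m q *\<^sub>v \<xi> i 0) {..<N} $ k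
        = finsum_vec TYPE(real) q (\<lambda>i. \<xi> i 0) {..<N} $ k"
      unfolding index_finsum_vec[OF finite_lessThan k c(1)] index_finsum_vec[OF finite_lessThan k c(2)]
      by (intro sum.cong refl arg_cong[where f = "\<lambda>v. v $ k"] one_mult_mat_vec \<xi>c) auto
  qed
  also have "\<dots> = 0\<^sub>v q" by (rule B) fact
  finally show "((ones N)\<^sup>T \<otimes>\<^sub>K 1\<^sub>m q) *\<^sub>v \<Xi> 0 = 0\<^sub>v q" .
qed

text \<open>\<open>R * R\<^sup>T\<close> is the projection along the vector of ones, which the Laplacian annihilates.\<close>

lemma Lap_R_R: "Lap * (R * R\<^sup>T) = Lap"
proof -
  have RR: "R * R\<^sup>T \<in> carrier_mat N N" using R by (intro mult_carrier_mat[OF R]) simp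
  have OO: "ones N * (ones N)\<^sup>T \<in> carrier_mat N N" by (intro mult_carrier_mat[OF ones_carrier]) simp
  have "Lap * (ones N * (ones N)\<^sup>T) = (Lap * ones N) * (ones N)\<^sup>T"
    by (intro assoc_mult_mat[symmetric, of _ N N _ 1 _ N]) auto
  also have "\<dots> = 0\<^sub>m N N" unfolding laplacian_mult_ones[OF G] by (intro left_mult_zero_mat) simp
  finally have 0: "Lap * ((1 / real N) \<cdot>\<^sub>m (ones N * (ones N)\<^sup>T)) = 0\<^sub>m N N"
    using mult_smult_distrib[OF laplacian_carrier OO] by auto
  have "Lap = Lap * (R * R\<^sup>T + (1 / real N) \<cdot>\<^sub>m (ones N * (ones N)\<^sup>T))"
    unfolding R_split using right_mult_one_mat[OF laplacian_carrier] by simp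
  also have "\<dots> = Lap * (R * R\<^sup>T) + Lap * ((1 / real N) \<cdot>\<^sub>m (ones N * (ones N)\<^sup>T))"
    using OO by (intro mult_add_distrib_mat[OF laplacian_carrier RR]) simp
  also have "\<dots> = Lap * (R * R\<^sup>T)"
    unfolding 0 using mult_carrier_mat[OF laplacian_carrier RR] by (intro right_add_zero_mat)
  finally show ?thesis ..
qed

lemma LP_R: "LP * R\<^sup>T = R\<^sup>T * Lap"
proof -
  have RT: "R\<^sup>T \<in> carrier_mat (N - 1) N" using R by simp
  have RL: "R\<^sup>T * Lap \<in> carrier_mat (N - 1) N" by (rule mult_carrier_mat[OF RT laplacian_carrier])
  have RR: "R * R\<^sup>T \<in> carrier_mat N N" by (rule mult_carrier_mat[OF R RT])
  have "LP * R\<^sup>T = (R\<^sup>T * Lap) * (R * R\<^sup>T)"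
    unfolding Lambda_P_def by (rule assoc_mult_mat[OF RL R RT])
  also have "\<dots> = R\<^sup>T * (Lap * (R * R\<^sup>T))" by (rule assoc_mult_mat[OF RT laplacian_carrier RR])
  finally show ?thesis unfolding Lap_R_R .
qed

lemma LI_R: "LI * R\<^sup>T = R\<^sup>T * integral_coupling"
proof (cases cpl)
  case CoupA
  then show ?thesis using LP_R by (simp add: Lambda_I_def integral_coupling_def[unfolded CoupA])
next
  case CoupB
  have RT: "R\<^sup>T \<in> carrier_mat (N - 1) N" using R by simp
  have "LI = 1\<^sub>m (N - 1)" "integral_coupling = 1\<^sub>m N"
    unfolding Lambda_I_def integral_coupling_def using CoupB by simp_all
  then show ?thesis using left_mult_one_mat[OF RT] right_mult_one_mat[OF RT] by simp
qed

lemma ones_Lap: "(ones N)\<^sup>T * Lap = 0\<^sub>m 1 N"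
proof -
  have "(Lap * ones N)\<^sup>T = (ones N)\<^sup>T * Lap\<^sup>T" by (rule transpose_mult[OF laplacian_carrier ones_carrier])
  then show ?thesis unfolding laplacian_symmetric[OF G] laplacian_mult_ones[OF G] by simp
qed

lemma ZE: "Z\<^sup>T * E\<^sup>T = 0\<^sub>m (n - q) q"
  using transpose_mult[OF E Z] unfolding EZ by simp

text \<open>By \<open>E * W * W\<^sup>T = E\<close>, a product with \<open>E\<close> sees a state only through its \<open>w\<close> coordinates.\<close>

lemma output_identities:
  "Z\<^sup>T * (E\<^sup>T * E) = 0\<^sub>m (n - q) n" "W\<^sup>T * (E\<^sup>T * E) = (W\<^sup>T * E\<^sup>T * E * W) * W\<^sup>T"
  "(gain_K E W * E * W) * W\<^sup>T = gain_K E W * E"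
proof -
  have ET: "E\<^sup>T \<in> carrier_mat n q" and ZT: "Z\<^sup>T \<in> carrier_mat (n - q) n" and WT: "W\<^sup>T \<in> carrier_mat q n"
    using E Z W by auto
  show "Z\<^sup>T * (E\<^sup>T * E) = 0\<^sub>m (n - q) n"
    unfolding assoc_mult_mat[OF ZT ET E, symmetric] ZE by (rule left_mult_zero_mat[OF E])
  have WE': "W\<^sup>T * E\<^sup>T \<in> carrier_mat q q" by (rule mult_carrier_mat[OF WT ET])
  have "(W\<^sup>T * E\<^sup>T * E * W) * W\<^sup>T = (W\<^sup>T * E\<^sup>T * (E * W)) * W\<^sup>T"
    unfolding assoc_mult_mat[OF WE' E W] ..
  also have "\<dots> = W\<^sup>T * E\<^sup>T * (E * W * W\<^sup>T)"
    by (rule assoc_mult_mat[OF WE' mult_carrier_mat[OF E W] WT])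
  also have "\<dots> = W\<^sup>T * (E\<^sup>T * E)" unfolding E_eq by (rule assoc_mult_mat[OF WT ET E])
  finally show "W\<^sup>T * (E\<^sup>T * E) = (W\<^sup>T * E\<^sup>T * E * W) * W\<^sup>T" ..
  have "(gain_K E W * E * W) * W\<^sup>T = (gain_K E W * (E * W)) * W\<^sup>T"
    unfolding assoc_mult_mat[OF K_carrier E W] ..
  also have "\<dots> = gain_K E W * (E * W * W\<^sup>T)"
    by (rule assoc_mult_mat[OF K_carrier mult_carrier_mat[OF E W] WT])
  finally show "(gain_K E W * E * W) * W\<^sup>T = gain_K E W * E" unfolding E_eq .
qed

text \<open>The feedback acts through \<open>E\<^sup>T\<close>, whose range is orthogonal to the columns of \<open>Z\<close>; the Laplacian
  annihilates the mean. Hence only the disagreement is affected. In case (B) the integral feedback is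
  not a difference between agents, and the mean of \<open>\<xi>\<close> has to vanish for this to hold.\<close>

lemma coupling_in_coordinates:
  assumes X: "X \<in> carrier_vec (N * n)" and \<Xi>: "\<Xi> \<in> carrier_vec (N * q)"
  shows "ZallT *\<^sub>v (PropM *\<^sub>v X) = 0\<^sub>v dZ"
    and "ZallT *\<^sub>v (IntM *\<^sub>v \<Xi>) = 0\<^sub>v dZ"
    and "WallT *\<^sub>v (PropM *\<^sub>v X) = 0\<^sub>v q"
    and "(cpl = CoupB \<Longrightarrow> ((ones N)\<^sup>T \<otimes>\<^sub>K 1\<^sub>m q) *\<^sub>v \<Xi> = 0\<^sub>v q) \<Longrightarrow>
      WallT *\<^sub>v (IntM *\<^sub>v \<Xi>) = 0\<^sub>v q"
    and "RWT *\<^sub>v (PropM *\<^sub>v X) = S_mat *\<^sub>v (RWT *\<^sub>v X)"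
    and "RWT *\<^sub>v (IntM *\<^sub>v \<Xi>) = T_mat *\<^sub>v (RqT *\<^sub>v \<Xi>)"
    and "RqT *\<^sub>v (EstM *\<^sub>v X) = F_mat *\<^sub>v (RWT *\<^sub>v X)"
    and "((ones N)\<^sup>T \<otimes>\<^sub>K 1\<^sub>m q) *\<^sub>v (EstM *\<^sub>v X) = 0\<^sub>v q"
proof -
  have ET: "E\<^sup>T \<in> carrier_mat n q" and ZT: "Z\<^sup>T \<in> carrier_mat (n - q) n" and WT: "W\<^sup>T \<in> carrier_mat q n"
    and RT: "R\<^sup>T \<in> carrier_mat (N - 1) N" and OT: "(ones N)\<^sup>T \<in> carrier_mat 1 N"
        and Lc: "Lap \<in> carrier_mat N N"
    using E Z W R by auto
  have EE: "E\<^sup>T * E \<in> carrier_mat n n" by (rule mult_carrier_mat[OF ET E])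
  have KE: "gain_K E W * E \<in> carrier_mat q n" by (rule mult_carrier_mat[OF K_carrier E])
  have WE': "W\<^sup>T * E\<^sup>T \<in> carrier_mat q q" by (rule mult_carrier_mat[OF WT ET])
  have A: "W\<^sup>T * E\<^sup>T * E * W \<in> carrier_mat q q"
    by (rule mult_carrier_mat[OF mult_carrier_mat[OF WE' E] W])
  have KEW: "gain_K E W * E * W \<in> carrier_mat q q" by (rule mult_carrier_mat[OF KE W])
  have IC: "integral_coupling \<in> carrier_mat N N" by simp
  have I1: "1\<^sub>m q \<in> carrier_mat q q" by simp
  have WEE: "W\<^sup>T * (E\<^sup>T * E) \<in> carrier_mat q n" by (rule mult_carrier_mat[OF WT EE])
  have KE1: "1\<^sub>m q * (gain_K E W * E) \<in> carrier_mat q n" by (rule mult_carrier_mat[OF I1 KE])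
  have LL: "1\<^sub>m N * Lap \<in> carrier_mat N N" "1\<^sub>m N * integral_coupling \<in> carrier_mat N N"
    by (rule mult_carrier_mat[OF one_carrier_mat Lc] mult_carrier_mat[OF one_carrier_mat IC])+
  show "ZallT *\<^sub>v (PropM *\<^sub>v X) = 0\<^sub>v dZ"
    unfolding kron_mult_vec[OF one_carrier_mat ZT Lc EE X] output_identities(1) kron_zero(2)[OF LL(1)]
    by (rule zero_mat_mult_vec[OF X])
  show "ZallT *\<^sub>v (IntM *\<^sub>v \<Xi>) = 0\<^sub>v dZ"
    unfolding kron_mult_vec[OF one_carrier_mat ZT IC ET \<Xi>] ZE kron_zero(2)[OF LL(2)]
    by (rule zero_mat_mult_vec[OF \<Xi>])
  show w1: "WallT *\<^sub>v (PropM *\<^sub>v X) = 0\<^sub>v q"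
    unfolding kron_mult_vec[OF OT WT Lc EE X] ones_Lap kron_zero(1)[OF WEE] zero_mat_mult_vec[OF X] by simp
  show "WallT *\<^sub>v (IntM *\<^sub>v \<Xi>) = 0\<^sub>v q"
    if B: "cpl = CoupB \<Longrightarrow> ((ones N)\<^sup>T \<otimes>\<^sub>K 1\<^sub>m q) *\<^sub>v \<Xi> = 0\<^sub>v q"
  proof (cases cpl)
    case CoupA
    then have ic: "integral_coupling = Lap" unfolding integral_coupling_def by simp
    show ?thesis
      unfolding ic kron_mult_vec[OF OT WT Lc ET \<Xi>] ones_Lap kron_zero(1)[OF WE'] zero_mat_mult_vec[OF \<Xi>] by simp
  next
    case CoupB
    then have ic: "integral_coupling = 1\<^sub>m N" unfolding integral_coupling_def by simp
    have "WallT *\<^sub>v ((1\<^sub>m N \<otimes>\<^sub>K E\<^sup>T) *\<^sub>v \<Xi>)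
      = (1\<^sub>m 1 \<otimes>\<^sub>K (W\<^sup>T * E\<^sup>T)) *\<^sub>v (((ones N)\<^sup>T \<otimes>\<^sub>K 1\<^sub>m q) *\<^sub>v \<Xi>)"
      unfolding kron_mult_vec[OF OT WT one_carrier_mat ET \<Xi>] kron_mult_vec[OF one_carrier_mat WE' OT I1 \<Xi>]
        left_mult_one_mat[OF OT] right_mult_one_mat[OF OT] right_mult_one_mat[OF WE'] ..
    also have "\<dots> = 0\<^sub>v q"
    proof -
      have "1\<^sub>m 1 \<otimes>\<^sub>K (W\<^sup>T * E\<^sup>T) \<in> carrier_mat (1 * q) (1 * q)" by (rule kron_carrier[OF one_carrier_mat WE'])
      then show ?thesis unfolding B[OF CoupB] by (auto intro!: eq_vecI)
    qed
    finally show ?thesis unfolding ic .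
  qed
  show "RWT *\<^sub>v (PropM *\<^sub>v X) = S_mat *\<^sub>v (RWT *\<^sub>v X)"
    unfolding kron_mult_vec[OF RT WT Lc EE X] kron_mult_vec[OF LP_carrier A RT WT X] LP_R output_identities(2) ..
  show "RWT *\<^sub>v (IntM *\<^sub>v \<Xi>) = T_mat *\<^sub>v (RqT *\<^sub>v \<Xi>)"
    unfolding kron_mult_vec[OF RT WT IC ET \<Xi>] kron_mult_vec[OF LI_carrier WE' RT I1 \<Xi>] LI_R
      right_mult_one_mat[OF WE'] ..
  show "RqT *\<^sub>v (EstM *\<^sub>v X) = F_mat *\<^sub>v (RWT *\<^sub>v X)"
    unfolding kron_mult_vec[OF RT I1 Lc KE X] kron_mult_vec[OF LP_carrier KEW RT WT X] LP_R output_identities(3)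
      left_mult_one_mat[OF KE] ..
  show "((ones N)\<^sup>T \<otimes>\<^sub>K 1\<^sub>m q) *\<^sub>v (EstM *\<^sub>v X) = 0\<^sub>v q"
    unfolding kron_mult_vec[OF OT I1 Lc KE X] ones_Lap kron_zero(1)[OF KE1] zero_mat_mult_vec[OF X] by simp
qed

text \<open>Combines the two resolutions of the identity \<open>Z * Z\<^sup>T + W * W\<^sup>T = 1\<^sub>m n\<close> and
  \<open>R * R\<^sup>T + (1 / N) \<cdot>\<^sub>m (ones N * (ones N)\<^sup>T) = 1\<^sub>m N\<close>: the \<open>w\<close> part is split further into mean and
  disagreement.\<close>

lemma reconstruct:
  assumes X: "X \<in> carrier_vec (N * n)"
  shows "Zall *\<^sub>v (ZallT *\<^sub>v X)
    + Wall *\<^sub>v ((1 / real N) \<cdot>\<^sub>v (WallT *\<^sub>v X))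
    + RW *\<^sub>v (RWT *\<^sub>v X) = X"
proof -
  have ZT: "Z\<^sup>T \<in> carrier_mat (n - q) n" and WT: "W\<^sup>T \<in> carrier_mat q n"
    and RT: "R\<^sup>T \<in> carrier_mat (N - 1) N" and OT: "(ones N)\<^sup>T \<in> carrier_mat 1 N"
    using Z W R by auto
  have ZZ: "Z * Z\<^sup>T \<in> carrier_mat n n" and WW: "W * W\<^sup>T \<in> carrier_mat n n"
    and RR: "R * R\<^sup>T \<in> carrier_mat N N" and OO: "ones N * (ones N)\<^sup>T \<in> carrier_mat N N"
    by (rule mult_carrier_mat[OF Z ZT] mult_carrier_mat[OF W WT] mult_carrier_mat[OF R RT]
        mult_carrier_mat[OF ones_carrier OT])+
  let ?O = "(1 / real N) \<cdot>\<^sub>m (ones N * (ones N)\<^sup>T)"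
  have Oc: "?O \<in> carrier_mat N N" using OO by simp
  let ?z = "(1\<^sub>m N \<otimes>\<^sub>K (Z * Z\<^sup>T)) *\<^sub>v X" and ?o = "(?O \<otimes>\<^sub>K (W * W\<^sup>T)) *\<^sub>v X"
    and ?r = "((R * R\<^sup>T) \<otimes>\<^sub>K (W * W\<^sup>T)) *\<^sub>v X"
  have kc: "1\<^sub>m N \<otimes>\<^sub>K (Z * Z\<^sup>T) \<in> carrier_mat (N * n) (N * n)" "?O \<otimes>\<^sub>K (W * W\<^sup>T) \<in> carrier_mat (N * n) (N * n)"
    "(R * R\<^sup>T) \<otimes>\<^sub>K (W * W\<^sup>T) \<in> carrier_mat (N * n) (N * n)" "1\<^sub>m N \<otimes>\<^sub>K (W * W\<^sup>T) \<in> carrier_mat (N * n) (N * n)"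
    "(ones N * (ones N)\<^sup>T) \<otimes>\<^sub>K (W * W\<^sup>T) \<in> carrier_mat (N * n) (N * n)"
    by (rule kron_carrier; fact one_carrier_mat ZZ Oc WW RR OO)+
  have 1: "Zall *\<^sub>v (ZallT *\<^sub>v X) = ?z"
    unfolding kron_mult_vec[OF one_carrier_mat Z one_carrier_mat ZT X]
    by (simp only: left_mult_one_mat[OF one_carrier_mat])
  have 2: "Wall *\<^sub>v ((1 / real N) \<cdot>\<^sub>v (WallT *\<^sub>v X)) = ?o"
  proof -
    have "Wall *\<^sub>v ((1 / real N) \<cdot>\<^sub>v (WallT *\<^sub>v X))
      = (1 / real N) \<cdot>\<^sub>v (Wall *\<^sub>v (WallT *\<^sub>v X))"
      by (rule mult_mat_vec[OF coordinate_matrices(2) mult_mat_vec_carrier[OF coordinate_matrices(5) X]])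
    also have "Wall *\<^sub>v (WallT *\<^sub>v X)
      = ((ones N * (ones N)\<^sup>T) \<otimes>\<^sub>K (W * W\<^sup>T)) *\<^sub>v X"
      by (rule kron_mult_vec[OF ones_carrier W OT WT X])
    also have "(1 / real N) \<cdot>\<^sub>v (((ones N * (ones N)\<^sup>T) \<otimes>\<^sub>K (W * W\<^sup>T)) *\<^sub>v X) = ?o"
      unfolding kron_smult_left
      by (rule smult_mat_mult_vec[symmetric]) (use carrier_vecD[OF X] carrier_matD[OF kc(5)] in simp)
    finally show ?thesis .
  qed
  have 3: "RW *\<^sub>v (RWT *\<^sub>v X) = ?r"
    by (rule kron_mult_vec[OF R W RT WT X])
  have zc: "?z \<in> carrier_vec (N * n)" and oc: "?o \<in> carrier_vec (N * n)" and rc: "?r \<in> carrier_vec (N * n)"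
    by (rule mult_mat_vec_carrier[OF kc(1) X] mult_mat_vec_carrier[OF kc(2) X]
        mult_mat_vec_carrier[OF kc(3) X])+
  have "?r + ?o = ((R * R\<^sup>T) \<otimes>\<^sub>K (W * W\<^sup>T) + ?O \<otimes>\<^sub>K (W * W\<^sup>T)) *\<^sub>v X"
    by (rule add_mult_distrib_mat_vec[OF kc(3) kc(2) X, symmetric])
  also have "\<dots> = (1\<^sub>m N \<otimes>\<^sub>K (W * W\<^sup>T)) *\<^sub>v X"
    unfolding kron_add_left[OF RR Oc WW, symmetric] R_split ..
  finally have ro: "?r + ?o = (1\<^sub>m N \<otimes>\<^sub>K (W * W\<^sup>T)) *\<^sub>v X" .
  have "?z + ?o + ?r = ?z + (?r + ?o)"
    unfolding assoc_add_vec[OF zc oc rc] comm_add_vec[OF oc rc] ..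
  also have "\<dots> = (1\<^sub>m N \<otimes>\<^sub>K (Z * Z\<^sup>T) + 1\<^sub>m N \<otimes>\<^sub>K (W * W\<^sup>T)) *\<^sub>v X"
    unfolding ro by (rule add_mult_distrib_mat_vec[OF kc(1) kc(4) X, symmetric])
  also have "\<dots> = X"
    unfolding kron_add_right[OF one_carrier_mat ZZ WW, symmetric] ZW_split kron_one
        by (rule one_mult_mat_vec[OF X])
  finally show ?thesis unfolding 1 2 3 .
qed

text \<open>The change of coordinates is linear, so it can be applied to the stacked equations term by term.
  Shifting \<open>\<xi>\<close> by \<open>xis kI\<close> replaces \<open>H (X t)\<close> by \<open>H (X t) - H xs\<close> in the equation of the
  disagreement.\<close>

lemma mas_solution_error_coords:
  assumes sol: "mas_solution cpl N n q G E h W \<kappa> kP kI x \<xi>" and kI: "0 < kI"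
  defines "X \<equiv> \<lambda>t. stack N n (\<lambda>i. x i t)" and "\<Xi> \<equiv> \<lambda>t. stack N q (\<lambda>i. \<xi> i t)"
  defines "z\<delta> \<equiv> \<lambda>t. ZallT *\<^sub>v X t - stack N (n - q) zs"
    and "w\<delta> \<equiv> \<lambda>t. (1 / real N) \<cdot>\<^sub>v (WallT *\<^sub>v X t) - ws"
    and "wt \<equiv> \<lambda>t. RWT *\<^sub>v X t"
    and "\<xi>\<delta> \<equiv> \<lambda>t. RqT *\<^sub>v \<Xi> t - xis kI"
  shows "error_solution cpl N n q G E h Z W R zs ws \<kappa> kP kI z\<delta> w\<delta> wt \<xi>\<delta>"
    and "0 \<le> t \<Longrightarrow> error_coords cpl N n q G E h Z W R zs ws kI x \<xi> t = z\<delta> t @\<^sub>v w\<delta> t @\<^sub>v wt t @\<^sub>v \<xi>\<delta> t"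
    and "0 \<le> t \<Longrightarrow> X t - xs = assemble (z\<delta> t @\<^sub>v w\<delta> t) + RW *\<^sub>v wt t"
proof -
  have form: "has_derivative_traj (N * n) X (\<lambda>t. H (X t) - kP \<cdot>\<^sub>v (PropM *\<^sub>v X t)
      - kI \<cdot>\<^sub>v (IntM *\<^sub>v \<Xi> t))"
    "has_derivative_traj (N * q) \<Xi> (\<lambda>t. \<kappa> \<cdot>\<^sub>v (EstM *\<^sub>v X t))"
    "cpl = CoupB \<Longrightarrow> ((ones N)\<^sup>T \<otimes>\<^sub>K 1\<^sub>m q) *\<^sub>v \<Xi> 0 = 0\<^sub>v q"
    unfolding X_def \<Xi>_def by (rule mas_stacked_form[OF sol], assumption?)+
  let ?xi = "xis kI"
  note xi = integral_gain_xi_star[OF kI]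
  have Xc: "X t \<in> carrier_vec (N * n)" and \<Xi>c: "\<Xi> t \<in> carrier_vec (N * q)" for t
    by (simp_all add: X_def \<Xi>_def)
  have c1: "PropM *\<^sub>v X t \<in> carrier_vec (N * n)"
    and c2: "IntM *\<^sub>v \<Xi> t \<in> carrier_vec (N * n)"
    and c3: "EstM *\<^sub>v X t \<in> carrier_vec (N * q)" for t
    by (rule mult_mat_vec_carrier[OF stacked_matrices(1) Xc] mult_mat_vec_carrier[OF stacked_matrices(2) \<Xi>c]
        mult_mat_vec_carrier[OF stacked_matrices(3) Xc])+
  have image: "A *\<^sub>v (H (X t) - kP \<cdot>\<^sub>v (PropM *\<^sub>v X t) - kI \<cdot>\<^sub>v (IntM *\<^sub>v \<Xi> t))
    = A *\<^sub>v H (X t) - kP \<cdot>\<^sub>v (A *\<^sub>v (PropM *\<^sub>v X t)) - kI \<cdot>\<^sub>v (A *\<^sub>v (IntM *\<^sub>v \<Xi> t))"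
    if "A \<in> carrier_mat k (N * n)" for A k t
    by (rule mult_mat_vec_combination[OF that H_carrier c1 c2])
  note id = coupling_in_coordinates[OF Xc \<Xi>c]
  note zH = mult_mat_vec_carrier[OF coordinate_matrices(4) H_carrier]
  note wH = mult_mat_vec_carrier[OF coordinate_matrices(5) H_carrier]
  note zX = mult_mat_vec_carrier[OF coordinate_matrices(4) Xc]
  note wX = mult_mat_vec_carrier[OF coordinate_matrices(5) Xc]
  note rX = mult_mat_vec_carrier[OF coordinate_matrices(6) Xc]
  have z\<delta>c: "z\<delta> t \<in> carrier_vec dZ" and w\<delta>c: "w\<delta> t \<in> carrier_vec q"
    and wtc: "wt t \<in> carrier_vec dR" for t
    using zX[of t] wX[of t] rX[of t] equil_carrier(2) by (auto simp: z\<delta>_def w\<delta>_def wt_def)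
  have O1: "(ones N)\<^sup>T \<otimes>\<^sub>K 1\<^sub>m q \<in> carrier_mat q (N * q)"
  proof -
    have "(ones N)\<^sup>T \<otimes>\<^sub>K 1\<^sub>m q \<in> carrier_mat (1 * q) (N * q)" by (rule kron_carrier) auto
    then show ?thesis by simp
  qed
  \<comment> \<open>the mean of \<xi> is conserved, as the Laplacian has zero column sums\<close>
  have mean: "((ones N)\<^sup>T \<otimes>\<^sub>K 1\<^sub>m q) *\<^sub>v \<Xi> t = 0\<^sub>v q" if B: "cpl = CoupB" and t: "0 \<le> t" for t
  proof -
    have deriv: "has_derivative_traj q (\<lambda>t. ((ones N)\<^sup>T \<otimes>\<^sub>K 1\<^sub>m q) *\<^sub>v \<Xi> t)
        (\<lambda>t. ((ones N)\<^sup>T \<otimes>\<^sub>K 1\<^sub>m q) *\<^sub>v (\<kappa> \<cdot>\<^sub>v (EstM *\<^sub>v X t)))"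
      by (rule has_derivative_traj_mult_mat[OF form(2) O1])
    have "has_derivative_traj q (\<lambda>t. ((ones N)\<^sup>T \<otimes>\<^sub>K 1\<^sub>m q) *\<^sub>v \<Xi> t) (\<lambda>t. 0\<^sub>v q)"
    proof -
      have "\<kappa> \<cdot>\<^sub>v 0\<^sub>v q = 0\<^sub>v q" by (auto intro!: eq_vecI)
      with deriv show ?thesis unfolding mult_mat_vec[OF O1 c3] id(8) by simp
    qed
    from has_derivative_traj_zero_const[OF this t] show ?thesis using form(3)[OF B] by simp
  qed
  have recon: "Zall *\<^sub>v (z\<delta> t + stack N (n - q) zs) + Wall *\<^sub>v (w\<delta> t + ws) + RW *\<^sub>v wt t = X t" for t
  proof -
    have "z\<delta> t + stack N (n - q) zs = ZallT *\<^sub>v X t"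
      unfolding z\<delta>_def using carrier_vecD[OF zX] by (intro eq_vecI) auto
    moreover have "w\<delta> t + ws = (1 / real N) \<cdot>\<^sub>v (WallT *\<^sub>v X t)"
      unfolding w\<delta>_def using carrier_vecD[OF wX] carrier_vecD[OF equil_carrier(2)] by (intro eq_vecI) auto
    ultimately show ?thesis unfolding wt_def using reconstruct[OF Xc] by simp
  qed
  have z': "has_derivative_traj dZ z\<delta> (\<lambda>t. ZallT *\<^sub>v H (X t))"
  proof -
    have "has_derivative_traj dZ z\<delta> (\<lambda>t. ZallT *\<^sub>v (H (X t)
        - kP \<cdot>\<^sub>v (PropM *\<^sub>v X t) - kI \<cdot>\<^sub>v (IntM *\<^sub>v \<Xi> t)))"
      unfolding z\<delta>_def
      by (rule has_derivative_traj_minus_const[OF has_derivative_traj_mult_mat[OF form(1) coordinate_matrices(4)] stack_carrier])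
    then show ?thesis
      by (rule has_derivative_traj_cong[OF _ refl])
        (use carrier_vecD[OF zH] in \<open>auto simp: image[OF coordinate_matrices(4)] id(1,2) intro!: eq_vecI\<close>)
  qed
  have w': "has_derivative_traj q w\<delta> (\<lambda>t. (1 / real N) \<cdot>\<^sub>v (WallT *\<^sub>v H (X t)))"
  proof -
    let ?O = "(1 / real N) \<cdot>\<^sub>m WallT"
    have Oc: "?O \<in> carrier_mat q (N * n)" using coordinate_matrices(5) by simp
    have Ov: "?O *\<^sub>v v = (1 / real N) \<cdot>\<^sub>v (WallT *\<^sub>v v)" if "v \<in> carrier_vec (N * n)" for v
      by (rule smult_mat_mult_vec) (use that carrier_matD[OF coordinate_matrices(5)] in simp)
    have "has_derivative_traj q (\<lambda>t. ?O *\<^sub>v X t - ws) (\<lambda>t. ?O *\<^sub>v (H (X t)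
        - kP \<cdot>\<^sub>v (PropM *\<^sub>v X t) - kI \<cdot>\<^sub>v (IntM *\<^sub>v \<Xi> t)))"
      by (rule has_derivative_traj_minus_const[OF has_derivative_traj_mult_mat[OF form(1) Oc] equil_carrier(2)])
    then show ?thesis
    proof (rule has_derivative_traj_cong)
      fix t :: real assume t: "0 \<le> t"
      show "?O *\<^sub>v X t - ws = w\<delta> t" unfolding w\<delta>_def Ov[OF Xc] ..
      have w2: "WallT *\<^sub>v (IntM *\<^sub>v \<Xi> t) = 0\<^sub>v q"
        by (rule id(4), rule mean[OF _ t])
      have "?O *\<^sub>v (PropM *\<^sub>v X t) = 0\<^sub>v q" "?O *\<^sub>v (IntM *\<^sub>v \<Xi> t) = 0\<^sub>v q"
        unfolding Ov[OF c1] Ov[OF c2] id(3) w2 by (auto intro!: eq_vecI)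
      then show "?O *\<^sub>v (H (X t) - kP \<cdot>\<^sub>v (PropM *\<^sub>v X t) - kI \<cdot>\<^sub>v (IntM *\<^sub>v \<Xi> t))
        = (1 / real N) \<cdot>\<^sub>v (WallT *\<^sub>v H (X t))"
        unfolding image[OF Oc] Ov[OF H_carrier] using carrier_vecD[OF wH] by (auto intro!: eq_vecI)
    qed
  qed
  have T: "T_mat \<in> carrier_mat dR dR" using E W by (intro kron_carrier LI_carrier) auto
  have rXi: "RqT *\<^sub>v \<Xi> t \<in> carrier_vec dR" for t
    by (rule mult_mat_vec_carrier[OF stacked_matrices(4) \<Xi>c])
  have wt': "has_derivative_traj dR wt (\<lambda>t. RWT *\<^sub>v (H (X t) - H xs)
      - kP \<cdot>\<^sub>v (S_mat *\<^sub>v wt t) - kI \<cdot>\<^sub>v (T_mat *\<^sub>v \<xi>\<delta> t))"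
  proof -
    have "has_derivative_traj dR wt (\<lambda>t. RWT *\<^sub>v (H (X t)
        - kP \<cdot>\<^sub>v (PropM *\<^sub>v X t) - kI \<cdot>\<^sub>v (IntM *\<^sub>v \<Xi> t)))"
      unfolding wt_def by (rule has_derivative_traj_mult_mat[OF form(1) coordinate_matrices(6)])
    then show ?thesis
    proof (rule has_derivative_traj_cong[OF _ refl])
      fix t :: real
      let ?a = "RWT *\<^sub>v H (X t)" and ?b = "RWT *\<^sub>v H xs"
      let ?s = "S_mat *\<^sub>v wt t" and ?u = "T_mat *\<^sub>v (RqT *\<^sub>v \<Xi> t)" and ?v = "T_mat *\<^sub>v ?xi"
      have rH: "?a \<in> carrier_vec dR" "?b \<in> carrier_vec dR"
        by (rule mult_mat_vec_carrier[OF coordinate_matrices(6) H_carrier])+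
      have tc: "?u \<in> carrier_vec dR" "?v \<in> carrier_vec dR"
        by (rule mult_mat_vec_carrier[OF T rXi] mult_mat_vec_carrier[OF T xi(1)])+
      have sc: "?s \<in> carrier_vec dR"
        unfolding wt_def id(5)[symmetric] by (rule mult_mat_vec_carrier[OF coordinate_matrices(6) c1])
      have 1: "RWT *\<^sub>v (H (X t) - H xs) = ?a - ?b"
        by (rule mult_minus_distrib_mat_vec[OF coordinate_matrices(6) H_carrier H_carrier])
      have 2: "T_mat *\<^sub>v \<xi>\<delta> t = ?u - ?v"
        unfolding \<xi>\<delta>_def by (rule mult_minus_distrib_mat_vec[OF T rXi xi(1)])
      have "a - k \<cdot>\<^sub>v s - l \<cdot>\<^sub>v u = (a - l \<cdot>\<^sub>v v) - k \<cdot>\<^sub>v s - l \<cdot>\<^sub>v (u - v)"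
        if "a \<in> carrier_vec m" "s \<in> carrier_vec m" "u \<in> carrier_vec m" "v \<in> carrier_vec m"
        for a s u v :: "real vec" and k l m
        using that by (intro eq_vecI) (auto simp: algebra_simps)
      from this[OF rH(1) sc tc(1) tc(2), of kP kI]
      have "?a - kP \<cdot>\<^sub>v ?s - kI \<cdot>\<^sub>v ?u = (?a - ?b) - kP \<cdot>\<^sub>v ?s - kI \<cdot>\<^sub>v (?u - ?v)" unfolding xi(2) .
      then show "RWT *\<^sub>v (H (X t) - kP \<cdot>\<^sub>v (PropM *\<^sub>v X t)
          - kI \<cdot>\<^sub>v (IntM *\<^sub>v \<Xi> t))
        = RWT *\<^sub>v (H (X t) - H xs) - kP \<cdot>\<^sub>v (S_mat *\<^sub>v wt t) - kI \<cdot>\<^sub>v (T_mat *\<^sub>v \<xi>\<delta> t)"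
        unfolding image[OF coordinate_matrices(6)] id(5) id(6) 1 2 wt_def .
    qed
  qed
  have xi': "has_derivative_traj dR \<xi>\<delta> (\<lambda>t. \<kappa> \<cdot>\<^sub>v (F_mat *\<^sub>v wt t))"
  proof -
    have "has_derivative_traj dR \<xi>\<delta>
        (\<lambda>t. RqT *\<^sub>v (\<kappa> \<cdot>\<^sub>v (EstM *\<^sub>v X t)))"
      unfolding \<xi>\<delta>_def
      by (rule has_derivative_traj_minus_const[OF has_derivative_traj_mult_mat[OF form(2) stacked_matrices(4)] xi(1)])
    then show ?thesis unfolding mult_mat_vec[OF stacked_matrices(4) c3] id(7) wt_def .
  qed
  show "error_solution cpl N n q G E h Z W R zs ws \<kappa> kP kI z\<delta> w\<delta> wt \<xi>\<delta>"
    unfolding error_solution_def Let_def recon using z' w' wt' xi' by blast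
  assume t: "0 \<le> t"
  have xc: "x i t \<in> carrier_vec n" if "i < N" for i
    using sol that t by (auto simp: mas_solution_def has_derivative_traj_def)
  have ZT: "Z\<^sup>T \<in> carrier_mat (n - q) n" and WT: "W\<^sup>T \<in> carrier_mat q n" and RT: "R\<^sup>T \<in> carrier_mat (N - 1) N"
    using Z W R by auto
  have "stack N (n - q) (\<lambda>i. Z\<^sup>T *\<^sub>v x i t) = ZallT *\<^sub>v X t"
    unfolding X_def by (rule kron_one_mult_stack[OF ZT xc, symmetric])
  moreover have "finsum_vec TYPE(real) q (\<lambda>i. W\<^sup>T *\<^sub>v x i t) {..<N} = WallT *\<^sub>v X t"
    unfolding X_def by (rule ones_transpose_kron_mult_stack[OF WT xc, symmetric])
  moreover have "RqT *\<^sub>v stack N q (\<lambda>i. W\<^sup>T *\<^sub>v x i t) = RWT *\<^sub>v X t"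
  proof -
    have "stack N q (\<lambda>i. W\<^sup>T *\<^sub>v x i t) = (1\<^sub>m N \<otimes>\<^sub>K W\<^sup>T) *\<^sub>v X t"
      unfolding X_def by (rule kron_one_mult_stack[OF WT xc, symmetric])
    then show ?thesis
      by (simp only: kron_mult_vec[OF RT one_carrier_mat one_carrier_mat WT Xc]
          right_mult_one_mat[OF RT] left_mult_one_mat[OF WT])
  qed
  ultimately show "error_coords cpl N n q G E h Z W R zs ws kI x \<xi> t = z\<delta> t @\<^sub>v w\<delta> t @\<^sub>v wt t @\<^sub>v \<xi>\<delta> t"
    unfolding error_coords_def z\<delta>_def w\<delta>_def wt_def \<xi>\<delta>_def \<Xi>_def by simp
  have "X t = (assemble (z\<delta> t @\<^sub>v w\<delta> t) + xs) + RW *\<^sub>v wt t"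
    using recon[of t] error_state[OF z\<delta>c w\<delta>c wtc] by metis
  then have "X t - xs = (assemble (z\<delta> t @\<^sub>v w\<delta> t) + xs + RW *\<^sub>v wt t) - xs" by simp
  then show "X t - xs = assemble (z\<delta> t @\<^sub>v w\<delta> t) + RW *\<^sub>v wt t"
    unfolding vec_add_add_diff_mid[OF assemble_carrier mult_mat_vec_carrier[OF coordinate_matrices(3) wtc] xs_carrier] .
qed

lemma mas_exp_bound_of_error_exp_bound:
  assumes bound: "error_bound \<kappa> kP kI c r" and kI: "0 < kI"
  shows "mas_bound \<kappa> kP kI c r"
  unfolding mas_exp_bound_def
proof (intro allI impI)
  fix x \<xi> assume sol: "mas_solution cpl N n q G E h W \<kappa> kP kI x \<xi>"
  note m = mas_solution_error_coords[OF sol kI]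
  note b = bound[unfolded error_exp_bound_def exp_bound_def, rule_format, OF m(1)]
  show "exp_bound c r (error_coords cpl N n q G E h Z W R zs ws kI x \<xi>)"
    unfolding exp_bound_def
  proof (intro allI impI)
    fix t :: real assume t: "0 \<le> t"
    show "enorm (error_coords cpl N n q G E h Z W R zs ws kI x \<xi> t)
      \<le> c * exp (- r * t) * enorm (error_coords cpl N n q G E h Z W R zs ws kI x \<xi> 0)"
      unfolding m(2)[OF t] m(2)[OF order_refl] by (rule b[OF t])
  qed
qed

section \<open>Exponential convergence\<close>

text \<open>The error of one agent is a block of \<open>X t - xs\<close>, which is linear in the error coordinates.\<close>

lemma agents_converge_of_error_exp_bound:
  assumes bound: "error_bound \<kappa> kP kI c r" and kI: "0 < kI"
  shows "agents_converge cpl N n q G E h Z W zs ws \<kappa> kP kI r"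
  unfolding agents_converge_def
proof (intro allI impI)
  fix x \<xi> assume sol: "mas_solution cpl N n q G E h W \<kappa> kP kI x \<xi>"
  let ?e = "error_coords cpl N n q G E h Z W R zs ws kI x \<xi>"
  let ?X = "\<lambda>t. stack N n (\<lambda>i. x i t)"
  obtain ba where ba: "ba > 0" "\<And>e. e \<in> carrier_vec d \<Longrightarrow> enorm (assemble e) \<le> ba * enorm e"
    using assemble_bounded by blast
  obtain bR where bR: "bR > 0" "\<And>v. v \<in> carrier_vec dR \<Longrightarrow> enorm (RW *\<^sub>v v) \<le> bR * enorm v"
    using mult_mat_vec_enorm_bounded[of RW] carrier_matD[OF coordinate_matrices(3)] by auto
  have eb: "enorm (?e t) \<le> c * exp (- r * t) * enorm (?e 0)" if "0 \<le> t" for t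
    using mas_exp_bound_of_error_exp_bound[OF bound kI] sol that
    unfolding mas_exp_bound_def exp_bound_def by blast
  have Xb: "enorm (?X t - xs) \<le> (ba + bR) * enorm (?e t)" if t: "0 \<le> t" for t
  proof -
    note m = mas_solution_error_coords[OF sol kI]
    define z w u v where
      "z = ZallT *\<^sub>v ?X t - stack N (n - q) zs" and
      "w = (1 / real N) \<cdot>\<^sub>v (WallT *\<^sub>v ?X t) - ws" and
      "u = RWT *\<^sub>v ?X t" and
      "v = RqT *\<^sub>v stack N q (\<lambda>i. \<xi> i t) - xis kI"
    have X: "?X t - xs = assemble (z @\<^sub>v w) + RW *\<^sub>v u" and e: "?e t = z @\<^sub>v w @\<^sub>v u @\<^sub>v v"
      using m(3)[OF t] m(2)[OF t] unfolding z_def w_def u_def v_def by blast+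
    have uc: "u \<in> carrier_vec dR"
      unfolding u_def by (rule mult_mat_vec_carrier[OF coordinate_matrices(6) stack_carrier])
    have zw: "z @\<^sub>v w \<in> carrier_vec d"
      unfolding z_def w_def
      using mult_mat_vec_carrier[OF coordinate_matrices(4) stack_carrier]
          mult_mat_vec_carrier[OF coordinate_matrices(5) stack_carrier] equil_carrier(2)
      by auto
    have sq: "(enorm (?e t))\<^sup>2 = (enorm (z @\<^sub>v w))\<^sup>2 + ((enorm u)\<^sup>2 + (enorm v)\<^sup>2)"
      unfolding e by (simp add: enorm_append_square)
    have le: "enorm (z @\<^sub>v w) \<le> enorm (?e t)" "enorm u \<le> enorm (?e t)"
      by (rule power2_le_imp_le; simp add: sq)+
    have "enorm (?X t - xs) \<le> enorm (assemble (z @\<^sub>v w)) + enorm (RW *\<^sub>v u)"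
      unfolding X by (rule enorm_triangle[OF assemble_carrier
          mult_mat_vec_carrier[OF coordinate_matrices(3) uc]])
    also have "\<dots> \<le> ba * enorm (z @\<^sub>v w) + bR * enorm u" by (intro add_mono ba(2)[OF zw] bR(2)[OF uc])
    also have "\<dots> \<le> ba * enorm (?e t) + bR * enorm (?e t)"
      using ba(1) bR(1) le by (intro add_mono mult_left_mono) auto
    finally show ?thesis by (simp add: distrib_right)
  qed
  have "enorm (x i t - (Z *\<^sub>v zs i + W *\<^sub>v ws)) \<le> (ba + bR) * (c * enorm (?e 0)) * exp (- r * t)"
    if i: "i < N" and t: "0 \<le> t" for i t
  proof -
    have xc: "x j t \<in> carrier_vec n" if "j < N" for j
      using sol that t by (auto simp: mas_solution_def has_derivative_traj_def)
    have sc: "Z *\<^sub>v zs j + W *\<^sub>v ws \<in> carrier_vec n" if "j < N" for j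
      using Z W equil_carrier that by auto
    have "?X t - xs = stack N n (\<lambda>j. x j t - (Z *\<^sub>v zs j + W *\<^sub>v ws))"
      unfolding xs_stack by (rule stack_diff[symmetric]) (rule xc sc, assumption)+
    then have "(enorm (?X t - xs))\<^sup>2 = (\<Sum>j<N. (enorm (x j t - (Z *\<^sub>v zs j + W *\<^sub>v ws)))\<^sup>2)"
      using enorm_stack_square[of N "\<lambda>j. x j t - (Z *\<^sub>v zs j + W *\<^sub>v ws)" n] xc sc by simp
    moreover have "(enorm (x i t - (Z *\<^sub>v zs i + W *\<^sub>v ws)))\<^sup>2 \<le> (\<Sum>j<N. (enorm (x j t - (Z *\<^sub>v zs j + W *\<^sub>v ws)))\<^sup>2)"
      using i by (intro member_le_sum) auto
    ultimately have "enorm (x i t - (Z *\<^sub>v zs i + W *\<^sub>v ws)) \<le> enorm (?X t - xs)"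
      by - (rule power2_le_imp_le[OF _ enorm_nonneg], simp)
    also have "\<dots> \<le> (ba + bR) * enorm (?e t)" by (rule Xb[OF t])
    also have "\<dots> \<le> (ba + bR) * (c * exp (- r * t) * enorm (?e 0))"
      using ba(1) bR(1) by (intro mult_left_mono eb t) auto
    finally show ?thesis by (simp add: mult_ac)
  qed
  then show "\<exists>C. \<forall>i<N. \<forall>t\<ge>0. enorm (x i t - (Z *\<^sub>v zs i + W *\<^sub>v ws)) \<le> C * exp (- r * t)" by blast
qed

lemma bounds_of_error_bound:
  assumes bound: "\<exists>c. error_bound \<kappa> kP kI c r" and kI: "0 < kI"
  shows "(\<exists>c. error_bound \<kappa> kP kI c r \<and> mas_bound \<kappa> kP kI c r) \<and>
    agents_converge cpl N n q G E h Z W zs ws \<kappa> kP kI r"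
  using bound mas_exp_bound_of_error_exp_bound[OF _ kI] agents_converge_of_error_exp_bound[OF _ kI] by blast

lemma convergence_for_fixed_gains:
  assumes ges: "blended_ges N n q h Z W zs ws \<mu>" and \<mu>: "0 < \<mu>" and gains: "0 < \<kappa>" "0 < kI"
  shows "\<exists>kPs>0. \<forall>kP>kPs. \<exists>r>0. (\<exists>c. error_bound \<kappa> kP kI c r \<and> mas_bound \<kappa> kP kI c r) \<and>
    agents_converge cpl N n q G E h Z W zs ws \<kappa> kP kI r"
proof -
  \<comment> \<open>only positivity of the final rate matters, so any \<open>\<rho>\<close> below \<open>\<mu>\<close> serves\<close>
  have \<rho>: "0 < \<mu> / 2" "\<mu> / 2 < \<mu>" using \<mu> by auto
  obtain b c L \<gamma> where pos: "0 < b" "0 < c" "0 < L"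
    and bound: "\<And>kP kI \<kappa> \<alpha> \<beta> \<epsilon> r. 0 \<le> kP \<Longrightarrow> 0 \<le> kI \<Longrightarrow> 0 \<le> \<kappa> \<Longrightarrow>
      decay_certificate b c L \<gamma> (\<mu> / 2) kP kI \<kappa> \<alpha> \<beta> \<epsilon> r \<Longrightarrow> \<exists>C. error_bound \<kappa> kP kI C r"
    using error_exp_bound_of_certificate[OF ges \<rho>] by metis
  obtain k0 where k0: "k0 > 0"
    "\<And>kP. kP > k0 \<Longrightarrow> \<exists>r>0. \<exists>\<alpha> \<beta> \<epsilon>. decay_certificate b c L \<gamma> (\<mu> / 2) kP kI \<kappa> \<alpha> \<beta> \<epsilon> r"
    using decay_certificate_fixed_gains[of b c L \<kappa> kI "\<mu> / 2" \<gamma>] pos gains \<rho> by blast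
  have "\<exists>r>0. \<exists>C. error_bound \<kappa> kP kI C r" if kP: "kP > k0" for kP
  proof -
    obtain r \<alpha> \<beta> \<epsilon> where r: "r > 0" "decay_certificate b c L \<gamma> (\<mu> / 2) kP kI \<kappa> \<alpha> \<beta> \<epsilon> r"
      using k0(2)[OF kP] by blast
    have "\<exists>C. error_bound \<kappa> kP kI C r" by (rule bound[OF _ _ _ r(2)]) (use gains k0(1) kP in auto)
    with r(1) show ?thesis by blast
  qed
  with k0(1) bounds_of_error_bound gains(2) show ?thesis by metis
qed

lemma convergence_rate_for_proportional_gains:
  assumes ges: "blended_ges N n q h Z W zs ws \<mu>" and \<phi>: "0 < \<phi>" and \<upsilon>: "0 < \<upsilon>" "\<upsilon> < \<mu>"
  shows "\<exists>kPs>0. \<forall>kP>kPs. (\<exists>c. error_bound (\<phi> * kP) kP (\<phi> * kP) c (\<mu> - \<upsilon>) \<and>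
      mas_bound (\<phi> * kP) kP (\<phi> * kP) c (\<mu> - \<upsilon>)) \<and>
    agents_converge cpl N n q G E h Z W zs ws (\<phi> * kP) kP (\<phi> * kP) (\<mu> - \<upsilon>)"
proof -
  \<comment> \<open>strictly between the rate to be attained and \<open>\<mu>\<close>\<close>
  define \<rho> where "\<rho> = \<mu> - \<upsilon> / 2"
  have \<rho>: "0 < \<rho>" "\<rho> < \<mu>" and r: "0 \<le> \<mu> - \<upsilon>" "\<mu> - \<upsilon> < \<rho>" using \<upsilon> by (auto simp: \<rho>_def)
  obtain b c L \<gamma> where pos: "0 < b" "0 < c" "0 < L"
    and bound: "\<And>kP kI \<kappa> \<alpha> \<beta> \<epsilon> r. 0 \<le> kP \<Longrightarrow> 0 \<le> kI \<Longrightarrow> 0 \<le> \<kappa> \<Longrightarrow>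
      decay_certificate b c L \<gamma> \<rho> kP kI \<kappa> \<alpha> \<beta> \<epsilon> r \<Longrightarrow> \<exists>C. error_bound \<kappa> kP kI C r"
    using error_exp_bound_of_certificate[OF ges \<rho>] by metis
  obtain k0 where k0: "k0 > 0" "\<And>kP. kP > k0 \<Longrightarrow>
      \<exists>\<alpha> \<beta> \<epsilon>. decay_certificate b c L \<gamma> \<rho> kP (\<phi> * kP) (\<phi> * kP) \<alpha> \<beta> \<epsilon> (\<mu> - \<upsilon>)"
    using decay_certificate_proportional_gains[of b c L \<phi> "\<mu> - \<upsilon>" \<rho> \<gamma>] pos \<phi> r by blast
  have "\<exists>C. error_bound (\<phi> * kP) kP (\<phi> * kP) C (\<mu> - \<upsilon>) \<and> 0 < \<phi> * kP" if kP: "kP > k0" for kP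
  proof -
    have pk: "0 < kP" "0 < \<phi> * kP" using \<phi> k0(1) kP by auto
    obtain \<alpha> \<beta> \<epsilon> where cert: "decay_certificate b c L \<gamma> \<rho> kP (\<phi> * kP) (\<phi> * kP) \<alpha> \<beta> \<epsilon> (\<mu> - \<upsilon>)"
      using k0(2)[OF kP] by blast
    have "\<exists>C. error_bound (\<phi> * kP) kP (\<phi> * kP) C (\<mu> - \<upsilon>)"
      by (rule bound[OF _ _ _ cert]) (use pk in auto)
    with pk show ?thesis by blast
  qed
  with k0(1) bounds_of_error_bound show ?thesis by metis
qed

end

lemma full_row_rank_imp_le:
  fixes E :: "real mat"
  assumes E: "E \<in> carrier_mat q n" and r: "vec_space.rank q E = q"
  shows "q \<le> n"
proof -
  interpret vec_space "TYPE(real)" q .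
  show ?thesis using rank_le_nc[OF E] r by simp
qed

theorem theorem1:
  fixes N n q :: nat and G :: "(nat \<times> nat) set" and E :: "real mat" and cpl :: coupling
  assumes "0 < N"
    and "connected_graph N G"
    and "E \<in> carrier_mat q n"
    and "vec_space.rank q E = q"
  shows "\<exists>\<phi>bar>0. \<forall>(h :: nat \<Rightarrow> real vec \<Rightarrow> real vec) Z W R zs ws (\<mu> :: real).
    (\<forall>i<N. globally_lipschitz n (h i)) \<and>
    Z \<in> carrier_mat n (n - q) \<and> orthonormal_basis_cols Z (mat_kernel E) \<and>
    W \<in> carrier_mat n q \<and>
    orthonormal_basis_cols W (vec_module.orthogonal_complement n (mat_kernel E)) \<and>
    R \<in> carrier_mat N (N - 1) \<and> orthonormal_basis_cols R (mat_kernel ((ones N)\<^sup>T)) \<and>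
    unique_blended_equilibrium N n q h Z W zs ws \<and>
    0 < \<mu> \<and> blended_ges N n q h Z W zs ws \<mu>
    \<longrightarrow>
    (\<forall>\<kappa> kI. 0 < \<kappa> \<and> 0 < kI \<and> kI < 2 * \<kappa> \<longrightarrow>
       (\<exists>kPs>0. \<forall>kP>kPs. \<exists>r>0.
          (\<exists>c. error_exp_bound cpl N n q G E h Z W R zs ws \<kappa> kP kI c r \<and>
               mas_exp_bound cpl N n q G E h Z W R zs ws \<kappa> kP kI c r) \<and>
          agents_converge cpl N n q G E h Z W zs ws \<kappa> kP kI r)) \<and>
    (\<forall>\<phi> \<upsilon>. 0 < \<phi> \<and> \<phi> < \<phi>bar \<and> 0 < \<upsilon> \<and> \<upsilon> < \<mu> \<longrightarrow>
       (\<exists>kPss>0. \<forall>kP>kPss.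
          (\<exists>c. error_exp_bound cpl N n q G E h Z W R zs ws (\<phi> * kP) kP (\<phi> * kP) c (\<mu> - \<upsilon>) \<and>
               mas_exp_bound cpl N n q G E h Z W R zs ws (\<phi> * kP) kP (\<phi> * kP) c (\<mu> - \<upsilon>)) \<and>
          agents_converge cpl N n q G E h Z W zs ws (\<phi> * kP) kP (\<phi> * kP) (\<mu> - \<upsilon>)))"
proof (rule exI[of _ 1], rule conjI, simp, intro allI impI, elim conjE, goal_cases)
  \<comment> \<open>the certificate exists for every positive ratio of the gains, so any positive threshold serves\<close>
  case (1 h Z W R zs ws \<mu>)
  interpret blended_setup cpl N n q G E h Z W R zs ws
    using assms 1 full_row_rank_imp_le[OF assms(3,4)]
    by unfold_locales (auto simp: unique_blended_equilibrium_def)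
  have "0 < \<mu>" "blended_ges N n q h Z W zs ws \<mu>" using 1 by blast+
  then show ?case
    using convergence_for_fixed_gains convergence_rate_for_proportional_gains
        by (intro conjI allI impI) simp_all
qed

end
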